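(* Let $0<s<1$, $n\ge1$, $m\ge1$, $p>1$, and let $v=(v_1,\dots,v_m)$ with $v_i\in C^2(\mathbb{R}^{n+1}_+)\cap C(\overline{\mathbb{R}^{n+1}_+})$ and $y^{1-2s}\partial_y v_i\in C(\overline{\mathbb{R}^{n+1}_+})$ be a solution of $$\begin{cases}\nabla\cdot(y^{1-2s}\nabla v_i)=0&\text{in }\mathbb{R}^{n+1}_+,\\ -\lim_{y\to0}y^{1-2s}\partial_y v_i=\kappa_s|v|^{p-1}v_i&\text{on }\partial\mathbb{R}^{n+1}_+,\end{cases}\qquad i=1,\dots,m,$$ where $\kappa_s=\frac{\Gamma(1-s)}{2^{2s-1}\Gamma(s)}$ and $|v|=(\sum_i v_i^2)^{1/2}$. For $x_0\in\partial\mathbb{R}^{n+1}_+$ and $\lambda>0$, writing $B_\lambda=B_\lambda(x_0)\subset\mathbb{R}^{n+1}$, define $$E_s(v,\lambda,x_0):=\lambda^{\frac{2s(p+1)}{p-1}-n}\Big(\frac12\int_{\mathbb{R}^{n+1}_+\cap B_\lambda}y^{1-2s}\sum_{i=1}^m|\nabla v_i|^2\,dx\,dy-\frac{\kappa_s}{p+1}\int_{\partial\mathbb{R}^{n+1}_+\cap B_\lambda}|v|^{p+1}dx\Big)+\lambda^{\frac{2s(p+1)}{p-1}-n-1}\frac{s}{p-1}\int_{\partial B_\lambda\cap\mathbb{R}^{n+1}_+}y^{1-2s}|v|^2\,d\sigma.$$ Then $E_s(v,\cdot,x_0)$ is nondecreasing in $\lambda$, and $$\frac{dE_s}{d\lambda}=\lambda^{\frac{2s(p+1)}{p-1}-n}\int_{\partial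 B_\lambda(x_0)\cap\mathbb{R}^{n+1}_+}y^{1-2s}\sum_{i=1}^m\Big(\frac{\partial v_i}{\partial r}+\frac{2s}{p-1}\frac{v_i}{r}\Big)^2d\sigma,$$ where $r=|(x,y)-x_0|$ and $\frac{\partial}{\partial r}$ is the radial derivative centred at $x_0$.
   Context: $\mathbb{R}^{n+1}_+=\{(x,y):x\in\mathbb{R}^n,\ y>0\}$, and $\partial\mathbb{R}^{n+1}_+=\{y=0\}$ is identified with $\mathbb{R}^n$; on it $v_i$ denotes the boundary trace. *)

theory Defs
  imports "HOL-Analysis.Analysis"
begin

text \<open>Points of R^{n+1} are pairs (x,y) with x :: real^'n, y :: real.
  Partial derivative of f at z in direction b (Frechet derivative applied to b).\<close>
definition partial :: "('a::euclidean_space \<Rightarrow> real) \<Rightarrow> 'a \<Rightarrow> 'a \<Rightarrow> real" where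
  "partial f b z = frechet_derivative f (at z) b"

definition grad :: "('a::euclidean_space \<Rightarrow> real) \<Rightarrow> 'a \<Rightarrow> 'a" where
  "grad f z = (\<Sum>b\<in>Basis. partial f b z *\<^sub>R b)"

definition C2_on :: "'a::euclidean_space set \<Rightarrow> ('a \<Rightarrow> real) \<Rightarrow> bool" where
  "C2_on U f \<longleftrightarrow> (\<forall>z\<in>U. f differentiable (at z))
     \<and> (\<forall>b\<in>Basis. \<forall>z\<in>U. partial f b differentiable (at z))
     \<and> (\<forall>b\<in>Basis. \<forall>c\<in>Basis. continuous_on U (partial (partial f b) c))"

definition upper :: "((real^'n) \<times> real) set" where
  "upper = {z. snd z > 0}"

definition upper_cl :: "((real^'n) \<times> real) set" where
  "upper_cl = {z. snd z \<ge> 0}"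

text \<open>Integral over the sphere of radius r centred at c with respect to surface
  measure, via the cone-measure formula
  int_{S_r(c)} F d sigma = N r^(N-1) int_{B_1(0)} F(c + r z/|z|) dz,  N = dimension.\<close>
definition sphere_integral :: "('a::euclidean_space \<Rightarrow> real) \<Rightarrow> 'a \<Rightarrow> real \<Rightarrow> real" where
  "sphere_integral F c r =
     real DIM('a) * r ^ (DIM('a) - 1) *
       (LINT z : ball 0 1 | lborel. F (c + r *\<^sub>R (z /\<^sub>R norm z)))"

definition kappa :: "real \<Rightarrow> real" where
  "kappa s = Gamma (1 - s) / (2 powr (2 * s - 1) * Gamma s)"

definition vnorm :: "nat \<Rightarrow> (nat \<Rightarrow> 'a \<Rightarrow> real) \<Rightarrow> 'a \<Rightarrow> real" where
  "vnorm m v z = sqrt (\<Sum>i<m. (v i z)\<^sup>2)"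

definition Es :: "real \<Rightarrow> real \<Rightarrow> nat \<Rightarrow> (nat \<Rightarrow> (real^'n) \<times> real \<Rightarrow> real)
                  \<Rightarrow> real \<Rightarrow> (real^'n) \<times> real \<Rightarrow> real" where
  "Es s p m v lam x0 =
     (let a = 2 * s*(p+1)/(p-1) - real CARD('n) in
      lam powr a *
        (1/2 * (LINT z : upper \<inter> ball x0 lam | lborel.
                  snd z powr (1 - 2 * s) * (\<Sum>i<m. (norm (grad (v i) z))\<^sup>2))
         - kappa s / (p+1) * (LINT x : {x. (x, 0) \<in> ball x0 lam} | lborel.
                  vnorm m v (x, 0) powr (p+1)))
      + lam powr (a - 1) * (s / (p-1)) *
        sphere_integral (\<lambda>z. indicator upper z * (snd z powr (1 - 2 * s) * (vnorm m v z)\<^sup>2)) x0 lam)"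

end

theory Submission
  imports Defs
begin

text \<open>
  Put \<open>c = 2s/(p-1)\<close> and blow up: \<open>w\<^sub>\<lambda>(z) = \<lambda>\<^sup>c v(x\<^sub>0 + \<lambda>z)\<close> solves the same system, and
  \<open>E\<^sub>s(v,\<lambda>,x\<^sub>0) = E\<^sub>s(w\<^sub>\<lambda>,1,0)\<close>, so that only half-balls of radius 1 occur. For two
  parameters the difference of the Dirichlet energies is the integral of
  \<open>y\<^sup>1\<^sup>-\<^sup>2\<^sup>s \<nabla>(w\<^sub>\<lambda> - w\<^sub>\<mu>) \<cdot> \<nabla>(w\<^sub>\<lambda> + w\<^sub>\<mu>)\<close>, which Green's identity turns into an integral over the
  half-sphere that contains radial derivatives only, plus a flat boundary integral. Together with the
  potential term the latter is the error of the trapezoidal rule for the nonlinearity, hence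
  \<open>O(|\<lambda> - \<mu>|\<^sup>2)\<close>. Dividing by \<open>\<lambda> - \<mu>\<close> and passing to the limit gives the derivative; no
  Pohozaev identity is needed.

  The limits require that the tangential gradient is bounded up to the flat boundary, which is not
  among the hypotheses. It follows from Brandt's argument: the maximum principle for
  \<open>v(x+te,y) - v(x-te,y)\<close> as a function of \<open>(x,y,t)\<close> improves a Hoelder exponent \<open>\<alpha>\<close> in the
  direction \<open>e\<close> to \<open>min (\<alpha> + 2s) 1\<close>, and finitely many steps reach Lipschitz continuity.
\<close>

section \<open>Degenerate elliptic equations on the half-space\<close>

text \<open>Differentiating the energy directly produces the full gradient on the half-sphere;
  polarising first leaves only radial derivatives there. The price is that the blow-up family must
  be Lipschitz in its parameter up to the flat boundary. Its parameter derivative is (c w + z . grad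
  w) / \<lambda>. The normal part of this is harmless: y d_y v is y^(2s) times the weighted flux,
  which is continuous up to the boundary by hypothesis. The tangential part is where regularity is
  lacking; the same bound also makes the Dirichlet energy finite, which is not assumed either.

  The exponent satisfies c p = c + 2s, so that flux and nonlinearity scale alike. The coefficient
  s/(p-1) = c/2 of the surface term completes the square: the difference quotient of w tends to (c w
  + w_r) / \<lambda>, and it is multiplied by w_r + 2 (c/2) w. The trapezoidal error is quadratic
  because |v|^(p-1) v, the gradient of |v|^(p+1)/(p+1), is locally Lipschitz.\<close>

lemma open_upper: "open (upper :: ((real^'n) \<times> real) set)"
  unfolding upper_def by (intro open_Collect_less continuous_intros)

lemma upper_subset_cl: "upper \<subseteq> upper_cl"
  by (auto simp: upper_def upper_cl_def)

lemma compact_half_ball: "compact (upper_cl \<inter> cball 0 R :: ((real^'n) \<times> real) set)"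
proof -
  have "closed (upper_cl :: ((real^'n) \<times> real) set)"
    unfolding upper_cl_def by (intro closed_Collect_le continuous_intros)
  then show ?thesis by (rule closed_Int_compact) simp
qed

lemma partial_has_derivative:
  "f differentiable (at z) \<Longrightarrow> (f has_derivative (\<lambda>d. partial f d z)) (at z)"
  unfolding partial_def by (simp add: frechet_derivative_works[symmetric])

lemma partial_eqI: "(f has_derivative f') (at z) \<Longrightarrow> partial f b z = f' b"
  unfolding partial_def using frechet_derivative_at by metis

lemma grad_inner_Basis: "b \<in> Basis \<Longrightarrow> grad f z \<bullet> b = partial f b z"
  unfolding grad_def by (simp add: inner_sum_left inner_Basis if_distrib cong: if_cong)

lemma partial_eq_grad_inner:
  assumes "f differentiable (at z)"
  shows "partial f d z = grad f z \<bullet> d"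
proof -
  interpret D: linear "\<lambda>d. partial f d z"
    using partial_has_derivative[OF assms] has_derivative_linear by blast
  have "partial f d z = partial f (\<Sum>b\<in>Basis. (d \<bullet> b) *\<^sub>R b) z"
    by (simp add: euclidean_representation)
  also have "\<dots> = (\<Sum>b\<in>Basis. (d \<bullet> b) * partial f b z)"
    by (simp add: D.sum D.scaleR)
  also have "\<dots> = grad f z \<bullet> d"
    unfolding grad_def by (simp add: inner_sum_left inner_commute[of d] mult.commute)
  finally show ?thesis .
qed

lemma has_real_derivative_line:
  assumes "f differentiable (at (z + r *\<^sub>R d))"
  shows "((\<lambda>r. f (z + r *\<^sub>R d)) has_real_derivative partial f d (z + r *\<^sub>R d)) (at r)"
proof -
  have L: "((\<lambda>r. z + r *\<^sub>R d) has_derivative (\<lambda>x. x *\<^sub>R d)) (at r)"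
    by (auto intro!: derivative_eq_intros)
  have "((\<lambda>r. f (z + r *\<^sub>R d)) has_derivative (\<lambda>x. partial f (x *\<^sub>R d) (z + r *\<^sub>R d))) (at r)"
    by (rule has_derivative_compose[of "\<lambda>r. z + r *\<^sub>R d" "\<lambda>x. x *\<^sub>R d" r UNIV f, OF L
          partial_has_derivative[OF assms]])
  moreover have "partial f (x *\<^sub>R d) (z + r *\<^sub>R d) = partial f d (z + r *\<^sub>R d) * x" for x
    by (simp add: partial_eq_grad_inner[OF assms])
  ultimately show ?thesis by (simp add: has_field_derivative_def)
qed

lemma C2_onD:
  assumes "C2_on U f" "z \<in> U"
  shows "f differentiable (at z)" "b \<in> Basis \<Longrightarrow> partial f b differentiable (at z)"
  using assms unfolding C2_on_def by auto

lemma C2_on_continuous: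
  assumes "C2_on U f"
  shows "continuous_on U f" "b \<in> Basis \<Longrightarrow> continuous_on U (partial f b)"
    "b \<in> Basis \<Longrightarrow> d \<in> Basis \<Longrightarrow> continuous_on U (partial (partial f b) d)"
  using assms unfolding C2_on_def
  by (auto intro!: continuous_at_imp_continuous_on differentiable_imp_continuous_within)

lemma C2_on_continuous_grad: "C2_on U f \<Longrightarrow> continuous_on U (grad f)"
  unfolding grad_def by (intro continuous_intros C2_on_continuous(2))

lemma sum_Basis_half_space:
  "(\<Sum>b\<in>(Basis :: ((real^'n) \<times> real) set). h b) = (\<Sum>b\<in>Basis. h (b, 0)) + h (0, 1)"
  by (simp add: Basis_prod_def sum.union_disjoint sum.reindex inj_on_def disjoint_iff image_iff add.commute) 

lemma weighted_partial:
  fixes f :: "(real^'n) \<times> real \<Rightarrow> real"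
  assumes f: "C2_on upper f" and z: "z \<in> upper" and b: "b \<in> Basis"
  shows "((\<lambda>w. snd w powr a * partial f b w) has_derivative
    (\<lambda>d. snd z powr a * partial (partial f b) d z + a * snd z powr (a - 1) * snd d * partial f b z)) (at z)"
proof -
  have z0: "snd z > 0" using z by (simp add: upper_def)
  note D = partial_has_derivative[OF C2_onD(2)[OF f z b]]
  show ?thesis
    by (rule has_derivative_eq_rhs, (rule derivative_intros D | simp add: z0)+)
       (use z0 in \<open>auto simp: fun_eq_iff powr_diff field_simps\<close>)
qed

text \<open>Only the interior equation, which is linear and does not couple the components, so a
  single function suffices. The nonlinear coupling sits in the flux, which is carried
  separately.\<close>

definition solves :: "real \<Rightarrow> ((real^'n) \<times> real \<Rightarrow> real) \<Rightarrow> bool" where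
  "solves a f \<longleftrightarrow> C2_on upper f \<and> (\<forall>z\<in>upper.
     (\<Sum>b\<in>Basis. partial (\<lambda>w. snd w powr a * partial f b w) b z) = 0)"

text \<open>Product rule, then division by y^a > 0. The divergence form serves integration by parts;
  this form serves the maximum principle and the scaling check.\<close>

lemma solves_iff_nondivergence_form:
  fixes f :: "(real^'n) \<times> real \<Rightarrow> real"
  shows "solves a f \<longleftrightarrow> C2_on upper f \<and> (\<forall>z\<in>upper.
    (\<Sum>b\<in>Basis. partial (partial f (b, 0)) (b, 0) z) + partial (partial f (0, 1)) (0, 1) z
    + a / snd z * partial f (0, 1) z = 0)"
proof -
  have "(\<Sum>b\<in>Basis. partial (\<lambda>w. snd w powr a * partial f b w) b z) = 0 \<longleftrightarrow>
    (\<Sum>b\<in>Basis. partial (partial f (b, 0)) (b, 0) z) + partial (partial f (0, 1)) (0, 1) z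
    + a / snd z * partial f (0, 1) z = 0" if f: "C2_on upper f" and z: "z \<in> upper" for z
  proof -
    have z0: "snd z > 0" using z by (simp add: upper_def)
    have "(\<Sum>b\<in>Basis. partial (\<lambda>w. snd w powr a * partial f b w) b z)
      = (\<Sum>b\<in>Basis. snd z powr a * partial (partial f b) b z
        + a * snd z powr (a - 1) * snd b * partial f b z)"
      by (intro sum.cong refl partial_eqI weighted_partial[OF f z])
    also have "\<dots> = snd z powr a * ((\<Sum>b\<in>Basis. partial (partial f (b, 0)) (b, 0) z)
      + partial (partial f (0, 1)) (0, 1) z + a / snd z * partial f (0, 1) z)"
      using z0 by (simp add: sum_Basis_half_space sum_distrib_left powr_diff algebra_simps)
    finally show ?thesis using z0 by simp
  qed
  then show ?thesis unfolding solves_def by blast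
qed

lemma solves_nondivergence_form:
  fixes f :: "(real^'n) \<times> real \<Rightarrow> real"
  assumes "solves a f" and "z \<in> upper"
  shows "(\<Sum>b\<in>Basis. partial (partial f (b, 0)) (b, 0) z) + partial (partial f (0, 1)) (0, 1) z
    + a / snd z * partial f (0, 1) z = 0"
  using assms solves_iff_nondivergence_form[of a f] by blast

lemma has_derivative_rescale:
  fixes f :: "'a::euclidean_space \<Rightarrow> real"
  assumes "f differentiable (at (x0 + l *\<^sub>R z))"
  shows "((\<lambda>z. c * f (x0 + l *\<^sub>R z)) has_derivative (\<lambda>d. c * l * partial f d (x0 + l *\<^sub>R z))) (at z)"
proof -
  have L: "((\<lambda>z. x0 + l *\<^sub>R z) has_derivative (\<lambda>d. l *\<^sub>R d)) (at z)"
    by (auto intro!: derivative_eq_intros)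
  have "((\<lambda>z. c * f (x0 + l *\<^sub>R z)) has_derivative (\<lambda>d. c * partial f (l *\<^sub>R d) (x0 + l *\<^sub>R z))) (at z)"
    by (rule has_derivative_mult_right,
        rule has_derivative_compose[of "\<lambda>z. x0 + l *\<^sub>R z" "\<lambda>d. l *\<^sub>R d" z UNIV f, OF L
          partial_has_derivative[OF assms]])
  then show ?thesis by (simp add: partial_eq_grad_inner[OF assms] mult.assoc)
qed

lemma upper_rescale:
  "snd x0 = 0 \<Longrightarrow> l > 0 \<Longrightarrow> x0 + l *\<^sub>R z \<in> upper \<longleftrightarrow> z \<in> upper"
  "snd x0 = 0 \<Longrightarrow> l > 0 \<Longrightarrow> x0 + l *\<^sub>R z \<in> upper_cl \<longleftrightarrow> z \<in> upper_cl"
  by (auto simp: upper_def upper_cl_def zero_less_mult_iff zero_le_mult_iff)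

lemma partial_rescale:
  fixes f :: "'a::euclidean_space \<Rightarrow> real"
  assumes "f differentiable (at (x0 + l *\<^sub>R z))"
  shows "partial (\<lambda>z. c * f (x0 + l *\<^sub>R z)) d z = c * l * partial f d (x0 + l *\<^sub>R z)"
  by (rule partial_eqI[OF has_derivative_rescale[OF assms]])

lemma second_partial_rescale:
  fixes f :: "(real^'n) \<times> real \<Rightarrow> real"
  assumes f: "C2_on upper f" and l: "l > 0" and x0: "snd x0 = 0" and z: "z \<in> upper" and b: "b \<in> Basis"
  shows "(partial (\<lambda>z. c * f (x0 + l *\<^sub>R z)) b has_derivative
     (\<lambda>d. c * l * l * partial (partial f b) d (x0 + l *\<^sub>R z))) (at z)"
proof (rule has_derivative_transform_within_open[OF _ open_upper z])
  have up: "x0 + l *\<^sub>R z \<in> upper" if "z \<in> upper" for z using that upper_rescale(1)[OF x0 l] by simp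
  show "((\<lambda>z. c * l * partial f b (x0 + l *\<^sub>R z)) has_derivative
     (\<lambda>d. c * l * l * partial (partial f b) d (x0 + l *\<^sub>R z))) (at z)"
    by (rule has_derivative_rescale[OF C2_onD(2)[OF f up[OF z] b]])
  show "c * l * partial f b (x0 + l *\<^sub>R w) = partial (\<lambda>z. c * f (x0 + l *\<^sub>R z)) b w" if "w \<in> upper" for w
    by (simp add: partial_rescale[OF C2_onD(1)[OF f up[OF that]]])
qed

text \<open>In nondivergence form every term picks up the same factor \<open>c * l * l\<close>: the
  coefficient a / y is homogeneous of degree -1, and since the dilation is centred on the flat
  boundary it multiplies heights by \<open>l\<close>. The case of dilation factor 1 about the origin
  covers multiplication by a constant.\<close>

lemma solves_rescale:
  fixes f :: "(real^'n) \<times> real \<Rightarrow> real"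
  assumes f: "solves a f" and l: "l > 0" and x0: "snd x0 = 0"
  shows "solves a (\<lambda>z. c * f (x0 + l *\<^sub>R z))"
proof -
  have C2: "C2_on upper f" using f by (simp add: solves_def)
  have up: "x0 + l *\<^sub>R z \<in> upper" if "z \<in> upper" for z using that upper_rescale(1)[OF x0 l] by simp
  let ?F = "\<lambda>z. c * f (x0 + l *\<^sub>R z)"
  have p1: "partial ?F d z = c * l * partial f d (x0 + l *\<^sub>R z)" if "z \<in> upper" for z d
    by (rule partial_rescale[OF C2_onD(1)[OF C2 up[OF that]]])
  note D2 = second_partial_rescale[OF C2 l x0]
  have p2: "partial (partial ?F b) d z = c * l * l * partial (partial f b) d (x0 + l *\<^sub>R z)"
    if "z \<in> upper" "b \<in> Basis" for z b d
    by (rule partial_eqI[OF D2[OF that]])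
  have "C2_on upper ?F"
    unfolding C2_on_def
  proof (intro conjI ballI)
    fix z :: "(real^'n) \<times> real" assume z: "z \<in> upper"
    show "?F differentiable at z"
      using has_derivative_rescale[OF C2_onD(1)[OF C2 up[OF z]]] differentiableI by blast
    fix b :: "(real^'n) \<times> real" assume b: "b \<in> Basis"
    show "partial ?F b differentiable at z" using D2[OF z b] differentiableI by blast
  next
    fix b d :: "(real^'n) \<times> real" assume b: "b \<in> Basis" "d \<in> Basis"
    have "continuous_on upper (\<lambda>z. c * l * l * partial (partial f b) d (x0 + l *\<^sub>R z))"
      by (intro continuous_intros continuous_on_compose2[OF C2_on_continuous(3)[OF C2 b]]) (use up in blast)
    then show "continuous_on upper (partial (partial ?F b) d)"
      by (rule continuous_on_eq) (simp add: p2 b)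
  qed
  moreover have "(\<Sum>b\<in>Basis. partial (partial ?F (b, 0)) (b, 0) z) + partial (partial ?F (0, 1)) (0, 1) z
    + a / snd z * partial ?F (0, 1) z = 0" if z: "z \<in> upper" for z
  proof -
    have z0: "snd z > 0" using z by (simp add: upper_def)
    let ?w = "x0 + l *\<^sub>R z"
    have "(\<Sum>b\<in>Basis. partial (partial ?F (b, 0)) (b, 0) z) + partial (partial ?F (0, 1)) (0, 1) z
       + a / snd z * partial ?F (0, 1) z
      = c * l * l * ((\<Sum>b\<in>Basis. partial (partial f (b, 0)) (b, 0) ?w) + partial (partial f (0, 1)) (0, 1) ?w
       + a / snd ?w * partial f (0, 1) ?w)"
      using z0 l x0 by (simp add: p1 p2 z Basis_prod_def sum_distrib_left distrib_left)
    then show ?thesis using solves_nondivergence_form[OF f up[OF z]] by simp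
  qed
  ultimately show ?thesis by (simp add: solves_iff_nondivergence_form)
qed

section \<open>Tangential Lipschitz regularity\<close>

lemma local_max_derivatives:
  fixes u u' :: "real \<Rightarrow> real"
  assumes d: "d > 0" and le: "\<And>r. \<bar>r - c\<bar> < d \<Longrightarrow> u r \<le> u c"
    and u: "\<And>r. \<bar>r - c\<bar> < d \<Longrightarrow> (u has_real_derivative u' r) (at r)"
    and u': "(u' has_real_derivative D) (at c)"
  shows "u' c = 0" "D \<le> 0"
proof -
  show z: "u' c = 0"
    by (rule DERIV_local_max[OF u d]) (use d le in \<open>auto simp: abs_minus_commute\<close>)
  \<comment> \<open>If \<open>D\<close> were positive, \<open>u'\<close> would be positive
    immediately to the right of \<open>c\<close>, and the mean value theorem would lift
    \<open>u\<close> above its maximum. Differentiability of \<open>u'\<close> is used at the single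
    point \<open>c\<close>.\<close>
  show "D \<le> 0"
  proof (rule ccontr)
    assume "\<not> D \<le> 0"
    then obtain e where e: "e > 0" "\<And>h. 0 < h \<Longrightarrow> h < e \<Longrightarrow> u' c < u' (c + h)"
      using DERIV_pos_inc_right[OF u'] by (metis not_le)
    define h where "h = min e d / 2"
    have h: "0 < h" "h < e" "h < d" using e d by (auto simp: h_def)
    have "\<exists>z>c. z < c + h \<and> u (c + h) - u c = (c + h - c) * u' z"
      by (rule MVT2) (use h in \<open>auto intro!: u\<close>)
    then obtain z where z1: "c < z" "z < c + h" "u (c + h) - u c = h * u' z" by auto
    have "u' z > 0" using e(2)[of "z - c"] z z1 h by auto
    then have "u (c + h) > u c" using z1 h by (smt (verit) mult_pos_pos)
    then show False using le[of "c + h"] h by auto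
  qed
qed

text \<open>
  The factor \<open>y powr (2 * s)\<close> is annihilated by \<open>\<partial>\<^sub>y\<^sub>y + (1 - 2s)/y \<partial>\<^sub>y\<close> and has nonzero flux at
  \<open>y = 0\<close>; the other factors keep the function below \<open>t powr \<gamma>\<close>. Subtracted from a concave
  function of \<open>t\<close>, it yields a supersolution with flux of order \<open>t powr (\<gamma> - 2 * s)\<close>.
\<close>

definition barrier_corr :: "real \<Rightarrow> real \<Rightarrow> real \<Rightarrow> real \<Rightarrow> real" where
  "barrier_corr s \<gamma> t y = t powr (\<gamma> + 2 - 2 * s) * y powr (2 * s) / (t\<^sup>2 + y\<^sup>2)"

text \<open>Used with the two variables in either role: as a function of t with \<open>q\<close> =
  y^2, and as a function of y with \<open>q\<close> = t^2. The power stays a common factor because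
  t^\<sigma> y^(2s) is later pulled out of the whole operator.\<close>

lemma powr_quotient_deriv:
  fixes t q \<sigma> :: real
  assumes t: "t > 0" and q: "q \<ge> 0"
  shows "((\<lambda>t. t powr \<sigma> / (t\<^sup>2 + q)) has_real_derivative
      t powr \<sigma> * (\<sigma> / t / (t\<^sup>2 + q) - 2 * t / (t\<^sup>2 + q)\<^sup>2)) (at t)" (is ?A)
    and "((\<lambda>t. t powr \<sigma> * (\<sigma> / t / (t\<^sup>2 + q) - 2 * t / (t\<^sup>2 + q)\<^sup>2)) has_real_derivative
      t powr \<sigma> * ((\<sigma>\<^sup>2 - \<sigma>) / t\<^sup>2 / (t\<^sup>2 + q) - (4 * \<sigma> + 2) / (t\<^sup>2 + q)\<^sup>2
         + 8 * t\<^sup>2 / (t\<^sup>2 + q) ^ 3)) (at t)" (is ?B)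
proof -
  define P where "P = t\<^sup>2 + q"
  have p: "P > 0" using t q by (simp add: P_def add_pos_nonneg)
  have p': "t\<^sup>2 + q \<noteq> 0" "t \<noteq> 0" using p t by (auto simp: P_def)
  have d1: "((\<lambda>t. t powr \<sigma>) has_real_derivative t powr \<sigma> * \<sigma> / t) (at t)"
    using has_real_derivative_powr[OF t, of \<sigma>] t by (simp add: powr_diff field_simps)
  have d2: "((\<lambda>t. t\<^sup>2 + q) has_real_derivative 2 * t) (at t)"
    by (auto intro!: derivative_eq_intros)
  show ?A
    apply (rule DERIV_cong[OF DERIV_divide[OF d1 d2 p'(1)]])
    using p t unfolding P_def[symmetric] by (simp add: field_simps power2_eq_square)
  have d3: "((\<lambda>t. (t\<^sup>2 + q)\<^sup>2) has_real_derivative 4 * t * (t\<^sup>2 + q)) (at t)"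
    by (auto intro!: derivative_eq_intros)
  have d0: "((\<lambda>t. \<sigma> / t) has_real_derivative - \<sigma> / t\<^sup>2) (at t)"
    using p' by (auto intro!: derivative_eq_intros simp: power2_eq_square)
  have d0': "((\<lambda>t. 2 * t) has_real_derivative 2) (at t)"
    by (auto intro!: derivative_eq_intros)
  have d4: "((\<lambda>t. \<sigma> / t / (t\<^sup>2 + q)) has_real_derivative
      - \<sigma> / t\<^sup>2 / (t\<^sup>2 + q) - 2 * \<sigma> / (t\<^sup>2 + q)\<^sup>2) (at t)"
    apply (rule DERIV_cong[OF DERIV_divide[OF d0 d2 p'(1)]])
    using p t unfolding P_def[symmetric] by (simp add: field_simps power2_eq_square)
  have d5: "((\<lambda>t. 2 * t / (t\<^sup>2 + q)\<^sup>2) has_real_derivative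
      2 / (t\<^sup>2 + q)\<^sup>2 - 8 * t\<^sup>2 / (t\<^sup>2 + q) ^ 3) (at t)"
    apply (rule DERIV_cong[OF DERIV_divide[OF d0' d3]])
    using p' apply simp
    using p t unfolding P_def[symmetric] by (simp add: field_simps power2_eq_square power3_eq_cube)
  show ?B
    apply (rule DERIV_cong[OF DERIV_mult[OF d1 DERIV_diff[OF d4 d5]]])
    using p t unfolding P_def[symmetric] by (simp add: field_simps power2_eq_square power3_eq_cube)
qed

text \<open>With r = sqrt (t^2 + y^2) both t and y are at most r, so t^(2-2s) y^(2s) \<le> r^2. The
  third form avoids the division and feeds the estimate of the operator; at the origin the quotient
  is 0 by the convention for division.\<close>

lemma barrier_corr_bounds:
  assumes s: "0 < s" "s < 1" and t: "t \<ge> 0" and y: "y \<ge> 0"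
  shows "0 \<le> barrier_corr s \<gamma> t y" "barrier_corr s \<gamma> t y \<le> t powr \<gamma>"
    "t powr (\<gamma> + 2 - 2 * s) * y powr (2 * s) \<le> t powr \<gamma> * (t\<^sup>2 + y\<^sup>2)"
proof -
  show "0 \<le> barrier_corr s \<gamma> t y" by (simp add: barrier_corr_def)
  define r where "r = sqrt (t\<^sup>2 + y\<^sup>2)"
  have tr: "t \<le> r" "y \<le> r" "0 \<le> r" using t y by (auto simp: r_def real_le_rsqrt)
  have "t powr (2 - 2 * s) * y powr (2 * s) \<le> r powr (2 - 2 * s) * r powr (2 * s)"
    using tr t y s by (intro mult_mono powr_mono2) auto
  also have "\<dots> = r\<^sup>2" using tr by (cases "r = 0") (auto simp: powr_add[symmetric] powr_numeral)
  also have "\<dots> = t\<^sup>2 + y\<^sup>2" by (simp add: r_def)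
  finally have *: "t powr (2 - 2 * s) * y powr (2 * s) \<le> t\<^sup>2 + y\<^sup>2" .
  have e: "t powr (\<gamma> + 2 - 2 * s) = t powr \<gamma> * t powr (2 - 2 * s)"
    by (simp add: powr_add[symmetric] algebra_simps)
  show **: "t powr (\<gamma> + 2 - 2 * s) * y powr (2 * s) \<le> t powr \<gamma> * (t\<^sup>2 + y\<^sup>2)"
    unfolding e mult.assoc by (intro mult_left_mono *) auto
  show "barrier_corr s \<gamma> t y \<le> t powr \<gamma>"
    unfolding barrier_corr_def using **
    by (cases "t\<^sup>2 + y\<^sup>2 = 0") (auto simp: divide_simps not_sum_power2_lt_zero)
qed

text \<open>The denominator vanishes only at the origin. On the whole edge t = 0 the function is
  squeezed between 0 and t^\<gamma>, which is where \<gamma> > 0 enters.\<close>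

lemma barrier_corr_continuous:
  assumes s: "0 < s" "s < 1" and g: "0 < \<gamma>"
  shows "continuous_on ({0..1} \<times> {0..1}) (\<lambda>z. barrier_corr s \<gamma> (fst z) (snd z))"
  unfolding continuous_on
proof
  fix z :: "real \<times> real" assume z: "z \<in> {0..1} \<times> {0..1}"
  let ?F = "at z within {0..1} \<times> {0..1}"
  have ft: "(fst \<longlongrightarrow> fst z) ?F" "(snd \<longlongrightarrow> snd z) ?F"
    by (rule tendsto_fst[OF tendsto_ident_at] tendsto_snd[OF tendsto_ident_at])+
  have ev: "eventually (\<lambda>w. 0 \<le> fst w \<and> 0 \<le> snd w) ?F"
    unfolding eventually_at_filter by (rule always_eventually) auto
  have ev1: "eventually (\<lambda>w. 0 \<le> fst w) ?F" and ev2: "eventually (\<lambda>w. 0 \<le> snd w) ?F"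
    using ev by (rule eventually_mono, simp)+
  show "((\<lambda>z. barrier_corr s \<gamma> (fst z) (snd z)) \<longlongrightarrow> barrier_corr s \<gamma> (fst z) (snd z)) ?F"
  proof (cases "fst z = 0")
    case True
    have "((\<lambda>w. fst w powr \<gamma>) \<longlongrightarrow> fst z powr \<gamma>) ?F"
      by (rule tendsto_powr'[OF ft(1) tendsto_const]) (use g ev1 in simp)
    then have lim: "((\<lambda>w. fst w powr \<gamma>) \<longlongrightarrow> 0) ?F" using True g by simp
    have "((\<lambda>w. barrier_corr s \<gamma> (fst w) (snd w)) \<longlongrightarrow> 0) ?F"
    proof (rule tendsto_sandwich[OF _ _ tendsto_const lim])
      show "eventually (\<lambda>w. 0 \<le> barrier_corr s \<gamma> (fst w) (snd w)) ?F"
        using ev by (rule eventually_mono) (simp add: barrier_corr_bounds[OF s])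
      show "eventually (\<lambda>w. barrier_corr s \<gamma> (fst w) (snd w) \<le> fst w powr \<gamma>) ?F"
        using ev by (rule eventually_mono) (simp add: barrier_corr_bounds[OF s])
    qed
    moreover have "barrier_corr s \<gamma> (fst z) (snd z) = 0"
      using True s g by (simp add: barrier_corr_def)
    ultimately show ?thesis by simp
  next
    case False
    then have "fst z > 0" using z by (auto simp: mem_Times_iff)
    then have nz: "(fst z)\<^sup>2 + (snd z)\<^sup>2 \<noteq> 0" by simp
    show ?thesis unfolding barrier_corr_def
      apply (rule tendsto_divide[OF tendsto_mult[OF tendsto_powr'[OF ft(1) tendsto_const]
          tendsto_powr'[OF ft(2) tendsto_const]] tendsto_add[OF tendsto_power[OF ft(1)] tendsto_power[OF ft(2)]] nz])
      using False s ev2 by simp_all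
  qed
qed

text \<open>The right-hand side is the operator applied to \<open>barrier_corr\<close>. Since y^(2s)
  lies in the kernel of its y-part, all 1/y^2 terms cancel, and t^\<sigma> y^(2s) / P times O(1/t^2)
  is left. By \<open>A \<le> t powr \<gamma> * P\<close> this has order t^(\<gamma>-2), the order of
  the second derivative of t^\<gamma>, so a small multiple can be absorbed.\<close>

lemma barrier_corr_supersolution:
  fixes s \<gamma> t y :: real
  assumes s: "0 < s" "s < 1" and g: "0 < \<gamma>" "\<gamma> < 2" and t: "t > 0" and y: "y > 0"
  defines "\<sigma> \<equiv> \<gamma> + 2 - 2 * s" and "P \<equiv> t\<^sup>2 + y\<^sup>2"
  shows "- 19 * t powr (\<gamma> - 2) \<le>
     y powr (2 * s) * (t powr \<sigma> * ((\<sigma>\<^sup>2 - \<sigma>) / t\<^sup>2 / P - (4 * \<sigma> + 2) / P\<^sup>2 + 8 * t\<^sup>2 / P ^ 3))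
   + t powr \<sigma> * (y powr (2 * s) * (((2 * s)\<^sup>2 - 2 * s) / y\<^sup>2 / P - (4 * (2 * s) + 2) / P\<^sup>2 + 8 * y\<^sup>2 / P ^ 3))
   + (1 - 2 * s) / y * (t powr \<sigma> * (y powr (2 * s) * (2 * s / y / P - 2 * y / P\<^sup>2)))"
    (is "_ \<le> ?R")
proof -
  define A where "A = t powr \<sigma> * y powr (2 * s)"
  have P: "P > 0" using t y by (simp add: P_def add_pos_pos)
  have yP: "y\<^sup>2 = P - t\<^sup>2" by (simp add: P_def)
  have A: "0 \<le> A" "A \<le> t powr \<gamma> * P"
    using barrier_corr_bounds(3)[OF s, of t y \<gamma>] t y by (auto simp: A_def \<sigma>_def P_def)
  have "?R = A * ((\<sigma>\<^sup>2 - \<sigma>) / t\<^sup>2 / P - (4 * \<sigma> + 2) / P\<^sup>2 + 8 * t\<^sup>2 / P ^ 3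
      + (((2 * s)\<^sup>2 - 2 * s) / y\<^sup>2 / P - (4 * (2 * s) + 2) / P\<^sup>2 + 8 * y\<^sup>2 / P ^ 3)
      + (1 - 2 * s) / y * (2 * s / y / P - 2 * y / P\<^sup>2))" (is "_ = A * ?B")
    unfolding A_def by (simp add: algebra_simps)
  also have "?B = (\<sigma>\<^sup>2 - \<sigma>) / t\<^sup>2 / P - (4 * \<sigma> + 2) / P\<^sup>2 - (4 * (2 * s) + 2) / P\<^sup>2
      - 2 * (1 - 2 * s) / P\<^sup>2 + (8 * t\<^sup>2 / P ^ 3 + 8 * y\<^sup>2 / P ^ 3)"
  proof -
    \<comment> \<open>The indicial equation for the exponent 2s: 2s (2s - 1) + (1 - 2s) 2s =
      0.\<close>
    have e1: "((2 * s)\<^sup>2 - 2 * s) / y\<^sup>2 / P + (1 - 2 * s) / y * (2 * s / y / P) = 0"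
      using y P by (simp add: field_simps power2_eq_square)
    have e2: "(1 - 2 * s) / y * (2 * y / P\<^sup>2) = 2 * (1 - 2 * s) / P\<^sup>2"
      using y by simp
    show ?thesis using e1 e2 unfolding right_diff_distrib by linarith
  qed
  also have "8 * t\<^sup>2 / P ^ 3 + 8 * y\<^sup>2 / P ^ 3 = 8 / P\<^sup>2"
    using P unfolding yP by (simp add: field_simps power2_eq_square power3_eq_cube)
  also have "(\<sigma>\<^sup>2 - \<sigma>) / t\<^sup>2 / P - (4 * \<sigma> + 2) / P\<^sup>2 - (4 * (2 * s) + 2) / P\<^sup>2
      - 2 * (1 - 2 * s) / P\<^sup>2 + 8 / P\<^sup>2 = 1 / P * ((\<sigma>\<^sup>2 - \<sigma>) / t\<^sup>2 - (4 * \<sigma> + 4 * s - 2) / P)"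
    using P t by (simp add: field_simps power2_eq_square)
  also have "A * (1 / P * ((\<sigma>\<^sup>2 - \<sigma>) / t\<^sup>2 - (4 * \<sigma> + 4 * s - 2) / P)) \<ge> - 19 * t powr (\<gamma> - 2)"
  proof -
    have sg: "0 < \<sigma>" "\<sigma> < 4" using s g by (auto simp: \<sigma>_def)
    have s1: "\<sigma>\<^sup>2 - \<sigma> \<ge> - 1 / 4" using zero_le_power2[of "\<sigma> - 1/2"] by (simp add: power2_eq_square algebra_simps)
    \<comment> \<open>With \<sigma> < 4 and s < 1 the numerator is below 18; together with
      \<sigma>^2 - \<sigma> \<ge> -1/4 this is rounded up to the constant 19.\<close>
    have "(4 * \<sigma> + 4 * s - 2) / P \<le> 18 / P" using P sg s by (intro divide_right_mono) auto
    also have "\<dots> \<le> 18 / t\<^sup>2" using t by (intro divide_left_mono) (auto simp: P_def add_pos_nonneg)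
    finally have s2: "(4 * \<sigma> + 4 * s - 2) / P \<le> 18 / t\<^sup>2" .
    have s3: "(\<sigma>\<^sup>2 - \<sigma>) / t\<^sup>2 \<ge> (- 1 / 4) / t\<^sup>2" by (rule divide_right_mono[OF s1]) auto
    have s4: "(\<sigma>\<^sup>2 - \<sigma>) / t\<^sup>2 - (4 * \<sigma> + 4 * s - 2) / P \<ge> - 19 / t\<^sup>2"
    proof -
      have "- 19 / t\<^sup>2 \<le> (- 1 / 4 - 18) / t\<^sup>2" by (rule divide_right_mono) auto
      then have "- 19 / t\<^sup>2 \<le> (- 1 / 4) / t\<^sup>2 - 18 / t\<^sup>2" by (simp only: diff_divide_distrib)
      then show ?thesis using s2 s3 by linarith
    qed
    have AP: "A * (1 / P) \<le> t powr \<gamma>" "0 \<le> A * (1 / P)" using A P by (simp_all add: pos_divide_le_eq)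
    have "A * (1 / P) * (19 / t\<^sup>2) \<le> t powr \<gamma> * (19 / t\<^sup>2)"
      by (rule mult_right_mono[OF AP(1)]) auto
    also have "\<dots> = 19 * t powr (\<gamma> - 2)" using t by (simp add: powr_diff powr_numeral)
    finally have "A * (1 / P) * (19 / t\<^sup>2) \<le> 19 * t powr (\<gamma> - 2)" .
    moreover have "A * (1 / P) * ((\<sigma>\<^sup>2 - \<sigma>) / t\<^sup>2 - (4 * \<sigma> + 4 * s - 2) / P) \<ge> A * (1 / P) * (- 19 / t\<^sup>2)"
      by (rule mult_left_mono[OF s4 AP(2)])
    ultimately show ?thesis by (simp add: mult.assoc)
  qed
  finally show ?thesis .
qed

text \<open>\<open>G\<close> is a concave profile in t minus a small multiple of
  \<open>barrier_corr\<close>: the profile supplies concavity of size t^(\<gamma>-2), the correction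
  supplies the flux at y = 0. At \<gamma> = 1 the concavity constant vanishes, hence that exponent
  is excluded. For \<gamma> > 1 the power is convex and 2t - t^\<gamma> takes its place, which caps
  the upper bound at order t.\<close>

lemma barrier_exists:
  fixes s \<gamma> :: real
  assumes s: "0 < s" "s < 1" and g: "0 < \<gamma>" "\<gamma> < 2" "\<gamma> \<noteq> 1"
  obtains G Gt Gtt Gy Gyy :: "real \<Rightarrow> real \<Rightarrow> real" and c \<epsilon> :: real where
    "c > 0" "\<epsilon> > 0"
    "\<And>t y. t > 0 \<Longrightarrow> y > 0 \<Longrightarrow> ((\<lambda>t. G t y) has_real_derivative Gt t y) (at t)"
    "\<And>t y. t > 0 \<Longrightarrow> y > 0 \<Longrightarrow> ((\<lambda>t. Gt t y) has_real_derivative Gtt t y) (at t)"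
    "\<And>t y. t > 0 \<Longrightarrow> y > 0 \<Longrightarrow> ((\<lambda>y. G t y) has_real_derivative Gy t y) (at y)"
    "\<And>t y. t > 0 \<Longrightarrow> y > 0 \<Longrightarrow> ((\<lambda>y. Gy t y) has_real_derivative Gyy t y) (at y)"
    "\<And>t y. t > 0 \<Longrightarrow> t \<le> 1 \<Longrightarrow> y > 0 \<Longrightarrow> Gtt t y + Gyy t y + (1 - 2 * s) / y * Gy t y \<le> - c"
    "\<And>t. t > 0 \<Longrightarrow> ((\<lambda>y. y powr (1 - 2 * s) * Gy t y) \<longlongrightarrow> - \<epsilon> * t powr (\<gamma> - 2 * s)) (at_right 0)"
    "\<And>t y. 0 \<le> t \<Longrightarrow> t \<le> 1 \<Longrightarrow> 0 \<le> y \<Longrightarrow> t / 2 \<le> G t y"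
    "\<And>t y. 0 \<le> t \<Longrightarrow> t \<le> 1 \<Longrightarrow> 0 \<le> y \<Longrightarrow> G t y \<le> 2 * t powr (min \<gamma> 1)"
    "continuous_on ({0..1} \<times> {0..1}) (\<lambda>z. G (fst z) (snd z))"
proof -
  define \<sigma> where "\<sigma> = \<gamma> + 2 - 2 * s"
  define c where "c = \<gamma> * \<bar>\<gamma> - 1\<bar> / 2"
  \<comment> \<open>The bound by c/19 leaves half of the concavity -2c t^(\<gamma>-2) after the
    correction is absorbed; the bound by 1/2 keeps \<open>G\<close> above t/2.\<close>
  define \<eta> where "\<eta> = min (1 / 2) (c / 19)"
  have c0: "c > 0" using g by (simp add: c_def)
  have \<eta>0: "\<eta> > 0" "\<eta> \<le> 1 / 2" "19 * \<eta> \<le> c" using c0 by (auto simp: \<eta>_def)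
  define \<omega> where "\<omega> = (\<lambda>t::real. if \<gamma> < 1 then t powr \<gamma> else 2 * t - t powr \<gamma>)"
  define \<omega>' where "\<omega>' = (\<lambda>t::real. if \<gamma> < 1 then \<gamma> * t powr (\<gamma> - 1) else 2 - \<gamma> * t powr (\<gamma> - 1))"
  define \<omega>'' where "\<omega>'' = (\<lambda>t::real. - 2 * c * t powr (\<gamma> - 2))"
  have d\<omega>: "(\<omega> has_real_derivative \<omega>' t) (at t)" if "t > 0" for t
  proof (cases "\<gamma> < 1")
    case True
    then show ?thesis unfolding \<omega>_def \<omega>'_def using has_real_derivative_powr[OF that, of \<gamma>] by simp
  next
    case False
    then show ?thesis unfolding \<omega>_def \<omega>'_def
      using that by (auto intro!: derivative_eq_intros has_real_derivative_powr[OF that, of \<gamma>])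
  qed
  have d\<omega>': "(\<omega>' has_real_derivative \<omega>'' t) (at t)" if "t > 0" for t
  proof -
    have D: "((\<lambda>t. \<gamma> * t powr (\<gamma> - 1)) has_real_derivative \<gamma> * (\<gamma> - 1) * t powr (\<gamma> - 2)) (at t)"
      using DERIV_cmult[OF has_real_derivative_powr[OF that, of "\<gamma> - 1"], of \<gamma>] by (simp add: mult.assoc)
    show ?thesis
    proof (cases "\<gamma> < 1")
      case True
      then have "\<gamma> * (\<gamma> - 1) = - 2 * c" by (simp add: c_def abs_if algebra_simps)
      then show ?thesis using D True by (simp add: \<omega>'_def \<omega>''_def)
    next
      case False
      then have "\<gamma> * (\<gamma> - 1) = 2 * c" using g by (simp add: c_def abs_if algebra_simps)
      then show ?thesis using DERIV_diff[OF DERIV_const D, of 2] False by (simp add: \<omega>'_def \<omega>''_def)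
    qed
  qed
  have tle: "t powr 1 \<le> t powr \<gamma>" if "0 \<le> t" "t \<le> 1" "\<gamma> < 1" for t
    using that g by (intro powr_mono') auto
  have tge: "t powr \<gamma> \<le> t powr 1" if "0 \<le> t" "t \<le> 1" "\<not> \<gamma> < 1" for t
    using that g by (intro powr_mono') auto
  have wlow: "t / 2 + \<eta> * t powr \<gamma> \<le> \<omega> t" if "0 \<le> t" "t \<le> 1" for t
  proof -
    have "\<eta> * t powr \<gamma> \<le> 1 / 2 * t powr \<gamma>" using \<eta>0 by (intro mult_right_mono) auto
    then show ?thesis using tle[OF that] tge[OF that] that by (cases "\<gamma> < 1") (auto simp: \<omega>_def)
  qed
  have wup: "\<omega> t \<le> 2 * t powr (min \<gamma> 1)" if "0 \<le> t" for t
    using that by (auto simp: \<omega>_def)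
  define R1 where "R1 = (\<lambda>r t q::real. t powr r * (r / t / (t\<^sup>2 + q) - 2 * t / (t\<^sup>2 + q)\<^sup>2))"
  define R2 where "R2 = (\<lambda>r t q::real. t powr r * ((r\<^sup>2 - r) / t\<^sup>2 / (t\<^sup>2 + q) - (4 * r + 2) / (t\<^sup>2 + q)\<^sup>2
         + 8 * t\<^sup>2 / (t\<^sup>2 + q) ^ 3))"
  define G where "G = (\<lambda>t y. \<omega> t - \<eta> * barrier_corr s \<gamma> t y)"
  define Gt where "Gt = (\<lambda>t y. \<omega>' t - \<eta> * (y powr (2 * s) * R1 \<sigma> t (y\<^sup>2)))"
  define Gtt where "Gtt = (\<lambda>t y. \<omega>'' t - \<eta> * (y powr (2 * s) * R2 \<sigma> t (y\<^sup>2)))"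
  define Gy where "Gy = (\<lambda>t y. - \<eta> * (t powr \<sigma> * R1 (2 * s) y (t\<^sup>2)))"
  define Gyy where "Gyy = (\<lambda>t y. - \<eta> * (t powr \<sigma> * R2 (2 * s) y (t\<^sup>2)))"
  have cont: "continuous_on ({0..1} \<times> {0..1}) (\<lambda>z. G (fst z) (snd z))"
  proof -
    have "continuous_on ({0..1} \<times> {0..1}) (\<lambda>z::real\<times>real. fst z powr \<gamma>)"
      by (intro continuous_on_powr' continuous_intros) (use g in auto)
    then have "continuous_on ({0..1} \<times> {0..1}) (\<lambda>z::real\<times>real. \<omega> (fst z))"
      by (cases "\<gamma> < 1") (auto simp: \<omega>_def intro!: continuous_intros)
    then show ?thesis unfolding G_def
      by (intro continuous_intros barrier_corr_continuous s g)
  qed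
  show thesis
  proof (rule that[of c "2 * s * \<eta>" G Gt Gtt Gy Gyy])
    fix t y :: real assume t: "t > 0" and y: "y > 0"
    have e1: "barrier_corr s \<gamma> t y = y powr (2 * s) * (t powr \<sigma> / (t\<^sup>2 + y\<^sup>2))" for t y
      by (simp add: barrier_corr_def \<sigma>_def)
    have e2: "barrier_corr s \<gamma> t y = t powr \<sigma> * (y powr (2 * s) / (y\<^sup>2 + t\<^sup>2))" for t y
      by (simp add: barrier_corr_def \<sigma>_def add.commute)
    show "((\<lambda>t. G t y) has_real_derivative Gt t y) (at t)"
      unfolding G_def Gt_def e1 R1_def
      by (intro DERIV_diff d\<omega>[OF t] DERIV_cmult powr_quotient_deriv(1)[OF t]) auto
    show "((\<lambda>t. Gt t y) has_real_derivative Gtt t y) (at t)"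
      unfolding Gt_def Gtt_def R1_def R2_def
      by (intro DERIV_diff d\<omega>'[OF t] DERIV_cmult powr_quotient_deriv(2)[OF t]) auto
    show "((\<lambda>y. G t y) has_real_derivative Gy t y) (at y)"
      unfolding G_def Gy_def e2 R1_def
      by (rule DERIV_cong[OF DERIV_diff[OF DERIV_const DERIV_cmult[OF DERIV_cmult[OF powr_quotient_deriv(1)[OF y]]]]])
         auto
    show "((\<lambda>y. Gy t y) has_real_derivative Gyy t y) (at y)"
      unfolding Gy_def Gyy_def R1_def R2_def
      by (intro DERIV_cmult powr_quotient_deriv(2)[OF y]) auto
    assume t1: "t \<le> 1"
    have "- 19 * t powr (\<gamma> - 2) \<le> y powr (2 * s) * R2 \<sigma> t (y\<^sup>2) + t powr \<sigma> * R2 (2 * s) y (t\<^sup>2)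
        + (1 - 2 * s) / y * (t powr \<sigma> * R1 (2 * s) y (t\<^sup>2))" (is "_ \<le> ?L")
      using barrier_corr_supersolution[OF s g(1,2) t y] unfolding R1_def R2_def \<sigma>_def
      by (simp add: add.commute)
    then have "\<eta> * (- 19 * t powr (\<gamma> - 2)) \<le> \<eta> * ?L"
      by (rule mult_left_mono) (use \<eta>0 in auto)
    moreover have "Gtt t y + Gyy t y + (1 - 2 * s) / y * Gy t y = \<omega>'' t - \<eta> * ?L"
      by (simp add: Gtt_def Gyy_def Gy_def algebra_simps)
    moreover have "19 * \<eta> * t powr (\<gamma> - 2) \<le> c * t powr (\<gamma> - 2)"
      by (rule mult_right_mono) (use \<eta>0 in auto)
    \<comment> \<open>Here t \<le> 1 and \<gamma> < 2 turn t^(\<gamma>-2) into a constant.\<close>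
    moreover have "c * 1 \<le> c * t powr (\<gamma> - 2)"
      using powr_mono'[of "\<gamma> - 2" 0 t] t t1 g c0 by (intro mult_left_mono) auto
    ultimately show "Gtt t y + Gyy t y + (1 - 2 * s) / y * Gy t y \<le> - c"
      unfolding \<omega>''_def by linarith
  next
    fix t :: real assume t: "t > 0"
    have ev: "eventually (\<lambda>y. y powr (1 - 2 * s) * Gy t y
        = - \<eta> * (t powr \<sigma> * (2 * s / (y\<^sup>2 + t\<^sup>2) - 2 * y\<^sup>2 / (y\<^sup>2 + t\<^sup>2)\<^sup>2))) (at_right 0)"
      unfolding eventually_at_filter
    proof (intro always_eventually allI impI)
      fix y :: real assume "y \<noteq> 0" "y \<in> {0<..}"
      then have y: "y > 0" by simp
      have "y powr (1 - 2 * s) * y powr (2 * s) = y" using y by (simp add: powr_add[symmetric])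
      then have "y powr (1 - 2 * s) * (y powr (2 * s) * (2 * s / y / (y\<^sup>2 + t\<^sup>2) - 2 * y / (y\<^sup>2 + t\<^sup>2)\<^sup>2))
         = y * (2 * s / y / (y\<^sup>2 + t\<^sup>2) - 2 * y / (y\<^sup>2 + t\<^sup>2)\<^sup>2)" by (simp add: mult.assoc[symmetric])
      also have "\<dots> = 2 * s / (y\<^sup>2 + t\<^sup>2) - 2 * y\<^sup>2 / (y\<^sup>2 + t\<^sup>2)\<^sup>2"
        using y by (simp add: right_diff_distrib power2_eq_square)
      finally show "y powr (1 - 2 * s) * Gy t y
        = - \<eta> * (t powr \<sigma> * (2 * s / (y\<^sup>2 + t\<^sup>2) - 2 * y\<^sup>2 / (y\<^sup>2 + t\<^sup>2)\<^sup>2))"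
        unfolding Gy_def R1_def by (simp add: mult.left_commute)
    qed
    have "((\<lambda>y. - \<eta> * (t powr \<sigma> * (2 * s / (y\<^sup>2 + t\<^sup>2) - 2 * y\<^sup>2 / (y\<^sup>2 + t\<^sup>2)\<^sup>2))) \<longlongrightarrow>
       - \<eta> * (t powr \<sigma> * (2 * s / (0\<^sup>2 + t\<^sup>2) - 2 * 0\<^sup>2 / (0\<^sup>2 + t\<^sup>2)\<^sup>2))) (at_right 0)"
      by (intro tendsto_intros) (use t in auto)
    moreover have "- \<eta> * (t powr \<sigma> * (2 * s / (0\<^sup>2 + t\<^sup>2) - 2 * 0\<^sup>2 / (0\<^sup>2 + t\<^sup>2)\<^sup>2))
       = - (2 * s * \<eta>) * t powr (\<gamma> - 2 * s)"
    proof -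
      have "\<sigma> = \<gamma> - 2 * s + 2" by (simp add: \<sigma>_def)
      then have "t powr \<sigma> = t powr (\<gamma> - 2 * s) * t\<^sup>2" using t by (simp only: powr_add) (simp add: powr_numeral)
      then show ?thesis using t by simp
    qed
    ultimately have "((\<lambda>y. - \<eta> * (t powr \<sigma> * (2 * s / (y\<^sup>2 + t\<^sup>2) - 2 * y\<^sup>2 / (y\<^sup>2 + t\<^sup>2)\<^sup>2))) \<longlongrightarrow>
       - (2 * s * \<eta>) * t powr (\<gamma> - 2 * s)) (at_right 0)" by (simp only:)
    then show "((\<lambda>y. y powr (1 - 2 * s) * Gy t y) \<longlongrightarrow> - (2 * s * \<eta>) * t powr (\<gamma> - 2 * s)) (at_right 0)"
      using ev by (simp only: tendsto_cong[OF ev])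
  next
    fix t y :: real assume t: "0 \<le> t" "t \<le> 1" "0 \<le> y"
    note b = barrier_corr_bounds(1,2)[OF s t(1,3), of \<gamma>]
    have "\<eta> * barrier_corr s \<gamma> t y \<le> \<eta> * t powr \<gamma>" "0 \<le> \<eta> * barrier_corr s \<gamma> t y"
      using b \<eta>0 by (auto intro: mult_left_mono)
    then show "t / 2 \<le> G t y" "G t y \<le> 2 * t powr (min \<gamma> 1)"
      unfolding G_def using wlow[OF t(1,2)] wup[OF t(1)] by linarith+
  qed (use c0 \<eta>0 s cont in auto)
qed

text \<open>
  The difference \<open>\<phi>(x,y,t) = f(x+te,y) - f(x-te,y)\<close> satisfies \<open>\<phi>\<^sub>t\<^sub>t = \<phi>\<^sub>e\<^sub>e\<close>, so the direction \<open>e\<close>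
  in the operator may be traded for \<open>t\<close>, in which the barrier is strictly concave.
\<close>

lemma tangential_difference_bound:
  fixes s \<gamma> :: real
  assumes s: "0 < s" "s < 1" and g: "0 < \<gamma>" "\<gamma> < 2" "\<gamma> \<noteq> 1"
  obtains C :: real where "C > 0" and
    "\<And>(f :: (real^'n) \<times> real \<Rightarrow> real) fl xc e M t y.
      \<lbrakk>solves (1 - 2 * s) f; continuous_on upper_cl f; e \<in> Basis; M > 0;
       \<And>x. ((\<lambda>y. y powr (1 - 2 * s) * partial f (0, 1) (x, y)) \<longlongrightarrow> fl x) (at_right 0);
       \<And>x y. dist x xc \<le> 2 \<Longrightarrow> 0 \<le> y \<Longrightarrow> y \<le> 1 \<Longrightarrow> \<bar>f (x, y)\<bar> \<le> M;
       \<And>x t. dist x xc \<le> 1 \<Longrightarrow> 0 \<le> t \<Longrightarrow> t \<le> 1 \<Longrightarrow> \<bar>f (x + t *\<^sub>R e, 1) - f (x - t *\<^sub>R e, 1)\<bar> \<le> M * t;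
       \<And>x t. dist x xc \<le> 1 \<Longrightarrow> 0 < t \<Longrightarrow> t \<le> 1 \<Longrightarrow>
          \<bar>fl (x + t *\<^sub>R e) - fl (x - t *\<^sub>R e)\<bar> \<le> M * t powr (\<gamma> - 2 * s);
       0 \<le> t; t \<le> 1; 0 \<le> y; y \<le> 1\<rbrakk>
      \<Longrightarrow> f (xc + t *\<^sub>R e, y) - f (xc - t *\<^sub>R e, y) \<le> C * M * t powr (min \<gamma> 1)"
proof -
  obtain G Gt Gtt Gy Gyy c \<epsilon> where c: "c > 0" and \<epsilon>: "\<epsilon> > 0"
    and dGt: "\<And>t y. t > 0 \<Longrightarrow> y > 0 \<Longrightarrow> ((\<lambda>t. G t y) has_real_derivative Gt t y) (at t)"
    and dGtt: "\<And>t y. t > 0 \<Longrightarrow> y > 0 \<Longrightarrow> ((\<lambda>t. Gt t y) has_real_derivative Gtt t y) (at t)"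
    and dGy: "\<And>t y. t > 0 \<Longrightarrow> y > 0 \<Longrightarrow> ((\<lambda>y. G t y) has_real_derivative Gy t y) (at y)"
    and dGyy: "\<And>t y. t > 0 \<Longrightarrow> y > 0 \<Longrightarrow> ((\<lambda>y. Gy t y) has_real_derivative Gyy t y) (at y)"
    and super: "\<And>t y. t > 0 \<Longrightarrow> t \<le> 1 \<Longrightarrow> y > 0 \<Longrightarrow> Gtt t y + Gyy t y + (1 - 2 * s) / y * Gy t y \<le> - c"
    and Glim: "\<And>t. t > 0 \<Longrightarrow> ((\<lambda>y. y powr (1 - 2 * s) * Gy t y) \<longlongrightarrow> - \<epsilon> * t powr (\<gamma> - 2 * s)) (at_right 0)"
    and Glow: "\<And>t y. 0 \<le> t \<Longrightarrow> t \<le> 1 \<Longrightarrow> 0 \<le> y \<Longrightarrow> t / 2 \<le> G t y"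
    and Gup: "\<And>t y. 0 \<le> t \<Longrightarrow> t \<le> 1 \<Longrightarrow> 0 \<le> y \<Longrightarrow> G t y \<le> 2 * t powr (min \<gamma> 1)"
    and Gcont: "continuous_on ({0..1} \<times> {0..1}) (\<lambda>z. G (fst z) (snd z))"
    by (rule barrier_exists[OF s g]) blast
  define N where "N = real CARD('n)"
  \<comment> \<open>One summand per place where a positive maximum must be excluded: 4 for the faces
    t = 1 and y = 1; 4N/c for the interior, where the quadratic penalty costs 2k = 4M per direction;
    1/\<epsilon> for the face y = 0. The added ones make the last two inequalities strict.\<close>
  define K0 where "K0 = 4 + (4 * N / c + 1) + (1 / \<epsilon> + 1)"
  have N: "N \<ge> 0" by (simp add: N_def)
  have K0: "K0 \<ge> 4" "K0 * c > 4 * N" "K0 * \<epsilon> > 1"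
  proof -
    show "K0 \<ge> 4" using c \<epsilon> N by (simp add: K0_def)
    have "K0 * c = 4 * N + (c * 6 + c / \<epsilon>)" using c by (simp add: K0_def field_simps)
    then show "K0 * c > 4 * N" using c \<epsilon> by (simp add: add_pos_pos)
    have "K0 * \<epsilon> = 1 + (\<epsilon> * 6 + 4 * N * \<epsilon> / c)" using \<epsilon> by (simp add: K0_def field_simps)
    then show "K0 * \<epsilon> > 1" using c \<epsilon> N by (simp add: add_pos_nonneg)
  qed
  show thesis
  proof (rule that[of "2 * K0"])
    show "2 * K0 > 0" using K0 by simp
    fix f :: "(real^'n) \<times> real \<Rightarrow> real" and fl xc e M
    assume sol: "solves (1 - 2 * s) f" and cont: "continuous_on upper_cl f" and e: "e \<in> Basis" and M: "M > 0"
      and flux: "\<And>x. ((\<lambda>y. y powr (1 - 2 * s) * partial f (0, 1) (x, y)) \<longlongrightarrow> fl x) (at_right 0)"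
      and bd: "\<And>x y. dist x xc \<le> 2 \<Longrightarrow> 0 \<le> y \<Longrightarrow> y \<le> 1 \<Longrightarrow> \<bar>f (x, y)\<bar> \<le> M"
      and top: "\<And>x t. dist x xc \<le> 1 \<Longrightarrow> 0 \<le> t \<Longrightarrow> t \<le> 1 \<Longrightarrow> \<bar>f (x + t *\<^sub>R e, 1) - f (x - t *\<^sub>R e, 1)\<bar> \<le> M * t"
      and fld: "\<And>x t. dist x xc \<le> 1 \<Longrightarrow> 0 < t \<Longrightarrow> t \<le> 1 \<Longrightarrow>
          \<bar>fl (x + t *\<^sub>R e) - fl (x - t *\<^sub>R e)\<bar> \<le> M * t powr (\<gamma> - 2 * s)"
    have C2: "C2_on upper f" using sol by (simp add: solves_def)
    define K where "K = K0 * M"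
    \<comment> \<open>At distance 1 from \<open>xc\<close> the penalty then equals the trivial bound
      2M for the difference.\<close>
    define k where "k = 2 * M"
    have K: "K \<ge> 4 * M" "K * c > 2 * k * N" "K * \<epsilon> > M" "K > 0"
    proof -
      show "K \<ge> 4 * M" unfolding K_def using K0 M by (intro mult_right_mono) auto
      then show "K > 0" using M by linarith
      show "K * c > 2 * k * N" using mult_strict_left_mono[OF K0(2) M] by (simp add: K_def k_def mult_ac)
      show "K * \<epsilon> > M" using mult_strict_left_mono[OF K0(3) M] by (simp add: K_def mult_ac)
    qed
    define \<Phi> where "\<Phi> = (\<lambda>x t y. f (x + t *\<^sub>R e, y) - f (x - t *\<^sub>R e, y) - K * G t y - k * ((x - xc) \<bullet> (x - xc)))"
    define \<Omega> where "\<Omega> = cball xc 1 \<times> ({0..1::real} \<times> {0..1::real})"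
    have comp: "compact \<Omega>" unfolding \<Omega>_def by (intro compact_Times compact_cball compact_Icc)
    have ne: "\<Omega> \<noteq> {}" by (auto simp: \<Omega>_def)
    have cont\<Phi>: "continuous_on \<Omega> (\<lambda>w. \<Phi> (fst w) (fst (snd w)) (snd (snd w)))"
      unfolding \<Phi>_def
    proof (intro continuous_intros)
      show "continuous_on \<Omega> (\<lambda>w. f (fst w + fst (snd w) *\<^sub>R e, snd (snd w)))"
        by (rule continuous_on_compose2[OF cont]) (auto intro!: continuous_intros simp: \<Omega>_def upper_cl_def)
      show "continuous_on \<Omega> (\<lambda>w. f (fst w - fst (snd w) *\<^sub>R e, snd (snd w)))"
        by (rule continuous_on_compose2[OF cont]) (auto intro!: continuous_intros simp: \<Omega>_def upper_cl_def)
      show "continuous_on \<Omega> (\<lambda>w. G (fst (snd w)) (snd (snd w)))"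
        by (rule continuous_on_compose2[OF Gcont, of _ snd]) (auto intro!: continuous_intros simp: \<Omega>_def)
    qed
    obtain w where w: "w \<in> \<Omega>" and wmax: "\<And>w'. w' \<in> \<Omega> \<Longrightarrow>
        \<Phi> (fst w') (fst (snd w')) (snd (snd w')) \<le> \<Phi> (fst w) (fst (snd w)) (snd (snd w))"
      using continuous_attains_sup[OF comp ne cont\<Phi>] by blast
    obtain x t y where wxty: "w = (x, t, y)" by (cases w) auto
    have mx: "\<Phi> x' t' y' \<le> \<Phi> x t y" if "dist x' xc \<le> 1" "0 \<le> t'" "t' \<le> 1" "0 \<le> y'" "y' \<le> 1" for x' t' y'
      using wmax[of "(x', t', y')"] that by (simp add: \<Omega>_def wxty dist_commute)
    have dom: "dist x xc \<le> 1" "0 \<le> t" "t \<le> 1" "0 \<le> y" "y \<le> 1"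
      using w by (auto simp: \<Omega>_def wxty dist_commute)
    have en: "norm e = 1" using e by simp
    have bd2: "f (x' + t' *\<^sub>R e, y') - f (x' - t' *\<^sub>R e, y') \<le> 2 * M"
      if "dist x' xc \<le> 1" "0 \<le> t'" "t' \<le> 1" "0 \<le> y'" "y' \<le> 1" for x' t' y'
    proof -
      have "dist (x' + t' *\<^sub>R e) xc \<le> 2" "dist (x' - t' *\<^sub>R e) xc \<le> 2"
        using that en dist_triangle[of "x' + t' *\<^sub>R e" xc x'] dist_triangle[of "x' - t' *\<^sub>R e" xc x']
        by (auto simp: dist_norm)
      from bd[OF this(1) that(4,5)] bd[OF this(2) that(4,5)] show ?thesis by linarith
    qed
    have "\<Phi> x t y \<le> 0"
    proof (rule ccontr)
      assume "\<not> \<Phi> x t y \<le> 0"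
      then have pos: "\<Phi> x t y > 0" by simp
      have xx: "(x - xc) \<bullet> (x - xc) = (dist x xc)\<^sup>2" by (simp add: dist_norm power2_norm_eq_inner)
      have KG: "K * G t y \<ge> K * (t / 2)" using Glow[OF dom(2,3,4)] K by (intro mult_left_mono) auto
      have KG0: "K * G t y \<ge> 0" using KG K dom by (smt (verit) mult_nonneg_nonneg divide_nonneg_nonneg)
      have kx: "k * ((x - xc) \<bullet> (x - xc)) \<ge> 0" using M by (simp add: k_def)
      have t0: "t > 0"
      proof (rule ccontr)
        assume "\<not> t > 0"
        then have "t = 0" using dom by simp
        then show False using pos KG0 kx unfolding \<Phi>_def by simp
      qed
      have t1: "t < 1"
      proof (rule ccontr)
        assume "\<not> t < 1"
        then have t: "t = 1" using dom by simp
        show False using pos KG kx bd2[OF dom] K unfolding \<Phi>_def t by linarith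
      qed
      have x1: "dist x xc < 1"
      proof (rule ccontr)
        assume "\<not> dist x xc < 1"
        then have "dist x xc = 1" using dom by simp
        then show False using pos KG0 bd2[OF dom] unfolding \<Phi>_def xx by (simp add: k_def)
      qed
      have y1: "y < 1"
      proof (rule ccontr)
        assume "\<not> y < 1"
        then have y: "y = 1" using dom by simp
        have "M * t \<le> K * (t / 2)" using K dom M mult_right_mono[of "2 * M" K t] by simp
        then show False using pos KG kx top[OF dom(1,2,3)] unfolding \<Phi>_def y by linarith
      qed
      have L1: "((\<lambda>r. f (z + r *\<^sub>R d)) has_real_derivative partial f d (z + r *\<^sub>R d)) (at r)"
        if "z + r *\<^sub>R d \<in> upper" for z d r
        by (rule has_real_derivative_line[OF C2_onD(1)[OF C2 that]])
      have L2: "((\<lambda>r. partial f d (z + r *\<^sub>R d)) has_real_derivative partial (partial f d) d (z + r *\<^sub>R d)) (at r)"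
        if "z + r *\<^sub>R d \<in> upper" "d \<in> Basis" for z d r
        by (rule has_real_derivative_line[OF C2_onD(2)[OF C2 that]])
      have uy: "((\<lambda>r. \<Phi> x t r) has_real_derivative
          partial f (0, 1) (x + t *\<^sub>R e, r) - partial f (0, 1) (x - t *\<^sub>R e, r) - K * Gy t r) (at r)" if "r > 0" for r
      proof -
        have D: "((\<lambda>r. f (x', r)) has_real_derivative partial f (0, 1) (x', r)) (at r)" for x'
          using L1[of "(x', 0)" r "(0, 1)"] that by (simp add: upper_def)
        show ?thesis unfolding \<Phi>_def
          by (rule derivative_eq_intros dGy[OF t0 that] D refl | simp)+
      qed
      show False
      proof (cases "y = 0")
        \<comment> \<open>On the flat face the weighted y-derivative of \<Phi> tends to a positive
          number, because the flux of the barrier beats the flux difference of \<open>f\<close>. So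
          \<Phi> increases with y near 0. The argument needs only the sign of the weighted
          derivative at small positive y; no derivative at y = 0 occurs.\<close>
        case True
        define u' where "u' = (\<lambda>r. partial f (0, 1) (x + t *\<^sub>R e, r) - partial f (0, 1) (x - t *\<^sub>R e, r) - K * Gy t r)"
        have "((\<lambda>r. r powr (1 - 2 * s) * partial f (0, 1) (x + t *\<^sub>R e, r)
              - r powr (1 - 2 * s) * partial f (0, 1) (x - t *\<^sub>R e, r) - K * (r powr (1 - 2 * s) * Gy t r))
            \<longlongrightarrow> fl (x + t *\<^sub>R e) - fl (x - t *\<^sub>R e) - K * (- \<epsilon> * t powr (\<gamma> - 2 * s))) (at_right 0)"
          by (intro tendsto_intros flux Glim t0)
        then have "((\<lambda>r. r powr (1 - 2 * s) * u' r)
            \<longlongrightarrow> fl (x + t *\<^sub>R e) - fl (x - t *\<^sub>R e) - K * (- \<epsilon> * t powr (\<gamma> - 2 * s))) (at_right 0)"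
          by (simp add: u'_def algebra_simps)
        moreover have "fl (x + t *\<^sub>R e) - fl (x - t *\<^sub>R e) - K * (- \<epsilon> * t powr (\<gamma> - 2 * s)) > 0"
        proof -
          have "M * t powr (\<gamma> - 2 * s) < K * \<epsilon> * t powr (\<gamma> - 2 * s)"
            using K t0 by (intro mult_strict_right_mono) auto
          then show ?thesis using fld[OF dom(1) t0 dom(3)] by (simp add: abs_le_iff mult.assoc)
        qed
        ultimately have "eventually (\<lambda>r. 0 < r powr (1 - 2 * s) * u' r) (at_right 0)"
          by (rule order_tendstoD)
        then obtain \<delta> where \<delta>: "\<delta> > 0" "\<And>r. 0 < r \<Longrightarrow> r < \<delta> \<Longrightarrow> 0 < r powr (1 - 2 * s) * u' r"
          unfolding eventually_at_right_field by auto
        define h where "h = min \<delta> 1 / 2"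
        have h: "0 < h" "h < \<delta>" "h < 1" using \<delta> by (auto simp: h_def)
        have "continuous_on {0..h} (\<lambda>r. \<Phi> x t r)"
          using continuous_on_compose2[OF cont\<Phi>, of "{0..h}" "\<lambda>r. (x, t, r)"] dom h
          by (simp add: \<Omega>_def image_subset_iff dist_commute continuous_intros)
        then obtain l z where z: "0 < z" "z < h" "((\<lambda>r. \<Phi> x t r) has_real_derivative l) (at z)"
            "\<Phi> x t h - \<Phi> x t 0 = (h - 0) * l"
          using MVT[of 0 h "\<lambda>r. \<Phi> x t r"] h uy by (auto simp: real_differentiable_def)
        have "l = u' z" using DERIV_unique[OF z(3) uy[OF z(1)]] by (simp add: u'_def)
        moreover have "0 < z powr (1 - 2 * s) * u' z" using \<delta>(2)[of z] z h by simp
        ultimately have "l > 0" by (simp add: zero_less_mult_iff)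
        then have "\<Phi> x t h > \<Phi> x t 0" using z(4) h by (smt (verit) mult_pos_pos)
        then show False using mx[of x t h] True dom h by simp
      next
        case False
        then have y0: "y > 0" using dom by simp
        define zp where "zp = (x + t *\<^sub>R e, y)"
        define zm where "zm = (x - t *\<^sub>R e, y)"
        have zu: "zp \<in> upper" "zm \<in> upper" using y0 by (auto simp: upper_def zp_def zm_def)
        define d where "d = min (1 - dist x xc) (min (min t (1 - t)) (min y (1 - y)))"
        have d: "d > 0" using x1 t0 t1 y0 y1 by (simp add: d_def)
        have sx: "partial (partial f (b, 0)) (b, 0) zp - partial (partial f (b, 0)) (b, 0) zm \<le> 2 * k"
          if b: "b \<in> Basis" for b
        proof -
          define u where "u = (\<lambda>r. \<Phi> (x + r *\<^sub>R b) t y)"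
          define u' where "u' = (\<lambda>r. partial f (b, 0) (zp + r *\<^sub>R (b, 0)) - partial f (b, 0) (zm + r *\<^sub>R (b, 0))
              - k * (2 * ((x - xc) \<bullet> b) + 2 * r))"
          have bB: "(b, 0::real) \<in> Basis" using b by (simp add: Basis_prod_def)
          have bb: "b \<bullet> b = 1" using b by simp
          have up: "zp + r *\<^sub>R (b, 0) \<in> upper" "zm + r *\<^sub>R (b, 0) \<in> upper" for r
            using y0 by (auto simp: upper_def zp_def zm_def)
          have ueq: "u = (\<lambda>r. f (zp + r *\<^sub>R (b, 0)) - f (zm + r *\<^sub>R (b, 0)) - K * G t y
              - k * ((x - xc) \<bullet> (x - xc) + 2 * ((x - xc) \<bullet> b) * r + r\<^sup>2))"
            unfolding u_def \<Phi>_def zp_def zm_def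
            by (rule ext) (simp add: algebra_simps inner_simps bb power2_eq_square inner_commute)
          have "\<And>r. \<bar>r - 0\<bar> < d \<Longrightarrow> u r \<le> u 0"
          proof -
            fix r assume "\<bar>r - 0\<bar> < d"
            then have r: "\<bar>r\<bar> \<le> 1 - dist x xc" by (simp add: d_def)
            have "dist (x + r *\<^sub>R b) xc \<le> dist x xc + \<bar>r\<bar>"
              using dist_triangle[of "x + r *\<^sub>R b" xc x] b by (simp add: dist_norm)
            then show "u r \<le> u 0" unfolding u_def using mx[of "x + r *\<^sub>R b" t y] r dom by simp
          qed
          moreover have "\<And>r. (u has_real_derivative u' r) (at r)"
            unfolding ueq u'_def
            by (rule derivative_eq_intros L1 up refl | simp add: algebra_simps)+
          moreover have "(u' has_real_derivative partial (partial f (b, 0)) (b, 0) (zp + 0 *\<^sub>R (b, 0))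
             - partial (partial f (b, 0)) (b, 0) (zm + 0 *\<^sub>R (b, 0)) - 2 * k) (at 0)"
            unfolding u'_def
            by (rule derivative_eq_intros L2 up bB refl | simp)+
          ultimately show ?thesis using local_max_derivatives(2)[OF d, of 0 u u']
            by (fastforce simp: zero_prod_def[symmetric])
        qed
        \<comment> \<open>Two derivatives of \<open>- F (- r)\<close> give
          \<open>- F'' (- r)\<close>, so the t-derivative reproduces exactly the difference of
          second derivatives at \<open>zp\<close> and \<open>zm\<close>. The penalty does not depend
          on t and costs nothing in this direction.\<close>
        have st: "partial (partial f (e, 0)) (e, 0) zp - partial (partial f (e, 0)) (e, 0) zm \<le> K * Gtt t y"
        proof -
          have eB: "(e, 0::real) \<in> Basis" using e by (simp add: Basis_prod_def)
          define F where "F = (\<lambda>r. f ((x, y) + r *\<^sub>R (e, 0)))"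
          define F' where "F' = (\<lambda>r. partial f (e, 0) ((x, y) + r *\<^sub>R (e, 0)))"
          define F'' where "F'' = (\<lambda>r. partial (partial f (e, 0)) (e, 0) ((x, y) + r *\<^sub>R (e, 0)))"
          have up: "(x, y) + r *\<^sub>R (e, 0) \<in> upper" for r using y0 by (simp add: upper_def)
          have dF: "(F has_real_derivative F' r) (at r)" "(F' has_real_derivative F'' r) (at r)" for r
            unfolding F_def F'_def F''_def by (rule L1[OF up], rule L2[OF up eB])
          have dF1: "((\<lambda>r. F (- r)) has_real_derivative - F' (- r)) (at r)" for r
            using dF(1)[of "- r"] by (simp only: DERIV_mirror)
          have dF2: "((\<lambda>r. F' (- r)) has_real_derivative - F'' (- r)) (at r)" for r
            using dF(2)[of "- r"] by (simp only: DERIV_mirror)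
          define u where "u = (\<lambda>r. \<Phi> x r y)"
          define u' where "u' = (\<lambda>r. F' r - (- F' (- r)) - K * Gt r y)"
          have ueq: "u = (\<lambda>r. F r - F (- r) - K * G r y - k * ((x - xc) \<bullet> (x - xc)))"
            by (simp add: u_def \<Phi>_def F_def)
          have "\<And>r. \<bar>r - t\<bar> < d \<Longrightarrow> u r \<le> u t"
            unfolding u_def by (rule mx) (use dom in \<open>auto simp: d_def\<close>)
          moreover have "\<And>r. \<bar>r - t\<bar> < d \<Longrightarrow> (u has_real_derivative u' r) (at r)"
          proof -
            fix r assume "\<bar>r - t\<bar> < d"
            then have r0: "r > 0" by (auto simp: d_def)
            show "(u has_real_derivative u' r) (at r)"
              unfolding ueq u'_def
              by (rule derivative_eq_intros dF dF1 dGt[OF r0 y0] refl | simp)+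
          qed
          moreover have "(u' has_real_derivative F'' t - F'' (- t) - K * Gtt t y) (at t)"
            unfolding u'_def
            by (rule derivative_eq_intros dF dF2 dGtt[OF t0 y0] refl | simp)+
          ultimately have "F'' t - F'' (- t) - K * Gtt t y \<le> 0" by (rule local_max_derivatives(2)[OF d, of t u u'])
          then show ?thesis by (simp add: F''_def zp_def zm_def)
        qed
        have sy: "partial f (0, 1) zp - partial f (0, 1) zm = K * Gy t y"
          "partial (partial f (0, 1)) (0, 1) zp - partial (partial f (0, 1)) (0, 1) zm \<le> K * Gyy t y"
        proof -
          define u where "u = (\<lambda>r. \<Phi> x t r)"
          define u' where "u' = (\<lambda>r. partial f (0, 1) (x + t *\<^sub>R e, r) - partial f (0, 1) (x - t *\<^sub>R e, r) - K * Gy t r)"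
          have "\<And>r. \<bar>r - y\<bar> < d \<Longrightarrow> u r \<le> u y"
            unfolding u_def by (rule mx) (use dom in \<open>auto simp: d_def\<close>)
          moreover have "\<And>r. \<bar>r - y\<bar> < d \<Longrightarrow> (u has_real_derivative u' r) (at r)"
            unfolding u_def u'_def by (rule uy) (auto simp: d_def)
          moreover have "(u' has_real_derivative partial (partial f (0, 1)) (0, 1) zp
               - partial (partial f (0, 1)) (0, 1) zm - K * Gyy t y) (at y)"
          proof -
            have D: "((\<lambda>r. partial f (0, 1) (x', r)) has_real_derivative partial (partial f (0, 1)) (0, 1) (x', y)) (at y)" for x'
              using L2[of "(x', 0)" y "(0, 1)"] y0 by (simp add: upper_def Basis_prod_def)
            show ?thesis unfolding u'_def zp_def zm_def
              by (rule derivative_eq_intros dGyy[OF t0 y0] D refl | simp)+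
          qed
          ultimately have "u' y = 0 \<and> partial (partial f (0, 1)) (0, 1) zp
               - partial (partial f (0, 1)) (0, 1) zm - K * Gyy t y \<le> 0"
            using local_max_derivatives[OF d, of y u u'] by blast
          then show "partial f (0, 1) zp - partial f (0, 1) zm = K * Gy t y"
            "partial (partial f (0, 1)) (0, 1) zp - partial (partial f (0, 1)) (0, 1) zm \<le> K * Gyy t y"
            by (auto simp: u'_def zp_def zm_def)
        qed
        have "(\<Sum>b\<in>Basis. partial (partial f (b, 0)) (b, 0) zp - partial (partial f (b, 0)) (b, 0) zm)
            = (partial (partial f (e, 0)) (e, 0) zp - partial (partial f (e, 0)) (e, 0) zm)
              + (\<Sum>b\<in>Basis - {e}. partial (partial f (b, 0)) (b, 0) zp - partial (partial f (b, 0)) (b, 0) zm)"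
          by (rule sum.remove) (use e in auto)
        also have "\<dots> \<le> K * Gtt t y + real (card (Basis - {e})) * (2 * k)"
          by (intro add_mono st sum_bounded_above sx) auto
        also have "\<dots> \<le> K * Gtt t y + N * (2 * k)"
          using M card_mono[of "Basis :: (real^'n) set" "Basis - {e}"]
          by (intro add_left_mono mult_right_mono) (auto simp: N_def k_def)
        finally have sumle: "(\<Sum>b\<in>Basis. partial (partial f (b, 0)) (b, 0) zp)
             - (\<Sum>b\<in>Basis. partial (partial f (b, 0)) (b, 0) zm) \<le> K * Gtt t y + N * (2 * k)"
          by (simp add: sum_subtractf)
        \<comment> \<open>By the equations at \<open>zp\<close> and \<open>zm\<close> the second
          derivatives and the drift of the difference add up to 0, whereas maximality bounds the
          same sum by K times the operator on \<open>G\<close> plus 2kN, hence by -Kc + 2kN <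
          0.\<close>
        have "(1 - 2 * s) / y * partial f (0, 1) zp - (1 - 2 * s) / y * partial f (0, 1) zm = (1 - 2 * s) / y * (K * Gy t y)"
          unfolding right_diff_distrib[symmetric] sy(1) ..
        moreover have "K * (Gtt t y + Gyy t y + (1 - 2 * s) / y * Gy t y) \<le> K * (- c)"
          using super[OF t0 dom(3) y0] K by (intro mult_left_mono) auto
        moreover have "K * (Gtt t y + Gyy t y + (1 - 2 * s) / y * Gy t y)
            = K * Gtt t y + K * Gyy t y + (1 - 2 * s) / y * (K * Gy t y)" by (simp add: algebra_simps)
        moreover have "snd zp = y" "snd zm = y" by (simp_all add: zp_def zm_def)
        moreover have "N * (2 * k) = 2 * k * N" "K * (- c) = - (K * c)" by simp_all
        ultimately show False
          using sumle sy(2) solves_nondivergence_form[OF sol zu(1)] solves_nondivergence_form[OF sol zu(2)] K(2)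
          by (simp only:)
      qed
    qed
    \<comment> \<open>The penalty vanishes at \<open>xc\<close>, so the estimate is read off on the
      axis of the cylinder; its constant does not depend on \<open>xc\<close>.\<close>
    then have le0: "\<Phi> xc t' y' \<le> 0" if "0 \<le> t'" "t' \<le> 1" "0 \<le> y'" "y' \<le> 1" for t' y'
      using mx[of xc t' y'] that by simp
    fix t y :: real assume ty: "0 \<le> t" "t \<le> 1" "0 \<le> y" "y \<le> 1"
    have "f (xc + t *\<^sub>R e, y) - f (xc - t *\<^sub>R e, y) \<le> K * G t y"
      using le0[OF ty] by (simp add: \<Phi>_def)
    also have "\<dots> \<le> K * (2 * t powr (min \<gamma> 1))"
      using Gup[OF ty(1-3)] K by (intro mult_left_mono) auto
    finally show "f (xc + t *\<^sub>R e, y) - f (xc - t *\<^sub>R e, y) \<le> 2 * K0 * M * t powr (min \<gamma> 1)"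
      by (simp add: K_def mult_ac)
  qed
qed

section \<open>Bootstrap of the tangential Hoelder exponent\<close>

lemma powr_difference_bound:
  fixes a b q B :: real
  assumes q: "q > 0" and ab: "0 \<le> b" "b \<le> a" "a \<le> B"
  shows "a powr (q + 1) - b powr (q + 1) \<le> (q + 1) * B powr q * (a - b)"
proof (cases "a = b")
  case False
  then have lt: "b < a" using ab by simp
  have "continuous_on {b..a} (\<lambda>x. x powr (q + 1))"
    by (intro continuous_on_powr' continuous_intros) (use ab q in auto)
  moreover have D: "((\<lambda>x. x powr (q + 1)) has_real_derivative (q + 1) * x powr q) (at x)" if "b < x" for x
    using has_real_derivative_powr[of x "q + 1"] that ab by simp
  ultimately obtain l z where z: "b < z" "z < a" "((\<lambda>x. x powr (q + 1)) has_real_derivative l) (at z)"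
      "a powr (q + 1) - b powr (q + 1) = (a - b) * l"
    using MVT[OF lt, of "\<lambda>x. x powr (q + 1)"] by (auto simp: real_differentiable_def)
  have "l = (q + 1) * z powr q" using DERIV_unique[OF z(3) D[OF z(1)]] .
  also have "\<dots> \<le> (q + 1) * B powr q"
    using z ab q by (intro mult_left_mono powr_mono2) auto
  finally show ?thesis using z(4) lt by (simp add: mult.commute mult_left_mono)
qed simp

text \<open>For q < 1 the power a^q is not Lipschitz at 0. In the splitting a^q (w_i - u_i) + u_i
  (a^q - b^q) the factor |u_i| \<le> b repairs this: b |a^q - b^q| is at most |a^(q+1) - b^(q+1)|,
  whose exponent exceeds 1. The two parts contribute 1 and q + 1 to the constant.\<close>

lemma power_nonlinearity_lipschitz:
  fixes w u :: "nat \<Rightarrow> real"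
  assumes q: "q > 0" and i: "i < m" and B: "L2_set w {..<m} \<le> B" "L2_set u {..<m} \<le> B"
  shows "\<bar>L2_set w {..<m} powr q * w i - L2_set u {..<m} powr q * u i\<bar>
    \<le> (q + 2) * B powr q * L2_set (\<lambda>i. w i - u i) {..<m}"
proof -
  define a where "a = L2_set w {..<m}"
  define b where "b = L2_set u {..<m}"
  define d where "d = L2_set (\<lambda>i. w i - u i) {..<m}"
  have ab: "0 \<le> a" "0 \<le> b" "a \<le> B" "b \<le> B" using B by (auto simp: a_def b_def L2_set_nonneg)
  have ti: "\<bar>x i\<bar> \<le> L2_set x {..<m}" for x :: "nat \<Rightarrow> real"
    using member_le_L2_set[of "{..<m}" i "\<lambda>i. \<bar>x i\<bar>"] i by (simp add: L2_set_def)
  have "a \<le> b + d"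
    using L2_set_triangle_ineq[of u "\<lambda>i. w i - u i" "{..<m}"] by (simp add: a_def b_def d_def)
  moreover have "b \<le> a + d"
    using L2_set_triangle_ineq[of w "\<lambda>i. u i - w i" "{..<m}"]
    by (simp add: a_def b_def d_def L2_set_def power2_commute)
  ultimately have abd: "\<bar>a - b\<bar> \<le> d" by linarith
  have e: "x powr (q + 1) = x * x powr q" if "0 \<le> x" for x :: real
    using that by (simp add: powr_add)
  have key: "b * \<bar>a powr q - b powr q\<bar> \<le> (q + 1) * B powr q * \<bar>a - b\<bar>"
  proof (cases "b \<le> a")
    case True
    then have "b * a powr q \<le> a * a powr q" by (intro mult_right_mono) auto
    moreover have "b powr q \<le> a powr q" using True ab q by (intro powr_mono2) auto
    ultimately show ?thesis using powr_difference_bound[OF q ab(2) True ab(3)] True ab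
      by (simp add: e right_diff_distrib)
  next
    case False
    then have "a * a powr q \<le> b * a powr q" by (intro mult_right_mono) auto
    moreover have "a powr q \<le> b powr q" using False ab q by (intro powr_mono2) auto
    ultimately show ?thesis using powr_difference_bound[OF q ab(1) _ ab(4)] False ab
      by (simp add: e right_diff_distrib)
  qed
  have "a powr q * w i - b powr q * u i = a powr q * (w i - u i) + u i * (a powr q - b powr q)"
    by (simp add: algebra_simps)
  then have "\<bar>a powr q * w i - b powr q * u i\<bar> \<le> a powr q * \<bar>w i - u i\<bar> + \<bar>u i\<bar> * \<bar>a powr q - b powr q\<bar>"
    using abs_triangle_ineq[of "a powr q * (w i - u i)" "u i * (a powr q - b powr q)"] by (simp add: abs_mult)
  also have "a powr q * \<bar>w i - u i\<bar> \<le> B powr q * d"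
    using ti[of "\<lambda>i. w i - u i"] ab q by (intro mult_mono powr_mono2) (auto simp: d_def)
  also have "\<bar>u i\<bar> * \<bar>a powr q - b powr q\<bar> \<le> b * \<bar>a powr q - b powr q\<bar>"
    using ti[of u] by (intro mult_right_mono) (auto simp: b_def)
  also note key
  also have "(q + 1) * B powr q * \<bar>a - b\<bar> \<le> (q + 1) * B powr q * d"
    using abd q by (intro mult_left_mono) auto
  finally show ?thesis by (simp add: a_def b_def d_def algebra_simps)
qed

lemma finite_uniform_bound:
  fixes f :: "'a \<Rightarrow> 'b \<Rightarrow> real"
  assumes "finite A" "\<And>a. a \<in> A \<Longrightarrow> \<exists>C. \<forall>x. P a x \<longrightarrow> f a x \<le> C"
  shows "\<exists>C>0. \<forall>a\<in>A. \<forall>x. P a x \<longrightarrow> f a x \<le> C"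
proof -
  obtain c where c: "\<And>a x. a \<in> A \<Longrightarrow> P a x \<Longrightarrow> f a x \<le> c a" using assms(2) by metis
  define C where "C = 1 + (\<Sum>a\<in>A. \<bar>c a\<bar>)"
  have "\<bar>c a\<bar> \<le> (\<Sum>a\<in>A. \<bar>c a\<bar>)" if "a \<in> A" for a
    by (rule member_le_sum) (use that assms in auto)
  then have "f a x \<le> C" if "a \<in> A" "P a x" for a x
    using c[OF that] that(1) unfolding C_def by (smt (verit))
  moreover have "C > 0" unfolding C_def by (smt (verit) sum_nonneg abs_ge_zero)
  ultimately show ?thesis by blast
qed

text \<open>The coefficient \<open>\<kappa>\<close> is an arbitrary real number here and enters the
  regularity estimates through its absolute value. It is identified with \<open>kappa s\<close>
  where the energy appears.\<close>

locale extension_system =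
  fixes s p \<kappa> :: real and m :: nat and v :: "nat \<Rightarrow> (real^'n) \<times> real \<Rightarrow> real"
  assumes s: "0 < s" "s < 1" and p: "p > 1"
    and sol: "\<And>i. i < m \<Longrightarrow> solves (1 - 2 * s) (v i)"
    and cont: "\<And>i. i < m \<Longrightarrow> continuous_on upper_cl (v i)"
    and cont_flux: "\<And>i. i < m \<Longrightarrow> \<exists>g. continuous_on upper_cl g \<and>
        (\<forall>z\<in>upper. g z = snd z powr (1 - 2 * s) * partial (v i) (0, 1) z)"
    and flux: "\<And>i x. i < m \<Longrightarrow>
        ((\<lambda>y. y powr (1 - 2 * s) * partial (v i) (0, 1) (x, y))
          \<longlongrightarrow> - (\<kappa> * vnorm m v (x, 0) powr (p - 1) * v i (x, 0))) (at_right 0)"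
begin

lemma C2: "i < m \<Longrightarrow> C2_on upper (v i)"
  using sol by (simp add: solves_def)

lemma bounded_on_half_ball:
  obtains M where "M > 0" "\<And>i z. i < m \<Longrightarrow> z \<in> upper_cl \<Longrightarrow> norm z \<le> R \<Longrightarrow> \<bar>v i z\<bar> \<le> M"
proof -
  have "\<exists>C. \<forall>z. z \<in> upper_cl \<and> norm z \<le> R \<longrightarrow> \<bar>v i z\<bar> \<le> C" if "i \<in> {..<m}" for i
  proof -
    have i: "i < m" using that by simp
    obtain B where "\<And>z. z \<in> upper_cl \<inter> cball 0 R \<Longrightarrow> norm (v i z) \<le> B"
      by (rule continuous_on_compact_bound[OF compact_half_ball continuous_on_subset[OF cont[OF i] Int_lower1]]) blast
    then show ?thesis by (intro exI[of _ B]) simp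
  qed
  then have "\<exists>C>0. \<forall>i\<in>{..<m}. \<forall>z. z \<in> upper_cl \<and> norm z \<le> R \<longrightarrow> \<bar>v i z\<bar> \<le> C"
    by (rule finite_uniform_bound[OF finite_lessThan])
  then obtain M where "M > 0" "\<forall>i\<in>{..<m}. \<forall>z. z \<in> upper_cl \<and> norm z \<le> R \<longrightarrow> \<bar>v i z\<bar> \<le> M"
    by blast
  then show thesis by (intro that[of M]) blast+
qed

text \<open>Away from the flat boundary gradient bounds are mere compactness. They serve the top
  face y = 1 of the comparison cylinder and, afterwards, all points of height at least 1.\<close>

lemma tangential_derivative_bounded_inside:
  obtains M where "M > 0" "\<And>i z b. i < m \<Longrightarrow> snd z \<ge> 1 \<Longrightarrow> norm z \<le> R \<Longrightarrow> b \<in> Basis \<Longrightarrow> \<bar>partial (v i) b z\<bar> \<le> M"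
proof -
  have "\<exists>C. \<forall>z. 1 \<le> snd z \<and> norm z \<le> R \<longrightarrow> \<bar>partial (v (fst a)) (snd a) z\<bar> \<le> C"
    if "a \<in> {..<m} \<times> (Basis :: ((real^'n) \<times> real) set)" for a
  proof -
    have i: "fst a < m" "snd a \<in> Basis" using that by auto
    have "closed {z :: (real^'n) \<times> real. 1 \<le> snd z}"
      by (intro closed_Collect_le continuous_intros)
    then have "compact ({z. 1 \<le> snd z} \<inter> cball 0 R :: ((real^'n) \<times> real) set)"
      by (rule closed_Int_compact) simp
    moreover have "continuous_on ({z. 1 \<le> snd z} \<inter> cball 0 R) (partial (v (fst a)) (snd a))"
      by (rule continuous_on_subset[OF C2_on_continuous(2)[OF C2[OF i(1)] i(2)]]) (auto simp: upper_def)
    ultimately obtain B where "\<And>z. z \<in> {z. 1 \<le> snd z} \<inter> cball 0 R \<Longrightarrow> norm (partial (v (fst a)) (snd a) z) \<le> B"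
      using continuous_on_compact_bound by blast
    then show ?thesis by (intro exI[of _ B]) simp
  qed
  then have "\<exists>C>0. \<forall>a\<in>{..<m} \<times> (Basis :: ((real^'n) \<times> real) set).
      \<forall>z. 1 \<le> snd z \<and> norm z \<le> R \<longrightarrow> \<bar>partial (v (fst a)) (snd a) z\<bar> \<le> C"
    by (rule finite_uniform_bound[OF finite_SigmaI[OF finite_lessThan finite_Basis]])
  then obtain M where M: "M > 0" "\<forall>a\<in>{..<m} \<times> (Basis :: ((real^'n) \<times> real) set).
      \<forall>z. 1 \<le> snd z \<and> norm z \<le> R \<longrightarrow> \<bar>partial (v (fst a)) (snd a) z\<bar> \<le> M"
    by blast
  show thesis
  proof (rule that[OF M(1)])
    fix i and z b :: "(real^'n) \<times> real" assume "i < m" "1 \<le> snd z" "norm z \<le> R" "b \<in> Basis"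
    then show "\<bar>partial (v i) b z\<bar> \<le> M" using M(2)[rule_format, of "(i, b)" z] by simp
  qed
qed

text \<open>At \<open>t = 0\<close> both sides vanish, also for \<open>\<alpha> = 0\<close>, since \<open>0 powr 0 = 0\<close>.\<close>

definition holder :: "real^'n \<Rightarrow> real \<Rightarrow> bool" where
  "holder e \<alpha> \<longleftrightarrow> (\<forall>R. \<exists>C>0. \<forall>i<m. \<forall>x t y. norm x \<le> R \<longrightarrow> 0 \<le> t \<longrightarrow> t \<le> 1 \<longrightarrow> 0 \<le> y \<longrightarrow> y \<le> 1 \<longrightarrow>
     \<bar>v i (x + t *\<^sub>R e, y) - v i (x - t *\<^sub>R e, y)\<bar> \<le> C * t powr \<alpha>)"

lemma norm_half_space_le: "norm (x, y) \<le> norm x + \<bar>y\<bar>" for x :: "real^'n" and y :: real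
  by (metis norm_Pair_le real_norm_def)

lemma norm_shift_le:
  fixes x e :: "real^'n"
  assumes "norm e = 1" "0 \<le> t" "t \<le> 1"
  shows "norm (x + t *\<^sub>R e) \<le> norm x + 1" "norm (x - t *\<^sub>R e) \<le> norm x + 1"
proof -
  have "norm (t *\<^sub>R e) \<le> 1" using assms by simp
  then show "norm (x + t *\<^sub>R e) \<le> norm x + 1" "norm (x - t *\<^sub>R e) \<le> norm x + 1"
    using norm_triangle_ineq[of x "t *\<^sub>R e"] norm_triangle_ineq4[of x "t *\<^sub>R e"] by linarith+
qed

lemma holder_zero:
  assumes e: "e \<in> Basis"
  shows "holder e 0"
  unfolding holder_def
proof
  fix R
  obtain M where M: "M > 0" "\<And>i z. i < m \<Longrightarrow> z \<in> upper_cl \<Longrightarrow> norm z \<le> R + 2 \<Longrightarrow> \<bar>v i z\<bar> \<le> M"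
    using bounded_on_half_ball[of "R + 2"] by blast
  have en: "norm e = 1" using e by simp
  have "\<bar>v i (x + t *\<^sub>R e, y) - v i (x - t *\<^sub>R e, y)\<bar> \<le> 2 * M * t powr 0"
    if "i < m" "norm x \<le> R" "0 \<le> t" "t \<le> 1" "0 \<le> y" "y \<le> 1" for i x t y
  proof (cases "t = 0")
    case False
    have "\<bar>v i (x + t *\<^sub>R e, y)\<bar> \<le> M" "\<bar>v i (x - t *\<^sub>R e, y)\<bar> \<le> M"
      using that norm_shift_le[OF en that(3,4), of x] norm_half_space_le[of "x + t *\<^sub>R e" y]
        norm_half_space_le[of "x - t *\<^sub>R e" y]
      by (auto intro!: M(2) simp: upper_cl_def)
    then show ?thesis using False by simp
  qed simp
  then show "\<exists>C>0. \<forall>i<m. \<forall>x t y. norm x \<le> R \<longrightarrow> 0 \<le> t \<longrightarrow> t \<le> 1 \<longrightarrow> 0 \<le> y \<longrightarrow> y \<le> 1 \<longrightarrow>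
     \<bar>v i (x + t *\<^sub>R e, y) - v i (x - t *\<^sub>R e, y)\<bar> \<le> C * t powr 0"
    using M(1) by (intro exI[of _ "2 * M"]) auto
qed

text \<open>Hoelder continuity of order \<alpha> passes to the flux, since the nonlinearity is
  locally Lipschitz. The flux differences are then at most M t^\<alpha> \<le> M t^(\<gamma>-2s) for
  t \<le> 1, which is the input of the comparison argument.\<close>

lemma holder_improve:
  assumes e: "e \<in> Basis" and H: "holder e \<alpha>" and g: "0 < \<gamma>" "\<gamma> < 2" "\<gamma> \<noteq> 1" and ga: "\<gamma> \<le> \<alpha> + 2 * s"
  shows "holder e (min \<gamma> 1)"
  unfolding holder_def
proof
  fix R0 :: real
  define R where "R = \<bar>R0\<bar>"
  have en: "norm e = 1" using e by simp
  \<comment> \<open>Centres have norm at most R, base points and shifts add at most 3 in x, and the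
    height adds 1.\<close>
  obtain M0 where M0: "M0 > 0" "\<And>i z. i < m \<Longrightarrow> z \<in> upper_cl \<Longrightarrow> norm z \<le> R + 4 \<Longrightarrow> \<bar>v i z\<bar> \<le> M0"
    using bounded_on_half_ball[of "R + 4"] by blast
  obtain M1 where M1: "M1 > 0" "\<And>i z b. i < m \<Longrightarrow> snd z \<ge> 1 \<Longrightarrow> norm z \<le> R + 4 \<Longrightarrow> b \<in> Basis \<Longrightarrow> \<bar>partial (v i) b z\<bar> \<le> M1"
    using tangential_derivative_bounded_inside[of "R + 4"] by blast
  obtain C0 where C0: "C0 > 0" "\<And>i x t y. i < m \<Longrightarrow> norm x \<le> R + 1 \<Longrightarrow> 0 \<le> t \<Longrightarrow> t \<le> 1 \<Longrightarrow> 0 \<le> y \<Longrightarrow> y \<le> 1 \<Longrightarrow>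
     \<bar>v i (x + t *\<^sub>R e, y) - v i (x - t *\<^sub>R e, y)\<bar> \<le> C0 * t powr \<alpha>"
    using H unfolding holder_def by meson
  \<comment> \<open>Lipschitz constant of the nonlinearity on vectors of norm at most m M0, times
    the Hoelder bound m C0 for the vector difference. Euclidean norms are estimated by sums of
    absolute values, hence the factors m.\<close>
  define M2 where "M2 = \<bar>\<kappa>\<bar> * (((p - 1) + 2) * (real m * M0) powr (p - 1) * (real m * C0))"
  define M where "M = M0 + 2 * M1 + M2"
  have M2: "M2 \<ge> 0" unfolding M2_def using p C0 by simp
  have M: "M > 0" "M0 \<le> M" "2 * M1 \<le> M" "M2 \<le> M" using M0 M1 M2 by (auto simp: M_def)
  obtain C where C: "C > 0" and est: "\<And>(f :: (real^'n) \<times> real \<Rightarrow> real) fl xc e M t y.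
      \<lbrakk>solves (1 - 2 * s) f; continuous_on upper_cl f; e \<in> Basis; M > 0;
       \<And>x. ((\<lambda>y. y powr (1 - 2 * s) * partial f (0, 1) (x, y)) \<longlongrightarrow> fl x) (at_right 0);
       \<And>x y. dist x xc \<le> 2 \<Longrightarrow> 0 \<le> y \<Longrightarrow> y \<le> 1 \<Longrightarrow> \<bar>f (x, y)\<bar> \<le> M;
       \<And>x t. dist x xc \<le> 1 \<Longrightarrow> 0 \<le> t \<Longrightarrow> t \<le> 1 \<Longrightarrow> \<bar>f (x + t *\<^sub>R e, 1) - f (x - t *\<^sub>R e, 1)\<bar> \<le> M * t;
       \<And>x t. dist x xc \<le> 1 \<Longrightarrow> 0 < t \<Longrightarrow> t \<le> 1 \<Longrightarrow>
          \<bar>fl (x + t *\<^sub>R e) - fl (x - t *\<^sub>R e)\<bar> \<le> M * t powr (\<gamma> - 2 * s);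
       0 \<le> t; t \<le> 1; 0 \<le> y; y \<le> 1\<rbrakk>
      \<Longrightarrow> f (xc + t *\<^sub>R e, y) - f (xc - t *\<^sub>R e, y) \<le> C * M * t powr (min \<gamma> 1)"
    by (rule tangential_difference_bound[OF s g, where 'n='n]) blast
  have "\<bar>v i (xc + t *\<^sub>R e, y) - v i (xc - t *\<^sub>R e, y)\<bar> \<le> C * M * t powr (min \<gamma> 1)"
    if i: "i < m" and xc: "norm xc \<le> R" and ty: "0 \<le> t" "t \<le> 1" "0 \<le> y" "y \<le> 1" for i xc t y
  proof -
    have nx: "norm x \<le> R + r" if "dist x xc \<le> r" for x r
      using xc that norm_triangle_ineq[of "x - xc" xc] by (simp add: dist_norm)
    define fl where "fl = (\<lambda>x. - (\<kappa> * vnorm m v (x, 0) powr (p - 1) * v i (x, 0)))"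
    have bd: "\<bar>v j (x, y)\<bar> \<le> M0" if "j < m" "norm x \<le> R + 3" "0 \<le> y" "y \<le> 1" for j x y
      using that norm_half_space_le[of x y] by (intro M0(2)) (auto simp: upper_cl_def)
    have top: "\<bar>v i (x + t *\<^sub>R e, 1) - v i (x - t *\<^sub>R e, 1)\<bar> \<le> 2 * M1 * t"
      if x: "dist x xc \<le> 1" and t: "0 \<le> t" "t \<le> 1" for x t
    proof (cases "t = 0")
      case False
      have D: "((\<lambda>r. v i ((x, 1) + r *\<^sub>R (e, 0))) has_real_derivative partial (v i) (e, 0) ((x, 1) + r *\<^sub>R (e, 0))) (at r)" for r
        by (rule has_real_derivative_line[OF C2_onD(1)[OF C2[OF i]]]) (simp add: upper_def)
      obtain z where z: "- t < z" "z < t" "v i ((x, 1) + t *\<^sub>R (e, 0)) - v i ((x, 1) + (- t) *\<^sub>R (e, 0))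
          = (t - (- t)) * partial (v i) (e, 0) ((x, 1) + z *\<^sub>R (e, 0))"
        using MVT2[of "- t" t "\<lambda>r. v i ((x, 1) + r *\<^sub>R (e, 0))", OF _ D] False t by auto
      have "norm (z *\<^sub>R e) \<le> 1" using z t en by simp
      then have "norm (x + z *\<^sub>R e, 1::real) \<le> R + 4"
        using norm_half_space_le[of "x + z *\<^sub>R e" 1] norm_triangle_ineq[of x "z *\<^sub>R e"] nx[OF x] by linarith
      then have "\<bar>partial (v i) (e, 0) ((x, 1) + z *\<^sub>R (e, 0))\<bar> \<le> M1"
        using e by (intro M1(2)[OF i]) (auto simp: Basis_prod_def)
      then have "\<bar>(t - (- t)) * partial (v i) (e, 0) ((x, 1) + z *\<^sub>R (e, 0))\<bar> \<le> 2 * M1 * t"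
        using t by (simp add: abs_mult mult.commute[of t] mult_right_mono)
      then show ?thesis unfolding z(3)[symmetric] by simp
    qed simp
    have fld: "\<bar>fl (x + t *\<^sub>R e) - fl (x - t *\<^sub>R e)\<bar> \<le> M2 * t powr (\<gamma> - 2 * s)"
      if x: "dist x xc \<le> 1" and t: "0 < t" "t \<le> 1" for x t
    proof -
      let ?w = "\<lambda>j. v j (x + t *\<^sub>R e, 0)" and ?u = "\<lambda>j. v j (x - t *\<^sub>R e, 0)"
      have n: "norm (x + t *\<^sub>R e) \<le> R + 3" "norm (x - t *\<^sub>R e) \<le> R + 3"
        using norm_shift_le[OF en _ t(2), of x] t nx[OF x] by auto
      have L2: "L2_set w {..<m} \<le> real m * c" if "\<And>j. j < m \<Longrightarrow> \<bar>w j\<bar> \<le> c" for w c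
        using L2_set_le_sum_abs[of w "{..<m}"] sum_bounded_above[of "{..<m}" "\<lambda>j. \<bar>w j\<bar>" c] that by fastforce
      have "\<bar>L2_set ?w {..<m} powr (p - 1) * ?w i - L2_set ?u {..<m} powr (p - 1) * ?u i\<bar>
        \<le> ((p - 1) + 2) * (real m * M0) powr (p - 1) * L2_set (\<lambda>j. ?w j - ?u j) {..<m}"
        by (rule power_nonlinearity_lipschitz) (use p i in \<open>auto intro!: L2 bd n\<close>)
      also have "\<dots> \<le> ((p - 1) + 2) * (real m * M0) powr (p - 1) * (real m * (C0 * t powr \<alpha>))"
        using p t nx[OF x] by (intro mult_left_mono L2 C0) auto
      finally have "\<bar>\<kappa>\<bar> * \<bar>L2_set ?w {..<m} powr (p - 1) * ?w i - L2_set ?u {..<m} powr (p - 1) * ?u i\<bar>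
        \<le> \<bar>\<kappa>\<bar> * (((p - 1) + 2) * (real m * M0) powr (p - 1) * (real m * (C0 * t powr \<alpha>)))"
        by (rule mult_left_mono) auto
      moreover have "fl (x + t *\<^sub>R e) - fl (x - t *\<^sub>R e) = - \<kappa> *
          (L2_set ?w {..<m} powr (p - 1) * ?w i - L2_set ?u {..<m} powr (p - 1) * ?u i)"
        unfolding fl_def vnorm_def L2_set_def by (simp add: algebra_simps)
      ultimately have "\<bar>fl (x + t *\<^sub>R e) - fl (x - t *\<^sub>R e)\<bar> \<le> M2 * t powr \<alpha>"
        by (simp add: abs_mult M2_def mult_ac)
      also have "\<dots> \<le> M2 * t powr (\<gamma> - 2 * s)"
        using t ga M2 by (intro mult_left_mono powr_mono') auto
      finally show ?thesis .
    qed
    \<comment> \<open>The comparison bounds the difference from one side only; the equation is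
      linear, so applying it to both signs \<open>c\<close> gives the absolute value.\<close>
    have main: "c * v i (xc + t *\<^sub>R e, y) - c * v i (xc - t *\<^sub>R e, y) \<le> C * M * t powr (min \<gamma> 1)"
      if c: "\<bar>c\<bar> = 1" for c
    proof (rule est[where f = "\<lambda>z. c * v i z" and fl = "\<lambda>x. c * fl x"])
      show "solves (1 - 2 * s) (\<lambda>z. c * v i z)"
        using solves_rescale[OF sol[OF i], of 1 0 c] by simp
      show "continuous_on upper_cl (\<lambda>z. c * v i z)" by (intro continuous_intros cont i)
      have pc: "partial (\<lambda>z. c * v i z) (0, 1) (x, y) = c * partial (v i) (0, 1) (x, y)" if "y > 0" for x y
        using partial_rescale[of "v i" 0 1 "(x, y)" c "(0, 1)"] C2_onD(1)[OF C2[OF i], of "(x, y)"] that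
        by (simp add: upper_def)
      show "((\<lambda>y. y powr (1 - 2 * s) * partial (\<lambda>z. c * v i z) (0, 1) (x, y)) \<longlongrightarrow> c * fl x) (at_right 0)" for x
      proof (rule Lim_transform_eventually)
        show "((\<lambda>y. c * (y powr (1 - 2 * s) * partial (v i) (0, 1) (x, y))) \<longlongrightarrow> c * fl x) (at_right 0)"
          unfolding fl_def by (intro tendsto_intros flux i)
        show "eventually (\<lambda>y. c * (y powr (1 - 2 * s) * partial (v i) (0, 1) (x, y))
            = y powr (1 - 2 * s) * partial (\<lambda>z. c * v i z) (0, 1) (x, y)) (at_right 0)"
          by (auto simp: eventually_at_filter pc intro!: always_eventually)
      qed
      show "\<bar>c * v i (x, y)\<bar> \<le> M" if "dist x xc \<le> 2" "0 \<le> y" "y \<le> 1" for x y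
        using bd[OF i, of x y] nx[OF that(1)] that M c by (simp add: abs_mult)
      show "\<bar>c * v i (x + t *\<^sub>R e, 1) - c * v i (x - t *\<^sub>R e, 1)\<bar> \<le> M * t"
        if "dist x xc \<le> 1" "0 \<le> t" "t \<le> 1" for x t
        using top[OF that] mult_right_mono[OF M(3) that(2)] c
        by (simp add: right_diff_distrib[symmetric] abs_mult)
      show "\<bar>c * fl (x + t *\<^sub>R e) - c * fl (x - t *\<^sub>R e)\<bar> \<le> M * t powr (\<gamma> - 2 * s)"
        if "dist x xc \<le> 1" "0 < t" "t \<le> 1" for x t
        using fld[OF that] mult_right_mono[OF M(4), of "t powr (\<gamma> - 2 * s)"] c
        by (simp add: right_diff_distrib[symmetric] abs_mult)
    qed (use e M ty in auto)
    show ?thesis using main[of 1] main[of "- 1"] by (simp add: abs_le_iff)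
  qed
  then show "\<exists>C>0. \<forall>i<m. \<forall>x t y. norm x \<le> R0 \<longrightarrow> 0 \<le> t \<longrightarrow> t \<le> 1 \<longrightarrow> 0 \<le> y \<longrightarrow> y \<le> 1 \<longrightarrow>
     \<bar>v i (x + t *\<^sub>R e, y) - v i (x - t *\<^sub>R e, y)\<bar> \<le> C * t powr (min \<gamma> 1)"
    using C M by (intro exI[of _ "C * M"]) (auto simp: R_def)
qed

text \<open>The exponents \<open>k / (N + 1/2)\<close> avoid the value 1, which \<open>holder_improve\<close> excludes.\<close>

lemma holder_one:
  assumes e: "e \<in> Basis"
  shows "holder e 1"
proof -
  \<comment> \<open>This choice makes one step \<sigma> at most 2s. Then N \<sigma> = 1 - \<sigma>/2
    is still below 1, and (N + 1) \<sigma> = 1 + \<sigma>/2 exceeds it, so the cap at 1 takes effect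
    exactly in the last step.\<close>
  obtain N :: nat where N: "real N \<ge> 1 / (2 * s)" using real_arch_simple by blast
  define \<sigma> where "\<sigma> = 1 / (real N + 1 / 2)"
  have \<sigma>: "\<sigma> > 0" by (simp add: \<sigma>_def add_nonneg_pos)
  have "2 * s * real N \<ge> 1" using N s by (simp add: field_simps)
  then have "1 \<le> 2 * s * (real N + 1 / 2)" using s by (simp add: distrib_left)
  then have \<sigma>s: "\<sigma> \<le> 2 * s" by (simp add: \<sigma>_def pos_divide_le_eq add_nonneg_pos)
  have N1: "\<sigma> * (real N + 1 / 2) = 1" by (simp add: \<sigma>_def)
  have "k \<le> N + 1 \<Longrightarrow> holder e (min (real k * \<sigma>) 1)" for k
  proof (induction k)
    case 0
    then show ?case using holder_zero[OF e] by simp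
  next
    case (Suc k)
    then have IH: "holder e (min (real k * \<sigma>) 1)" by simp
    have kN: "real k * \<sigma> \<le> real N * \<sigma>" using Suc.prems \<sigma> by (intro mult_right_mono) auto
    also have "\<dots> \<le> 1" using N1 \<sigma> by (simp add: algebra_simps)
    finally have k1: "min (real k * \<sigma>) 1 = real k * \<sigma>" by simp
    show ?case
    proof (rule holder_improve[OF e IH])
      show "0 < real (Suc k) * \<sigma>" using \<sigma> by simp
      have "real (Suc k) * \<sigma> \<le> (real N + 1) * \<sigma>" using Suc.prems \<sigma> by (intro mult_right_mono) auto
      also have "\<dots> = 1 + \<sigma> / 2" using N1 by (simp add: algebra_simps)
      also have "\<sigma> / 2 < 1"
      proof -
        have "\<sigma> \<le> 2 * s" by fact
        then show ?thesis using s by simp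
      qed
      finally show "real (Suc k) * \<sigma> < 2" by simp
      show "real (Suc k) * \<sigma> \<noteq> 1"
      proof
        assume "real (Suc k) * \<sigma> = 1"
        then have "(real (Suc k) - (real N + 1 / 2)) * \<sigma> = 0" using N1 by (simp add: algebra_simps)
        then have "real (Suc k) = real N + 1 / 2" using \<sigma> by simp
        then have "real (2 * Suc k) = real (2 * N + 1)" by simp
        then have "2 * Suc k = 2 * N + 1" by (simp only: of_nat_eq_iff)
        then show False by presburger
      qed
      show "real (Suc k) * \<sigma> \<le> min (real k * \<sigma>) 1 + 2 * s"
        unfolding k1 using \<sigma>s by (simp add: algebra_simps)
    qed
  qed
  from this[of "N + 1"] have "holder e (min (real (N + 1) * \<sigma>) 1)" by simp
  moreover have "real (N + 1) * \<sigma> \<ge> 1" using N1 \<sigma> by (simp add: algebra_simps)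
  ultimately show ?thesis by (simp only: min_absorb2)
qed

text \<open>The symmetric difference quotient converges to twice the derivative, so the Lipschitz
  bound passes to the tangential derivative with half its constant, uniformly as y tends to 0.
  Heights above 1 are covered by compactness.\<close>

lemma tangential_gradient_bound:
  obtains C where "C > 0" "\<And>i z b. i < m \<Longrightarrow> z \<in> upper \<Longrightarrow> norm z \<le> R \<Longrightarrow> b \<in> Basis \<Longrightarrow> \<bar>partial (v i) (b, 0) z\<bar> \<le> C"
proof -
  obtain M where M: "M > 0" "\<And>i z b. i < m \<Longrightarrow> snd z \<ge> 1 \<Longrightarrow> norm z \<le> R \<Longrightarrow> b \<in> Basis \<Longrightarrow> \<bar>partial (v i) b z\<bar> \<le> M"
    using tangential_derivative_bounded_inside[of R] by blast
  have ex: "\<exists>C. \<forall>a. fst a < m \<and> snd a \<in> upper \<and> snd (snd a) \<le> 1 \<and> norm (snd a) \<le> R \<longrightarrow>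
     \<bar>partial (v (fst a)) (e, 0) (snd a)\<bar> \<le> C" if e: "e \<in> Basis" for e
  proof -
    obtain C where C: "\<And>i x t y. i < m \<Longrightarrow> norm x \<le> R \<Longrightarrow> 0 \<le> t \<Longrightarrow> t \<le> 1 \<Longrightarrow> 0 \<le> y \<Longrightarrow> y \<le> 1 \<Longrightarrow>
     \<bar>v i (x + t *\<^sub>R e, y) - v i (x - t *\<^sub>R e, y)\<bar> \<le> C * t powr 1"
      using holder_one[OF e] unfolding holder_def by meson
    have "\<bar>partial (v i) (e, 0) (x, y)\<bar> \<le> C / 2"
      if i: "i < m" and y: "0 < y" "y \<le> 1" and x: "norm x \<le> R" for i x y
    proof -
      let ?D = "partial (v i) (e, 0) (x, y)"
      define F where "F = (\<lambda>r. v i ((x, y) + r *\<^sub>R (e, 0)))"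
      have F: "(F has_real_derivative ?D) (at 0)"
        unfolding F_def using has_real_derivative_line[OF C2_onD(1)[OF C2[OF i]], of "(x, y)" 0 "(e, 0)"] y
        by (simp add: upper_def zero_prod_def[symmetric])
      have F2: "((\<lambda>r. F (- r)) has_real_derivative - ?D) (at 0)"
        using F DERIV_mirror[of F ?D 0] by simp
      have "((\<lambda>r. F r - F (- r)) has_real_derivative ?D - (- ?D)) (at 0)"
        by (intro DERIV_diff F F2)
      then have "((\<lambda>r. (F r - F (- r)) / r) \<longlongrightarrow> 2 * ?D) (at 0)"
        by (simp add: has_field_derivative_iff)
      then have "((\<lambda>r. (F r - F (- r)) / r) \<longlongrightarrow> 2 * ?D) (at_right 0)"
        by (rule tendsto_mono[OF at_le[OF subset_UNIV]])
      then have "((\<lambda>r. \<bar>(F r - F (- r)) / r\<bar>) \<longlongrightarrow> \<bar>2 * ?D\<bar>) (at_right 0)"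
        by (rule tendsto_rabs)
      moreover have "eventually (\<lambda>r. \<bar>(F r - F (- r)) / r\<bar> \<le> C) (at_right 0)"
        unfolding eventually_at_right_field
      proof (intro exI[of _ 1] conjI allI impI)
        fix r :: real assume r: "0 < r" "r < 1"
        have "\<bar>v i (x + r *\<^sub>R e, y) - v i (x - r *\<^sub>R e, y)\<bar> \<le> C * r powr 1"
          by (rule C) (use i x y r in auto)
        then show "\<bar>(F r - F (- r)) / r\<bar> \<le> C" using r by (simp add: F_def pos_divide_le_eq)
      qed simp
      ultimately have "\<bar>2 * ?D\<bar> \<le> C" by (intro tendsto_upperbound) auto
      then show ?thesis by (simp add: abs_mult)
    qed
    moreover have "norm (fst z) \<le> R" if "norm z \<le> R" for z :: "(real^'n) \<times> real"
      using that norm_fst_le[of "fst z" "snd z"] by simp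
    ultimately show ?thesis by (intro exI[of _ "C / 2"]) (auto simp: upper_def)
  qed
  have "\<exists>C>0. \<forall>e\<in>(Basis :: (real^'n) set). \<forall>a. fst a < m \<and> snd a \<in> upper \<and> snd (snd a) \<le> 1 \<and> norm (snd a) \<le> R \<longrightarrow>
      \<bar>partial (v (fst a)) (e, 0) (snd a)\<bar> \<le> C"
    by (rule finite_uniform_bound[OF finite_Basis]) (rule ex)
  then obtain C where C0: "C > 0" and CC: "\<And>e a. e \<in> (Basis :: (real^'n) set) \<Longrightarrow>
      fst a < m \<and> snd a \<in> upper \<and> snd (snd a) \<le> 1 \<and> norm (snd a) \<le> R \<Longrightarrow>
      \<bar>partial (v (fst a)) (e, 0) (snd a)\<bar> \<le> C"
    by blast
  have C: "C > 0" "\<bar>partial (v i) (e, 0) z\<bar> \<le> C"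
    if "e \<in> Basis" "i < m" "z \<in> upper" "snd z \<le> 1" "norm z \<le> R" for e i z
    using C0 CC[of e "(i, z)"] that by auto
  show thesis
  proof (rule that[of "C + M"])
    fix i and z :: "(real^'n) \<times> real" and b :: "real^'n" assume a: "i < m" "z \<in> upper" "norm z \<le> R" "b \<in> Basis"
    have bB: "(b, 0::real) \<in> Basis" using a by (simp add: Basis_prod_def)
    show "\<bar>partial (v i) (b, 0) z\<bar> \<le> C + M"
    proof (cases "snd z \<le> 1")
      case True
      then show ?thesis using C(2)[OF a(4,1,2) True a(3)] M(1) by simp
    next
      case False
      then show ?thesis using M(2)[OF a(1) _ a(3) bB] C0 by simp
    qed
  qed (use C0 M in simp)
qed

end

section \<open>Green's identity on the unit half-ball\<close>

lemma integrable_indicator_cball: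
  "integrable lborel (indicator (cball (c::'a::euclidean_space) r) :: 'a \<Rightarrow> real)"
  by (rule integrable_real_indicator[OF _ emeasure_compact_finite[OF compact_cball]]) simp

text \<open>By translation invariance the difference quotients have integral zero.\<close>

lemma integral_partial_eq_0:
  fixes Y :: "'a::euclidean_space \<Rightarrow> real"
  assumes diff: "\<And>z. Y differentiable (at z)" and b: "b \<in> Basis"
    and cont: "continuous_on UNIV (partial Y b)"
    and supp: "\<And>z. norm z \<ge> R \<Longrightarrow> Y z = 0"
  shows "integrable lborel (partial Y b)" "(LINT z|lborel. partial Y b z) = 0"
proof -
  define D where "D = (\<lambda>n z. (Y (z + (1 / real (Suc n)) *\<^sub>R b) - Y z) * real (Suc n))"
  have nb: "norm b = 1" using b by simp
  have contY: "continuous_on UNIV Y"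
    using diff by (simp add: continuous_at_imp_continuous_on differentiable_imp_continuous_within)
  then have [measurable]: "Y \<in> borel_measurable borel" by (rule borel_measurable_continuous_onI)
  have [measurable]: "partial Y b \<in> borel_measurable borel" using cont by (rule borel_measurable_continuous_onI)
  have p0: "partial Y b z = 0" if "norm z > R" for z
  proof -
    have "(Y has_derivative (\<lambda>_. 0)) (at z)"
      by (rule has_derivative_transform_within_open[of "\<lambda>_. 0" _ _ _ "{z. norm z > R}"])
         (use that supp in \<open>auto intro!: open_Collect_less continuous_intros\<close>)
    then show ?thesis by (rule partial_eqI)
  qed
  obtain C where C: "\<And>z. norm z \<le> R + 2 \<Longrightarrow> \<bar>partial Y b z\<bar> \<le> C"
    using continuous_on_compact_bound[OF compact_cball continuous_on_subset[OF cont subset_UNIV], of 0 "R + 2"]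
    by (metis mem_cball_0 real_norm_def)
  have C1: "\<bar>partial Y b z\<bar> \<le> \<bar>C\<bar>" for z
    using C[of z] p0[of z] by (cases "norm z \<le> R + 2") auto
  have mv: "\<bar>Y (z + t *\<^sub>R b) - Y z\<bar> \<le> t * \<bar>C\<bar>" if tp: "t > 0" for z t
  proof -
    have D: "((\<lambda>r. Y (z + r *\<^sub>R b)) has_real_derivative partial Y b (z + r *\<^sub>R b)) (at r)" for r
      by (rule has_real_derivative_line[OF diff])
    obtain r where "Y (z + t *\<^sub>R b) - Y (z + 0 *\<^sub>R b) = (t - 0) * partial Y b (z + r *\<^sub>R b)"
      using MVT2[OF tp D] by blast
    then show ?thesis using tp C1[of "z + r *\<^sub>R b"] by (simp add: abs_mult)
  qed
  \<comment> \<open>The difference quotients vanish outside the ball of radius R + 1 because their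
    steps have length at most 1; inside, the mean value theorem bounds them.\<close>
  define B where "B = (\<lambda>z::'a. \<bar>C\<bar> * indicator (cball 0 (R + 1)) z)"
  have intB: "integrable lborel B"
    unfolding B_def by (intro integrable_mult_right integrable_indicator_cball)
  have DB: "norm (D n z) \<le> B z" for n z
  proof (cases "norm z \<le> R + 1")
    case True
    have "\<bar>Y (z + (1 / real (Suc n)) *\<^sub>R b) - Y z\<bar> * real (Suc n) \<le> (1 / real (Suc n) * \<bar>C\<bar>) * real (Suc n)"
      by (intro mult_right_mono mv) auto
    then show ?thesis using True by (simp add: D_def B_def abs_mult)
  next
    case False
    have "norm z \<le> norm (z + (1 / real (Suc n)) *\<^sub>R b) + norm ((1 / real (Suc n)) *\<^sub>R b)"
      using norm_triangle_ineq4[of "z + (1 / real (Suc n)) *\<^sub>R b" "(1 / real (Suc n)) *\<^sub>R b"] by simp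
    moreover have "norm ((1 / real (Suc n)) *\<^sub>R b) \<le> 1" using nb by simp
    ultimately have "norm (z + (1 / real (Suc n)) *\<^sub>R b) \<ge> R" using False by linarith
    then show ?thesis using False supp by (simp add: D_def B_def)
  qed
  have lim: "(\<lambda>n. D n z) \<longlonglongrightarrow> partial Y b z" for z
  proof -
    have "((\<lambda>r. Y (z + r *\<^sub>R b)) has_real_derivative partial Y b (z + 0 *\<^sub>R b)) (at 0)"
      by (rule has_real_derivative_line[OF diff])
    then have "((\<lambda>h. (Y (z + h *\<^sub>R b) - Y z) / h) \<longlongrightarrow> partial Y b z) (at 0)"
      by (simp add: DERIV_def)
    moreover have "filterlim (\<lambda>n. 1 / real (Suc n)) (at 0) sequentially"
      using LIMSEQ_inverse_real_of_nat by (auto simp: filterlim_at inverse_eq_divide)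
    ultimately have "(\<lambda>n. (Y (z + (1 / real (Suc n)) *\<^sub>R b) - Y z) / (1 / real (Suc n))) \<longlonglongrightarrow> partial Y b z"
      by (rule filterlim_compose)
    then show ?thesis by (simp add: D_def)
  qed
  have Dm: "D n \<in> borel_measurable lborel" for n unfolding D_def by measurable
  have pm: "partial Y b \<in> borel_measurable lborel" by measurable
  have conv: "(\<lambda>n. integral\<^sup>L lborel (D n)) \<longlonglongrightarrow> integral\<^sup>L lborel (partial Y b)"
    by (rule integral_dominated_convergence[OF pm Dm intB]) (use lim DB in auto)
  show "integrable lborel (partial Y b)"
    by (rule integrable_dominated_convergence[where s = D, OF pm Dm intB]) (use lim DB in auto)
  have "integral\<^sup>L lborel (D n) = 0" for n
  proof -
    let ?b = "(1 / real (Suc n)) *\<^sub>R b"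
    obtain K where K: "\<And>z. norm z \<le> R \<Longrightarrow> \<bar>Y z\<bar> \<le> K"
      using continuous_on_compact_bound[OF compact_cball continuous_on_subset[OF contY subset_UNIV], of 0 R]
      by (metis mem_cball_0 real_norm_def)
    have intY: "integrable lborel Y"
    proof (rule Bochner_Integration.integrable_bound)
      show "integrable lborel (\<lambda>z. K * indicator (cball 0 R) z :: real)"
        by (intro integrable_mult_right integrable_indicator_cball)
      show "AE z in lborel. norm (Y z) \<le> norm (K * indicator (cball 0 R) z :: real)"
      proof (rule AE_I2)
        fix z show "norm (Y z) \<le> norm (K * indicator (cball 0 R) z :: real)"
          using K[of z] supp[of z] by (cases "norm z \<le> R") auto
      qed
    qed measurable
    have tr: "distr lborel borel (\<lambda>z. z + ?b) = lborel" using lborel_distr_plus[of ?b] by (simp only: add.commute[of _ ?b])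
    have "integrable lborel (\<lambda>z. Y (z + ?b))"
      using integrable_distr_eq[of "\<lambda>z. z + ?b" lborel borel Y] tr intY by simp
    moreover have "integral\<^sup>L lborel (\<lambda>z. Y (z + ?b)) = integral\<^sup>L lborel Y"
      using integral_distr[of "\<lambda>z. z + ?b" lborel borel Y] tr by simp
    ultimately show ?thesis unfolding D_def using intY by simp
  qed
  then show "(LINT z|lborel. partial Y b z) = 0" using LIMSEQ_unique[OF conv] by simp
qed

text \<open>Closeness to \<open>c\<close> is demanded only where the weight is nonzero, so
  \<open>G\<close> need not be controlled elsewhere. It is applied with weights concentrating at y =
  0 from above and at r = 1 from below.\<close>

lemma approximate_identity:
  fixes \<phi> :: "nat \<Rightarrow> real \<Rightarrow> real" and G :: "real \<Rightarrow> real"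
  assumes one: "\<And>n. has_bochner_integral lborel (\<phi> n) 1" and pos: "\<And>n y. \<phi> n y \<ge> 0"
    and int: "\<And>n. integrable lborel (\<lambda>y. \<phi> n y * G y)"
    and conc: "\<And>e. e > 0 \<Longrightarrow> \<forall>\<^sub>F n in sequentially. \<forall>y. \<phi> n y \<noteq> 0 \<longrightarrow> \<bar>G y - c\<bar> \<le> e"
  shows "(\<lambda>n. LINT y|lborel. \<phi> n y * G y) \<longlonglongrightarrow> c"
proof (rule LIMSEQ_I)
  fix r :: real assume r: "r > 0"
  then obtain N where N: "\<And>n y. n \<ge> N \<Longrightarrow> \<phi> n y \<noteq> 0 \<Longrightarrow> \<bar>G y - c\<bar> \<le> r / 2"
    using conc[of "r / 2"] unfolding eventually_sequentially by auto
  have "norm ((LINT y|lborel. \<phi> n y * G y) - c) < r" if "n \<ge> N" for n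
  proof -
    have i1: "integrable lborel (\<phi> n)" and i2: "integral\<^sup>L lborel (\<phi> n) = 1"
      using one[of n] by (auto simp: has_bochner_integral_iff)
    have "(LINT y|lborel. \<phi> n y * G y) - c = (LINT y|lborel. \<phi> n y * G y) - (LINT y|lborel. \<phi> n y * c)"
      using i1 i2 by simp
    also have "\<dots> = (LINT y|lborel. \<phi> n y * G y - \<phi> n y * c)"
      using i1 int by (intro Bochner_Integration.integral_diff[symmetric]) auto
    finally have "\<bar>(LINT y|lborel. \<phi> n y * G y) - c\<bar> \<le> (LINT y|lborel. \<bar>\<phi> n y * G y - \<phi> n y * c\<bar>)"
      using integral_abs_bound[of lborel "\<lambda>y. \<phi> n y * G y - \<phi> n y * c"] by simp
    also have "\<dots> \<le> (LINT y|lborel. \<phi> n y * (r / 2))"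
    proof (rule integral_mono)
      fix y
      show "\<bar>\<phi> n y * G y - \<phi> n y * c\<bar> \<le> \<phi> n y * (r / 2)"
        using N[OF that, of y] pos[of n y] mult_left_mono[of "\<bar>G y - c\<bar>" "r / 2" "\<phi> n y"]
        by (cases "\<phi> n y = 0") (auto simp: abs_mult right_diff_distrib[symmetric])
    qed (use i1 int in auto)
    also have "\<dots> = r / 2" using i1 i2 by simp
    finally show ?thesis using r by simp
  qed
  then show "\<exists>no. \<forall>n\<ge>no. norm ((LINT y|lborel. \<phi> n y * G y) - c) < r" by blast
qed

text \<open>On [0,1] this is the cubic 3t^2 - 2t^3. Truncated squares give one formula on the whole
  line: the terms in t - 1 reduce the cubic to the constant 1 beyond t = 1. One continuous
  derivative is enough, as no cutoff is differentiated twice.\<close>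

lemma smooth_step_exists:
  obtains S S' :: "real \<Rightarrow> real" where "\<And>t. (S has_real_derivative S' t) (at t)"
    "continuous_on UNIV S'" "\<And>t. t \<le> 0 \<Longrightarrow> S t = 0" "\<And>t. t \<ge> 1 \<Longrightarrow> S t = 1"
    "\<And>t. S' t \<ge> 0" "\<And>t. t \<le> 0 \<or> t \<ge> 1 \<Longrightarrow> S' t = 0" "\<And>t. 0 \<le> S t \<and> S t \<le> 1"
proof -
  define P where "P = (\<lambda>t::real. (max 0 t)\<^sup>2)"
  have dP: "(P has_real_derivative 2 * max 0 t) (at t)" for t
  proof -
    consider "t > 0" | "t < 0" | "t = 0" by linarith
    then show ?thesis
    proof cases
      case 1
      have "((\<lambda>t. t\<^sup>2) has_real_derivative 2 * max 0 t) (at t)"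
        using 1 by (auto intro!: derivative_eq_intros)
      then show ?thesis
        by (rule has_field_derivative_transform_within_open[of _ _ _ "{0<..}"]) (use 1 in \<open>auto simp: P_def\<close>)
    next
      case 2
      have "((\<lambda>t. 0) has_real_derivative 2 * max 0 t) (at t)"
        using 2 by (auto intro!: derivative_eq_intros)
      then show ?thesis
        by (rule has_field_derivative_transform_within_open[of _ _ _ "{..<0}"]) (use 2 in \<open>auto simp: P_def\<close>)
    next
      case 3
      have "((\<lambda>h. (P (0 + h) - P 0) / h) \<longlongrightarrow> 0) (at 0)"
      proof (rule tendsto_0_le[where K = 1])
        show "((\<lambda>h::real. h) \<longlongrightarrow> 0) (at 0)" by (rule tendsto_ident_at)
        show "eventually (\<lambda>h. norm ((P (0 + h) - P 0) / h) \<le> norm h * 1) (at 0)"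
          by (auto simp: P_def power2_eq_square max_def eventually_at_filter)
      qed
      then show ?thesis using 3 by (simp add: DERIV_def)
    qed
  qed
  have dQ: "((\<lambda>t. t * P t) has_real_derivative 3 * P t) (at t)" for t
    by (rule DERIV_cong[OF DERIV_mult[OF DERIV_ident dP]]) (auto simp: P_def max_def power2_eq_square)
  define S where "S = (\<lambda>t. 3 * P t - 2 * (t * P t) + (3 * P (t - 1) + 2 * ((t - 1) * P (t - 1))))"
  define S' where "S' = (\<lambda>t. 6 * max 0 t - 6 * P t + (6 * max 0 (t - 1) + 6 * P (t - 1)))"
  have dP1: "((\<lambda>t. P (t - 1)) has_real_derivative 2 * max 0 (t - 1)) (at t)" for t
    using DERIV_shift[of P "2 * max 0 (t - 1)" t "- 1"] dP[of "t - 1"] by simp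
  have dQ1: "((\<lambda>t. (t - 1) * P (t - 1)) has_real_derivative 3 * P (t - 1)) (at t)" for t
    using DERIV_shift[of "\<lambda>t. t * P t" "3 * P (t - 1)" t "- 1"] dQ[of "t - 1"] by simp
  have dS: "(S has_real_derivative S' t) (at t)" for t
    unfolding S_def S'_def
    by (rule derivative_eq_intros dP dQ dP1 dQ1 refl | simp)+
  have S'1: "S' t = 0" if "t \<le> 0 \<or> t \<ge> 1" for t
    using that by (auto simp: S'_def P_def max_def power2_eq_square algebra_simps)
  have S'2: "S' t = 6 * (t * (1 - t))" if "0 < t" "t < 1" for t
    using that by (simp add: S'_def P_def max_def power2_eq_square algebra_simps)
  have pos: "S' t \<ge> 0" for t
    using S'1[of t] S'2[of t] by (cases "t \<le> 0 \<or> t \<ge> 1") auto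
  have S0: "S t = 0" if "t \<le> 0" for t using that by (auto simp: S_def P_def max_def)
  have S1: "S t = 1" if "t \<ge> 1" for t
    using that by (auto simp: S_def P_def max_def power2_eq_square algebra_simps)
  have mono: "S x \<le> S y" if "x \<le> y" for x y
    by (rule DERIV_nonneg_imp_nondecreasing[OF that]) (use dS pos in blast)
  have "0 \<le> S t \<and> S t \<le> 1" for t
    using mono[of "min t 0" t] mono[of t "max t 1"] S0[of "min t 0"] S1[of "max t 1"] by simp
  moreover have "continuous_on UNIV S'"
    unfolding S'_def P_def by (intro continuous_intros)
  ultimately show thesis by (intro that[of S S'] dS S0 S1 S'1 pos) auto
qed

section \<open>Integration by parts up to the flat boundary\<close>

lemma grad_inner_grad: "grad f z \<bullet> grad g z = (\<Sum>b\<in>Basis. partial f b z * partial g b z)"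
  by (subst euclidean_inner) (simp add: grad_inner_Basis)

text \<open>The integrand is the divergence of \<theta> h y^a grad k, the term with div (y^a grad k)
  being 0 by the equation for \<open>k\<close>. Since \<theta> vanishes for y \<le> e, the field
  extends by 0 to the whole space with bounded support, and each of its partial derivatives has
  integral 0.\<close>

lemma weak_form:
  fixes h k \<theta> :: "(real^'n) \<times> real \<Rightarrow> real"
  assumes k: "solves a k" and h: "C2_on upper h"
    and diff\<theta>: "\<And>z. \<theta> differentiable (at z)"
    and cont\<theta>: "\<And>b. b \<in> Basis \<Longrightarrow> continuous_on UNIV (partial \<theta> b)"
    and e: "e > 0" and low: "\<And>z. snd z \<le> e \<Longrightarrow> \<theta> z = 0" and supp: "\<And>z. norm z \<ge> R \<Longrightarrow> \<theta> z = 0"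
  shows "integrable lborel (\<lambda>z. snd z powr a * (\<theta> z * (grad h z \<bullet> grad k z) + h z * (grad \<theta> z \<bullet> grad k z)))"
      (is "integrable lborel ?I")
    and "(LINT z|lborel. snd z powr a * (\<theta> z * (grad h z \<bullet> grad k z) + h z * (grad \<theta> z \<bullet> grad k z))) = 0"
proof -
  have kC: "C2_on upper k" using k by (simp add: solves_def)
  \<comment> \<open>This half-space overlaps the upper one and together they cover the space;
    differentiability and continuity of the field are checked on each open piece.\<close>
  define L where "L = {z :: (real^'n) \<times> real. snd z < e}"
  have oL: "open L" unfolding L_def by (intro open_Collect_less continuous_intros)
  have cover: "upper \<union> L = UNIV" using e by (auto simp: upper_def L_def)
  define Y where "Y = (\<lambda>b z. \<theta> z * (h z * (snd z powr a * partial k b z)))"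
  define D where "D = (\<lambda>b z. \<theta> z * (h z * partial (\<lambda>w. snd w powr a * partial k b w) b z
      + partial h b z * (snd z powr a * partial k b z)) + partial \<theta> b z * (h z * (snd z powr a * partial k b z)))"
  have zero: "(f has_derivative (\<lambda>_. 0)) (at z)" if "z \<in> L" "\<And>w. w \<in> L \<Longrightarrow> f w = 0"
    for f :: "(real^'n) \<times> real \<Rightarrow> real" and z
    by (rule has_derivative_transform_within_open[OF _ oL that(1)]) (auto simp: that(2))
  have \<theta>L: "\<theta> w = 0" if "w \<in> L" for w using low that by (simp add: L_def)
  have YL: "(Y b has_derivative (\<lambda>_. 0)) (at z)" if "z \<in> L" for b z
    by (rule zero[OF that]) (simp add: Y_def \<theta>L)
  have \<theta>d: "partial \<theta> b z = 0" if "z \<in> L" for b z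
    by (rule partial_eqI[OF zero[OF that \<theta>L]])
  have YU: "(Y b has_derivative (\<lambda>d. \<theta> z * (h z * partial (\<lambda>w. snd w powr a * partial k b w) d z
      + partial h d z * (snd z powr a * partial k b z)) + partial \<theta> d z * (h z * (snd z powr a * partial k b z)))) (at z)"
    if z: "z \<in> upper" and b: "b \<in> Basis" for b z
    unfolding Y_def
    by (intro has_derivative_mult partial_has_derivative diff\<theta> C2_onD(1)[OF h z]
        differentiableI[OF weighted_partial[OF kC z b]])
  have YUb: "partial (Y b) b z = D b z" if "z \<in> upper" "b \<in> Basis" for b z
    unfolding D_def by (rule partial_eqI[OF YU[OF that]])
  have YLb: "partial (Y b) b z = 0" if "z \<in> L" for b z
    by (rule partial_eqI[OF YL[OF that]])
  have Ydiff: "Y b differentiable at z" if "b \<in> Basis" for b z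
  proof (cases "z \<in> upper")
    case True
    then show ?thesis by (rule differentiableI[OF YU[OF _ that]])
  next
    case False
    then have "z \<in> L" using cover by auto
    then show ?thesis by (rule differentiableI[OF YL])
  qed
  have contD: "continuous_on upper (D b)" if b: "b \<in> Basis" for b
  proof -
    have c1: "continuous_on upper (partial (\<lambda>w. snd w powr a * partial k b w) b)"
    proof (rule continuous_on_eq)
      show "continuous_on upper (\<lambda>z. snd z powr a * partial (partial k b) b z
          + a * snd z powr (a - 1) * snd b * partial k b z)"
        by (intro continuous_intros C2_on_continuous[OF kC] b) (auto simp: upper_def)
    qed (simp add: partial_eqI[OF weighted_partial[OF kC _ b]])
    have c2: "continuous_on upper \<theta>"
      using diff\<theta> by (simp add: continuous_at_imp_continuous_on differentiable_imp_continuous_within)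
    show ?thesis unfolding D_def
      by (intro continuous_intros c1 c2 C2_on_continuous[OF kC] C2_on_continuous[OF h] b
          continuous_on_subset[OF cont\<theta>[OF b]]) (auto simp: upper_def)
  qed
  have Ycont: "continuous_on UNIV (partial (Y b) b)" if b: "b \<in> Basis" for b
    unfolding cover[symmetric]
  proof (rule continuous_on_open_Un[OF open_upper oL])
    show "continuous_on upper (partial (Y b) b)"
      by (rule continuous_on_eq[OF contD[OF b]]) (simp add: YUb b)
    show "continuous_on L (partial (Y b) b)"
      by (rule continuous_on_eq[of _ "\<lambda>_. 0"]) (auto simp: YLb)
  qed
  have Ysupp: "Y b z = 0" if "norm z \<ge> R" for b z using supp that by (simp add: Y_def)
  note int = integral_partial_eq_0[OF Ydiff _ Ycont Ysupp]
  have eq: "(\<Sum>b\<in>Basis. partial (Y b) b z) = ?I z" for z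
  proof (cases "z \<in> upper")
    case True
    have "(\<Sum>b\<in>Basis. partial (Y b) b z) = (\<Sum>b\<in>Basis. D b z)"
      by (intro sum.cong refl YUb True)
    also have "\<dots> = \<theta> z * h z * (\<Sum>b\<in>Basis. partial (\<lambda>w. snd w powr a * partial k b w) b z)
      + snd z powr a * (\<theta> z * (\<Sum>b\<in>Basis. partial h b z * partial k b z) + h z * (\<Sum>b\<in>Basis. partial \<theta> b z * partial k b z))"
      unfolding D_def by (simp add: sum.distrib sum_distrib_left algebra_simps)
    also have "(\<Sum>b\<in>Basis. partial (\<lambda>w. snd w powr a * partial k b w) b z) = 0"
      using k True by (simp add: solves_def)
    finally show ?thesis by (simp add: grad_inner_grad)
  next
    case False
    then have z: "z \<in> L" using cover by auto
    then show ?thesis by (simp add: YLb grad_inner_grad \<theta>L \<theta>d)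
  qed
  have "integrable lborel (\<lambda>z. \<Sum>b\<in>Basis. partial (Y b) b z)"
    by (rule Bochner_Integration.integrable_sum) (rule int(1))
  then show "integrable lborel ?I" by (simp only: eq)
  have "(LINT z|lborel. (\<Sum>b\<in>Basis. partial (Y b) b z)) = (\<Sum>b\<in>Basis. LINT z|lborel. partial (Y b) b z)"
    by (rule Bochner_Integration.integral_sum) (rule int(1))
  also have "\<dots> = 0" by (intro sum.neutral ballI int(2))
  finally show "integral\<^sup>L lborel ?I = 0" by (simp only: eq)
qed

text \<open>The second function is the weighted normal derivative, extended to the boundary.\<close>

definition regular_solution ::
    "real \<Rightarrow> ((real^'n) \<times> real \<Rightarrow> real) \<Rightarrow> ((real^'n) \<times> real \<Rightarrow> real) \<Rightarrow> bool" where
  "regular_solution a f g \<longleftrightarrow> solves a f \<and> continuous_on upper_cl f \<and> continuous_on upper_cl g \<and>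
     (\<forall>z\<in>upper. g z = snd z powr a * partial f (0, 1) z) \<and>
     (\<forall>R. \<exists>C. \<forall>z\<in>upper. \<forall>b\<in>Basis. norm z \<le> R \<longrightarrow> \<bar>partial f (b, 0) z\<bar> \<le> C)"

lemma grad_inner:
  fixes f :: "(real^'n) \<times> real \<Rightarrow> real"
  shows "grad f z \<bullet> w = (\<Sum>b\<in>Basis. partial f (b, 0) z * (fst w \<bullet> b)) + partial f (0, 1) z * snd w"
proof -
  have "grad f z \<bullet> w = (\<Sum>b\<in>Basis. partial f b z * (b \<bullet> w))"
    unfolding grad_def by (simp add: inner_sum_left)
  then show ?thesis by (simp add: sum_Basis_half_space inner_Pair_0 inner_commute)
qed

text \<open>The normal derivative may be unbounded near y = 0; only y^a times it is known to be
  bounded, hence the factor y^(-a) in the last estimate.\<close>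

lemma regular_solution_bounds:
  fixes f g :: "(real^'n) \<times> real \<Rightarrow> real"
  assumes "regular_solution a f g"
  obtains C where "C > 0"
    "\<And>z. z \<in> upper_cl \<Longrightarrow> norm z \<le> R \<Longrightarrow> \<bar>f z\<bar> \<le> C" "\<And>z. z \<in> upper_cl \<Longrightarrow> norm z \<le> R \<Longrightarrow> \<bar>g z\<bar> \<le> C"
    "\<And>z b. z \<in> upper \<Longrightarrow> norm z \<le> R \<Longrightarrow> b \<in> Basis \<Longrightarrow> \<bar>partial f (b, 0) z\<bar> \<le> C"
    "\<And>z. z \<in> upper \<Longrightarrow> norm z \<le> R \<Longrightarrow> \<bar>partial f (0, 1) z\<bar> \<le> C * snd z powr (- a)"
proof -
  have cf: "continuous_on upper_cl f" and cg: "continuous_on upper_cl g"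
    and g: "\<And>z. z \<in> upper \<Longrightarrow> g z = snd z powr a * partial f (0, 1) z"
    and ex: "\<exists>C. \<forall>z\<in>upper. \<forall>b\<in>Basis. norm z \<le> R \<longrightarrow> \<bar>partial f (b, 0) z\<bar> \<le> C"
    using assms unfolding regular_solution_def by auto
  obtain C1 where C1: "C1 \<ge> 0" "\<And>z. z \<in> upper_cl \<inter> cball 0 R \<Longrightarrow> norm (f z) \<le> C1"
    by (rule continuous_on_compact_bound[OF compact_half_ball continuous_on_subset[OF cf Int_lower1]]) blast
  obtain C2 where C2: "C2 \<ge> 0" "\<And>z. z \<in> upper_cl \<inter> cball 0 R \<Longrightarrow> norm (g z) \<le> C2"
    by (rule continuous_on_compact_bound[OF compact_half_ball continuous_on_subset[OF cg Int_lower1]]) blast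
  obtain C3 where C3: "\<And>z b. z \<in> upper \<Longrightarrow> b \<in> Basis \<Longrightarrow> norm z \<le> R \<Longrightarrow> \<bar>partial f (b, 0) z\<bar> \<le> C3"
    using ex by blast
  define C where "C = 1 + C1 + C2 + \<bar>C3\<bar>"
  have C: "C > 0" "C1 \<le> C" "C2 \<le> C" "C3 \<le> C" using C1(1) C2(1) by (auto simp: C_def)
  show thesis
  proof (rule that[OF C(1)])
    fix z :: "(real^'n) \<times> real" assume "z \<in> upper_cl" "norm z \<le> R"
    then have "z \<in> upper_cl \<inter> cball 0 R" by simp
    from C1(2)[OF this] C2(2)[OF this] show "\<bar>f z\<bar> \<le> C" "\<bar>g z\<bar> \<le> C" using C by auto
  next
    fix z :: "(real^'n) \<times> real" and b :: "real^'n" assume "z \<in> upper" "norm z \<le> R" "b \<in> Basis"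
    then show "\<bar>partial f (b, 0) z\<bar> \<le> C" using C3[of z b] C(4) by simp
  next
    fix z :: "(real^'n) \<times> real" assume z: "z \<in> upper" "norm z \<le> R"
    have "snd z powr (- a) * snd z powr a = 1" using z by (simp add: upper_def powr_add[symmetric])
    then have "partial f (0, 1) z = g z * snd z powr (- a)"
      unfolding g[OF z(1)] by (simp add: mult_ac)
    moreover have "\<bar>g z\<bar> \<le> C" using C2(2)[of z] C(3) z upper_subset_cl by auto
    ultimately show "\<bar>partial f (0, 1) z\<bar> \<le> C * snd z powr (- a)"
      by (simp add: abs_mult mult_right_mono)
  qed
qed

text \<open>In grad h . grad k the two normal derivatives bring y^(-2a), so the weighted product is
  of order y^a + y^(-a), integrable for |a| < 1. In h (grad k . z) there is a single normal
  derivative, which the weight cancels, so no y^(-a) occurs; the surface integrals later rely on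
  this.\<close>

lemma grad_products_bound:
  fixes h gh k gk :: "(real^'n) \<times> real \<Rightarrow> real"
  assumes h: "regular_solution a h gh" and k: "regular_solution a k gk"
  obtains K where "K > 0"
    "\<And>z. z \<in> upper \<Longrightarrow> norm z \<le> R \<Longrightarrow> \<bar>snd z powr a * (grad h z \<bullet> grad k z)\<bar> \<le> K * (1 + snd z powr a + snd z powr (- a))"
    "\<And>z. z \<in> upper \<Longrightarrow> norm z \<le> R \<Longrightarrow> \<bar>h z * (snd z powr a * (grad k z \<bullet> z))\<bar> \<le> K * (1 + snd z powr a)"
proof -
  define N where "N = real CARD('n)"
  have N: "N \<ge> 1" by (simp add: N_def Suc_le_eq)
  obtain C1 where C1: "C1 > 0" "\<And>z. z \<in> upper_cl \<Longrightarrow> norm z \<le> R \<Longrightarrow> \<bar>h z\<bar> \<le> C1"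
    "\<And>z b. z \<in> upper \<Longrightarrow> norm z \<le> R \<Longrightarrow> b \<in> Basis \<Longrightarrow> \<bar>partial h (b, 0) z\<bar> \<le> C1"
    "\<And>z. z \<in> upper \<Longrightarrow> norm z \<le> R \<Longrightarrow> \<bar>partial h (0, 1) z\<bar> \<le> C1 * snd z powr (- a)"
    by (rule regular_solution_bounds[OF h, of R]) blast
  obtain C2 where C2: "C2 > 0" "\<And>z. z \<in> upper_cl \<Longrightarrow> norm z \<le> R \<Longrightarrow> \<bar>k z\<bar> \<le> C2"
    "\<And>z b. z \<in> upper \<Longrightarrow> norm z \<le> R \<Longrightarrow> b \<in> Basis \<Longrightarrow> \<bar>partial k (b, 0) z\<bar> \<le> C2"
    "\<And>z. z \<in> upper \<Longrightarrow> norm z \<le> R \<Longrightarrow> \<bar>partial k (0, 1) z\<bar> \<le> C2 * snd z powr (- a)"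
    by (rule regular_solution_bounds[OF k, of R]) blast
  define K where "K = N * C1 * C2 + N * C1 * C2 * \<bar>R\<bar>"
  have K: "N * C1 * C2 \<le> K" "N * C1 * C2 * \<bar>R\<bar> \<le> K" "K > 0"
    using N C1(1) C2(1) by (auto simp: K_def intro: add_pos_nonneg)
  have CK: "C1 * C2 \<le> N * C1 * C2" using N C1(1) C2(1) by simp
  show thesis
  proof (rule that[OF K(3)])
    fix z :: "(real^'n) \<times> real" assume z: "z \<in> upper" "norm z \<le> R"
    let ?w = "snd z powr a" and ?w' = "snd z powr (- a)"
    have y: "snd z > 0" using z by (simp add: upper_def)
    have ww: "?w * ?w' = 1" using y by (simp add: powr_add[symmetric])
    have "\<bar>\<Sum>b\<in>Basis. partial h (b, 0) z * partial k (b, 0) z\<bar> \<le> (\<Sum>b\<in>(Basis::(real^'n) set). C1 * C2)"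
      by (rule order_trans[OF sum_abs], rule sum_mono, unfold abs_mult, rule mult_mono)
         (use C1(1,3) C2(3) z in \<open>auto intro: less_imp_le\<close>)
    then have s1: "\<bar>\<Sum>b\<in>Basis. partial h (b, 0) z * partial k (b, 0) z\<bar> \<le> N * C1 * C2" by (simp add: N_def)
    have "\<bar>partial h (0, 1) z * partial k (0, 1) z\<bar> \<le> (C1 * ?w') * (C2 * ?w')"
      unfolding abs_mult by (rule mult_mono) (use C1(1,4) C2(4) z in auto)
    then have "?w * \<bar>partial h (0, 1) z * partial k (0, 1) z\<bar> \<le> ?w * ((C1 * ?w') * (C2 * ?w'))"
      by (rule mult_left_mono) simp
    also have "\<dots> = (?w * ?w') * (C1 * C2 * ?w')" by (simp only: mult_ac)
    finally have s2: "?w * \<bar>partial h (0, 1) z * partial k (0, 1) z\<bar> \<le> C1 * C2 * ?w'" by (simp add: ww)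
    have "\<bar>?w * (grad h z \<bullet> grad k z)\<bar> \<le> ?w * \<bar>\<Sum>b\<in>Basis. partial h (b, 0) z * partial k (b, 0) z\<bar>
        + ?w * \<bar>partial h (0, 1) z * partial k (0, 1) z\<bar>"
      unfolding grad_inner_grad sum_Basis_half_space distrib_left
      by (rule order_trans[OF abs_triangle_ineq]) (simp add: abs_mult)
    also have "\<dots> \<le> ?w * (N * C1 * C2) + C1 * C2 * ?w'"
      by (intro add_mono mult_left_mono s1 s2) auto
    also have "\<dots> \<le> ?w * K + K * ?w'"
      using K CK by (intro add_mono mult_left_mono mult_right_mono) auto
    also have "\<dots> \<le> K * (1 + ?w + ?w')" using K by (simp add: algebra_simps)
    finally show "\<bar>?w * (grad h z \<bullet> grad k z)\<bar> \<le> K * (1 + ?w + ?w')" .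
    have R: "R \<ge> 0" using z(2) norm_ge_zero order_trans by blast
    have zc: "z \<in> upper_cl" using z upper_subset_cl by auto
    have fz: "norm (fst z) \<le> R" "snd z \<le> R"
      using z(2) norm_fst_le[of "fst z" "snd z"] norm_snd_le[of "snd z" "fst z"] y by auto
    have bi: "\<bar>fst z \<bullet> b\<bar> \<le> R" if "b \<in> Basis" for b
      using Basis_le_norm[OF that, of "fst z"] fz(1) by linarith
    have "\<bar>\<Sum>b\<in>Basis. partial k (b, 0) z * (fst z \<bullet> b)\<bar> \<le> (\<Sum>b\<in>(Basis::(real^'n) set). C2 * R)"
      by (rule order_trans[OF sum_abs], rule sum_mono, unfold abs_mult, rule mult_mono)
         (use C2(1,3) z bi in auto)
    then have s3: "\<bar>\<Sum>b\<in>Basis. partial k (b, 0) z * (fst z \<bullet> b)\<bar> \<le> N * C2 * R" by (simp add: N_def)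
    have "\<bar>partial k (0, 1) z * snd z\<bar> \<le> (C2 * ?w') * R"
      unfolding abs_mult by (rule mult_mono) (use C2(1,4) z fz y R in auto)
    then have "?w * \<bar>partial k (0, 1) z * snd z\<bar> \<le> ?w * ((C2 * ?w') * R)"
      by (rule mult_left_mono) simp
    also have "\<dots> = (?w * ?w') * (C2 * R)" by (simp only: mult_ac)
    finally have s4: "?w * \<bar>partial k (0, 1) z * snd z\<bar> \<le> C2 * R" by (simp add: ww)
    have "\<bar>?w * (grad k z \<bullet> z)\<bar> \<le> ?w * \<bar>\<Sum>b\<in>Basis. partial k (b, 0) z * (fst z \<bullet> b)\<bar>
        + ?w * \<bar>partial k (0, 1) z * snd z\<bar>"
      unfolding grad_inner distrib_left
      by (rule order_trans[OF abs_triangle_ineq]) (simp add: abs_mult)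
    also have "\<dots> \<le> ?w * (N * C2 * R) + C2 * R"
      by (intro add_mono mult_left_mono s3 s4) auto
    also have "\<dots> \<le> ?w * (N * C2 * R) + N * C2 * R"
      using N C2(1) R by (intro add_left_mono) (simp add: mult_right_mono)
    finally have s5: "\<bar>?w * (grad k z \<bullet> z)\<bar> \<le> N * C2 * R * (1 + ?w)" by (simp add: algebra_simps)
    have "\<bar>h z * (?w * (grad k z \<bullet> z))\<bar> \<le> C1 * (N * C2 * R * (1 + ?w))"
      unfolding abs_mult[of "h z"] by (rule mult_mono[OF C1(2)[OF zc z(2)] s5]) (use C1(1) in auto)
    also have "\<dots> = N * C1 * C2 * \<bar>R\<bar> * (1 + ?w)" using R by simp
    also have "\<dots> \<le> K * (1 + ?w)" using K by (intro mult_right_mono) auto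
    finally show "\<bar>h z * (?w * (grad k z \<bullet> z))\<bar> \<le> K * (1 + ?w)" .
  qed
qed

lemma measurable_on_upper:
  fixes f :: "(real^'n) \<times> real \<Rightarrow> real"
  assumes "continuous_on upper f"
  shows "(\<lambda>z. indicator upper z * f z) \<in> borel_measurable borel"
  using borel_measurable_continuous_on_indicator[OF borel_open[OF open_upper] assms] by simp

text \<open>Fubini on the product of a ball in x and an interval in y that contains the half-ball;
  in y this is the integrability of y^a at 0.\<close>

lemma weight_integrable:
  assumes a: "a > -1"
  shows "integrable lborel (\<lambda>z :: (real^'n) \<times> real. indicator (upper \<inter> cball 0 R) z * snd z powr a)"
proof -
  define q where "q = (\<lambda>y::real. indicator {0..\<bar>R\<bar>} y * y powr a)"
  have "(\<lambda>y. y powr a) integrable_on {0..\<bar>R\<bar>}" by (rule integrable_on_powr_from_0[OF a]) simp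
  then have "(\<lambda>y. y powr a) absolutely_integrable_on {0..\<bar>R\<bar>}"
    by (subst absolutely_integrable_on_iff_nonneg) auto
  then have q: "integrable lborel q"
    unfolding set_integrable_def q_def by (subst (asm) integrable_completion) auto
  have q0: "q y \<ge> 0" for y by (simp add: q_def)
  have [measurable]: "q \<in> borel_measurable borel" using q by auto
  define F where "F = (\<lambda>z :: (real^'n) \<times> real. indicator (cball 0 R) (fst z) * q (snd z))"
  have "integrable (lborel \<Otimes>\<^sub>M lborel) F"
  proof (rule lborel_pair.Fubini_integrable)
    show "F \<in> borel_measurable (lborel \<Otimes>\<^sub>M lborel)" unfolding F_def
      by (intro borel_measurable_times measurable_compose[OF measurable_fst, of _ lborel]
          measurable_compose[OF measurable_snd, of _ lborel]) (auto intro!: borel_measurable_indicator)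
    show "integrable lborel (\<lambda>x. LINT y|lborel. norm (F (x, y)))"
      unfolding F_def by (simp add: abs_mult q0 integrable_indicator_cball)
    show "AE x in lborel. integrable lborel (\<lambda>y. F (x, y))"
      unfolding F_def using q by simp
  qed
  then have F: "integrable lborel F" by (simp add: lborel_prod)
  have "continuous_on upper (\<lambda>z :: (real^'n) \<times> real. snd z powr a)"
    by (intro continuous_intros) (auto simp: upper_def)
  then have m: "(\<lambda>z :: (real^'n) \<times> real. indicator upper z * snd z powr a) \<in> borel_measurable borel"
    by (rule measurable_on_upper)
  show ?thesis
  proof (rule Bochner_Integration.integrable_bound[OF F])
    have "(\<lambda>z :: (real^'n) \<times> real. indicator (cball 0 R) z * (indicator upper z * snd z powr a)) \<in> borel_measurable borel"
      by (rule borel_measurable_times[OF borel_measurable_indicator m]) simp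
    then show "(\<lambda>z :: (real^'n) \<times> real. indicator (upper \<inter> cball 0 R) z * snd z powr a) \<in> borel_measurable lborel"
      by (simp add: indicator_inter_arith mult_ac)
    show "AE z in lborel. norm (indicator (upper \<inter> cball 0 R) z * snd z powr a) \<le> norm (F z)"
    proof (rule AE_I2)
      fix z :: "(real^'n) \<times> real"
      show "norm (indicator (upper \<inter> cball 0 R) z * snd z powr a) \<le> norm (F z)"
      proof (cases "z \<in> upper \<inter> cball 0 R")
        case True
        then have "norm (fst z) \<le> R" "0 < snd z" "snd z \<le> R"
          using norm_fst_le[of "fst z" "snd z"] norm_snd_le[of "snd z" "fst z"] by (auto simp: upper_def)
        then show ?thesis using True by (simp add: F_def q_def)
      qed simp
    qed
  qed
qed

text \<open>The weak form is used with an extra cutoff in y. Its y-derivative is a probability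
  density concentrating at y = 0, against which y^a d_y k converges to the boundary value of
  \<open>gk\<close>; the two bulk terms converge by domination. The radial cutoff is a function of z
  . z, hence regular at the origin, with gradient 2 \<eta>' z.\<close>

lemma weak_form_up_to_boundary:
  fixes h gh k gk :: "(real^'n) \<times> real \<Rightarrow> real" and \<eta> \<eta>' :: "real \<Rightarrow> real"
  assumes a: "-1 < a" "a < 1"
    and h: "regular_solution a h gh" and k: "regular_solution a k gk"
    and d\<eta>: "\<And>u. (\<eta> has_real_derivative \<eta>' u) (at u)" and c\<eta>': "continuous_on UNIV \<eta>'"
    and \<eta>0: "\<And>u. u \<ge> \<rho> \<Longrightarrow> \<eta> u = 0 \<and> \<eta>' u = 0"
  defines "A \<equiv> \<lambda>z. indicator upper z * (\<eta> (z \<bullet> z) * (snd z powr a * (grad h z \<bullet> grad k z)))"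
    and "B \<equiv> \<lambda>z. indicator upper z * (2 * \<eta>' (z \<bullet> z) * (h z * (snd z powr a * (grad k z \<bullet> z))))"
  shows "integrable lborel A" "integrable lborel B"
    "integral\<^sup>L lborel A + integral\<^sup>L lborel B + (LINT x|lborel. \<eta> (x \<bullet> x) * (h (x, 0) * gk (x, 0))) = 0"
proof -
  have hs: "solves a h" "continuous_on upper_cl h" using h by (auto simp: regular_solution_def)
  have ks: "solves a k" "continuous_on upper_cl gk" "\<And>z. z \<in> upper \<Longrightarrow> gk z = snd z powr a * partial k (0, 1) z"
    using k by (auto simp: regular_solution_def)
  have hC: "C2_on upper h" and kC: "C2_on upper k" using hs ks by (auto simp: solves_def)
  \<comment> \<open>Beyond this radius z . z is at least \<rho>, because a norm above 1 is dominated
    by its square.\<close>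
  define R where "R = 1 + \<bar>\<rho>\<bar>"
  have R: "z \<bullet> z \<ge> \<rho>" if "norm z > R" for z :: "'b::real_inner"
  proof -
    have "norm z > 1" "norm z > \<rho>" using that by (auto simp: R_def)
    moreover from this have "norm z * 1 \<le> norm z * norm z" by (intro mult_left_mono) auto
    ultimately show ?thesis by (simp add: dot_square_norm power2_eq_square)
  qed
  have c\<eta>: "continuous_on UNIV \<eta>"
    using d\<eta> by (meson DERIV_isCont continuous_at_imp_continuous_on)
  obtain M1 where M1: "M1 \<ge> 0" "\<And>u. u \<in> {0..\<bar>\<rho>\<bar>} \<Longrightarrow> norm (\<eta> u) \<le> M1"
    by (rule continuous_on_compact_bound[OF compact_Icc continuous_on_subset[OF c\<eta> subset_UNIV]]) blast
  obtain M2 where M2: "M2 \<ge> 0" "\<And>u. u \<in> {0..\<bar>\<rho>\<bar>} \<Longrightarrow> norm (\<eta>' u) \<le> M2"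
    by (rule continuous_on_compact_bound[OF compact_Icc continuous_on_subset[OF c\<eta>' subset_UNIV]]) blast
  have \<eta>b: "\<bar>\<eta> u\<bar> \<le> M1" "\<bar>\<eta>' u\<bar> \<le> M2" if "u \<ge> 0" for u
    using M1(1) M1(2)[of u] M2(1) M2(2)[of u] \<eta>0[of u] that by (cases "u \<ge> \<rho>"; force)+
  obtain K where K: "K > 0"
    "\<And>z. z \<in> upper \<Longrightarrow> norm z \<le> R \<Longrightarrow> \<bar>snd z powr a * (grad h z \<bullet> grad k z)\<bar> \<le> K * (1 + snd z powr a + snd z powr (- a))"
    "\<And>z. z \<in> upper \<Longrightarrow> norm z \<le> R \<Longrightarrow> \<bar>h z * (snd z powr a * (grad k z \<bullet> z))\<bar> \<le> K * (1 + snd z powr a)"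
    by (rule grad_products_bound[OF h k, of R]) blast
  define W where "W = (\<lambda>z :: (real^'n) \<times> real. indicator (upper \<inter> cball 0 R) z * snd z powr 0
     + indicator (upper \<inter> cball 0 R) z * snd z powr a + indicator (upper \<inter> cball 0 R) z * snd z powr (- a))"
  have W: "integrable lborel W"
    unfolding W_def by (intro Bochner_Integration.integrable_add weight_integrable) (use a in auto)
  have Weq: "W z = 1 + snd z powr a + snd z powr (- a)" if "z \<in> upper" "norm z \<le> R" for z
    using that by (auto simp: W_def upper_def)
  have mA: "A \<in> borel_measurable borel"
    unfolding A_def
    by (intro measurable_on_upper continuous_intros C2_on_continuous_grad hC kC continuous_on_compose2[OF c\<eta>]) (auto simp: upper_def)
  have mB: "B \<in> borel_measurable borel"
    unfolding B_def
    by (intro measurable_on_upper continuous_intros C2_on_continuous_grad hC kC continuous_on_compose2[OF c\<eta>']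
        C2_on_continuous(1)[OF hC]) (auto simp: upper_def)
  have bA: "\<bar>A z\<bar> \<le> M1 * K * W z" for z
  proof (cases "z \<in> upper \<and> norm z \<le> R")
    case True
    then have "\<bar>A z\<bar> = \<bar>\<eta> (z \<bullet> z)\<bar> * \<bar>snd z powr a * (grad h z \<bullet> grad k z)\<bar>"
      by (simp add: A_def abs_mult)
    also have "\<dots> \<le> M1 * (K * (1 + snd z powr a + snd z powr (- a)))"
      by (rule mult_mono[OF \<eta>b(1) K(2)]) (use True M1 in auto)
    finally show ?thesis using True by (simp add: Weq mult.assoc)
  next
    case False
    then have "A z = 0" using R[of z] \<eta>0 by (auto simp: A_def)
    then show ?thesis using M1 K by (simp add: W_def)
  qed
  have bB: "\<bar>B z\<bar> \<le> 2 * M2 * K * W z" for z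
  proof (cases "z \<in> upper \<and> norm z \<le> R")
    case True
    then have "\<bar>B z\<bar> = \<bar>2 * \<eta>' (z \<bullet> z)\<bar> * \<bar>h z * (snd z powr a * (grad k z \<bullet> z))\<bar>"
      by (simp add: B_def abs_mult)
    also have "\<dots> \<le> (2 * M2) * (K * (1 + snd z powr a))"
      by (rule mult_mono[OF _ K(3)]) (use True M2 \<eta>b(2)[of "z \<bullet> z"] in \<open>auto simp: abs_mult\<close>)
    also have "\<dots> \<le> (2 * M2) * (K * (1 + snd z powr a + snd z powr (- a)))"
      using M2 K by (intro mult_left_mono) auto
    finally show ?thesis using True by (simp add: Weq mult.assoc)
  next
    case False
    then have "B z = 0" using R[of z] \<eta>0 by (auto simp: B_def)
    then show ?thesis using M2 K by (simp add: W_def)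
  qed
  have WA: "integrable lborel (\<lambda>z. M1 * K * W z)" and WB: "integrable lborel (\<lambda>z. 2 * M2 * K * W z)"
    using W by auto
  show iA: "integrable lborel A"
    by (rule Bochner_Integration.integrable_bound[OF WA])
       (use mA order_trans[OF bA abs_ge_self] in auto)
  show iB: "integrable lborel B"
    by (rule Bochner_Integration.integrable_bound[OF WB])
       (use mB order_trans[OF bB abs_ge_self] in auto)
  obtain S S' :: "real \<Rightarrow> real" where S: "\<And>t. (S has_real_derivative S' t) (at t)"
    "continuous_on UNIV S'" "\<And>t. t \<le> 0 \<Longrightarrow> S t = 0" "\<And>t. t \<ge> 1 \<Longrightarrow> S t = 1"
    "\<And>t. S' t \<ge> 0" "\<And>t. t \<le> 0 \<or> t \<ge> 1 \<Longrightarrow> S' t = 0" "\<And>t. 0 \<le> S t \<and> S t \<le> 1"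
    by (rule smooth_step_exists) blast
  have cS: "continuous_on UNIV S" using S(1) by (meson DERIV_isCont continuous_at_imp_continuous_on)
  define l where "l = (\<lambda>n. real (Suc n))"
  have l: "l n \<ge> 1" for n by (simp add: l_def)
  \<comment> \<open>The shift by 1 makes the cutoff vanish for y \<le> 1/l and equal 1 for y \<ge>
    2/l: the weak form needs a margin above the flat boundary.\<close>
  define \<theta> where "\<theta> = (\<lambda>n (z :: (real^'n) \<times> real). \<eta> (z \<bullet> z) * S (l n * snd z - 1))"
  have \<theta>: "(\<theta> n has_derivative (\<lambda>d. \<eta> (z \<bullet> z) * (S' (l n * snd z - 1) * (l n * snd d))
      + \<eta>' (z \<bullet> z) * (2 * (z \<bullet> d)) * S (l n * snd z - 1))) (at z)" for n z
  proof -
    have d1: "((\<lambda>z. z \<bullet> z) has_derivative (\<lambda>d. 2 * (z \<bullet> d))) (at z)"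
      by (rule has_derivative_eq_rhs[OF has_derivative_inner[OF has_derivative_ident has_derivative_ident]])
         (simp add: inner_commute)
    have d2: "((\<lambda>z :: (real^'n) \<times> real. l n * snd z - 1) has_derivative (\<lambda>d. l n * snd d)) (at z)"
      by (auto intro!: derivative_eq_intros)
    show ?thesis unfolding \<theta>_def
      by (rule has_derivative_mult[OF has_derivative_compose[OF d1 d\<eta>[unfolded has_field_derivative_def]]
            has_derivative_compose[OF d2 S(1)[unfolded has_field_derivative_def]]])
  qed
  have \<theta>d: "\<theta> n differentiable (at z)" for n z using \<theta> by (rule differentiableI)
  have \<theta>p: "partial (\<theta> n) d z = \<eta> (z \<bullet> z) * (S' (l n * snd z - 1) * (l n * snd d))
      + \<eta>' (z \<bullet> z) * (2 * (z \<bullet> d)) * S (l n * snd z - 1)" for n d z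
    by (rule partial_eqI[OF \<theta>])
  have \<theta>c: "continuous_on UNIV (partial (\<theta> n) b)" for n b
  proof -
    have "partial (\<theta> n) b = (\<lambda>z. \<eta> (z \<bullet> z) * (S' (l n * snd z - 1) * (l n * snd b))
      + \<eta>' (z \<bullet> z) * (2 * (z \<bullet> b)) * S (l n * snd z - 1))" by (rule ext) (rule \<theta>p)
    then show ?thesis
      by (auto intro!: continuous_intros continuous_on_compose2[OF c\<eta>] continuous_on_compose2[OF c\<eta>']
          continuous_on_compose2[OF S(2)] continuous_on_compose2[OF cS])
  qed
  have \<theta>low: "\<theta> n z = 0" if "snd z \<le> 1 / l n" for n z
  proof -
    have "l n * snd z \<le> 1" using that l[of n] by (simp add: field_simps)
    then show ?thesis by (simp add: \<theta>_def S(3))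
  qed
  have \<theta>supp: "\<theta> n z = 0" if "norm z \<ge> R + 1" for n z
    using R[of z] that \<eta>0 by (simp add: \<theta>_def)
  have ln: "1 / l n > 0" for n using l[of n] by simp
  note wf = weak_form[OF ks(1) hC \<theta>d \<theta>c ln \<theta>low \<theta>supp]
  define \<phi> where "\<phi> = (\<lambda>n y. l n * S' (l n * y - 1))"
  define G where "G = (\<lambda>z :: (real^'n) \<times> real. \<eta> (z \<bullet> z) * (h z * gk z))"
  define Sn where "Sn = (\<lambda>n (z :: (real^'n) \<times> real). S (l n * snd z - 1))"
  have \<phi>supp: "0 < y \<and> y < 2 / l n" if "\<phi> n y \<noteq> 0" for n y
  proof -
    have "\<not> (l n * y - 1 \<le> 0 \<or> l n * y - 1 \<ge> 1)" using that S(6) by (auto simp: \<phi>_def)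
    then have "1 < l n * y" "l n * y < 2" by auto
    then show ?thesis using l[of n] by (auto simp: field_simps zero_less_mult_iff dest: less_trans[OF zero_less_one])
  qed
  \<comment> \<open>The gradient of the product cutoff has a radial part, which belongs to
    \<open>B\<close>, and a vertical part, which gives \<phi> times h y^a d_y k. Outside the upper
    half-space all terms vanish.\<close>
  have split: "snd z powr a * (\<theta> n z * (grad h z \<bullet> grad k z) + h z * (grad (\<theta> n) z \<bullet> grad k z))
      = Sn n z * A z + Sn n z * B z + \<phi> n (snd z) * G z" for n z
  proof (cases "z \<in> upper")
    case True
    have "grad (\<theta> n) z \<bullet> grad k z = \<eta> (z \<bullet> z) * (S' (l n * snd z - 1) * (l n * snd (grad k z)))
      + \<eta>' (z \<bullet> z) * (2 * (z \<bullet> grad k z)) * S (l n * snd z - 1)"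
      by (simp add: partial_eq_grad_inner[OF \<theta>d, symmetric] \<theta>p)
    moreover have "snd (grad k z) = partial k (0, 1) z"
      using partial_eq_grad_inner[OF C2_onD(1)[OF kC True], of "(0, 1)"] by (simp add: inner_prod_def)
    ultimately show ?thesis using True ks(3)[OF True]
      by (simp add: A_def B_def Sn_def \<phi>_def G_def \<theta>_def inner_commute algebra_simps)
  next
    case False
    then have "snd z \<le> 0" by (simp add: upper_def not_less)
    moreover from this have "l n * snd z \<le> 0" using l[of n] by (simp add: mult_nonneg_nonpos)
    ultimately have "S (l n * snd z - 1) = 0" "S' (l n * snd z - 1) = 0" using S(3,6)[of "l n * snd z - 1"] by auto
    moreover from this have "grad (\<theta> n) z = 0" by (simp add: grad_def \<theta>p)
    ultimately show ?thesis using False by (simp add: A_def B_def Sn_def \<phi>_def \<theta>_def)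
  qed
  have Snm: "Sn n \<in> borel_measurable borel" for n
    unfolding Sn_def by (intro borel_measurable_continuous_onI continuous_on_compose2[OF cS] continuous_intros) auto
  have Sn1: "\<bar>Sn n z\<bar> \<le> 1" for n z using S(7)[of "l n * snd z - 1"] by (simp add: Sn_def)
  have SnA: "(\<lambda>n. Sn n z * F z) \<longlonglongrightarrow> F z" if F: "\<And>z. z \<notin> upper \<Longrightarrow> F z = 0" for F z
  proof (cases "z \<in> upper")
    case True
    then have y: "snd z > 0" by (simp add: upper_def)
    obtain N where N: "real N \<ge> 2 / snd z" using real_arch_simple by blast
    have "Sn n z = 1" if "n \<ge> N" for n
    proof -
      have "l n \<ge> 2 / snd z" using N that by (simp add: l_def)
      then have "l n * snd z \<ge> 2" using y by (simp add: field_simps)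
      then show ?thesis by (simp add: Sn_def S(4))
    qed
    then have "eventually (\<lambda>n. Sn n z * F z = F z) sequentially"
      unfolding eventually_sequentially by auto
    then show ?thesis by (rule tendsto_eventually)
  qed (simp add: F)
  have conv: "integrable lborel (\<lambda>z. Sn n z * F z)" "(\<lambda>n. LINT z|lborel. Sn n z * F z) \<longlonglongrightarrow> integral\<^sup>L lborel F"
    if F: "\<And>z. z \<notin> upper \<Longrightarrow> F z = 0" and iF: "integrable lborel F" for F n
  proof -
    have m: "F \<in> borel_measurable lborel" "(\<lambda>z. Sn n z * F z) \<in> borel_measurable lborel" for n
      using iF Snm[of n] by auto
    have ab: "integrable lborel (\<lambda>z. \<bar>F z\<bar>)" using iF by simp
    have bd: "norm (Sn n z * F z) \<le> \<bar>F z\<bar>" for n z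
      using mult_right_mono[OF Sn1[of n z], of "\<bar>F z\<bar>"] by (simp add: abs_mult)
    show "integrable lborel (\<lambda>z. Sn n z * F z)"
      by (rule Bochner_Integration.integrable_bound[OF ab m(2)]) (use bd in auto)
    have SnF: "(\<lambda>n. Sn n z * F z) \<longlonglongrightarrow> F z" for z by (rule SnA[of F z]) (rule F)
    show "(\<lambda>n. LINT z|lborel. Sn n z * F z) \<longlonglongrightarrow> integral\<^sup>L lborel F"
      by (rule integral_dominated_convergence[OF m ab]) (rule AE_I2 SnF bd)+
  qed
  have AU: "A z = 0" and BU: "B z = 0" if "z \<notin> upper" for z using that by (auto simp: A_def B_def)
  have iC: "integrable lborel (\<lambda>z. \<phi> n (snd z) * G z)" for n
  proof -
    have "integrable lborel (\<lambda>z. (Sn n z * A z + Sn n z * B z + \<phi> n (snd z) * G z) - Sn n z * A z - Sn n z * B z)"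
      using wf(1)[of n] unfolding split by (intro Bochner_Integration.integrable_diff conv(1) AU BU iA iB) auto
    then show ?thesis by simp
  qed
  have sum0: "(LINT z|lborel. Sn n z * A z) + (LINT z|lborel. Sn n z * B z) + (LINT z|lborel. \<phi> n (snd z) * G z) = 0" for n
    using wf(2)[of n] unfolding split
    by (simp add: conv(1) AU BU iA iB iC Bochner_Integration.integrable_add)
  have \<phi>c: "continuous_on UNIV (\<phi> n)" for n
    unfolding \<phi>_def by (intro continuous_intros continuous_on_compose2[OF S(2)]) auto
  have \<phi>1: "has_bochner_integral lborel (\<phi> n) 1" for n
  proof -
    have D: "((\<lambda>y. S (l n * y - 1)) has_real_derivative \<phi> n y) (at y)" for y
      unfolding \<phi>_def
      by (rule DERIV_cong[OF DERIV_chain2[OF S(1)]]) (auto intro!: derivative_eq_intros)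
    have "has_bochner_integral lborel (\<lambda>y. \<phi> n y * indicator {0..2} y) (S (l n * 2 - 1) - S (l n * 0 - 1))"
      by (rule has_bochner_integral_FTC_Icc_real[where F = "\<lambda>y. S (l n * y - 1)"])
         (use D \<phi>c[of n] in \<open>auto simp: continuous_on_eq_continuous_at\<close>)
    moreover have "2 / l n \<le> 2" using l[of n] by (simp add: field_simps)
    then have "(\<lambda>y. \<phi> n y * indicator {0..2} y) = \<phi> n"
      using \<phi>supp[of n] by (force simp: fun_eq_iff indicator_def)
    moreover have "S (l n * 2 - 1) - S (l n * 0 - 1) = 1" using S(3,4) l[of n] by simp
    ultimately show ?thesis by simp
  qed
  have \<phi>pos: "\<phi> n y \<ge> 0" for n y using S(5) l[of n] by (simp add: \<phi>_def)
  have Gc: "continuous_on upper_cl G"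
    unfolding G_def by (intro continuous_intros continuous_on_compose2[OF c\<eta>] hs ks) auto
  have Gx: "continuous_on {0..} (\<lambda>y. G (x, y))" for x
    by (intro continuous_on_compose2[OF Gc] continuous_intros) (auto simp: upper_cl_def)
  have iGx: "integrable lborel (\<lambda>y. \<phi> n y * G (x, y))" for n x
  proof -
    have "integrable lborel (\<lambda>y. indicator {0..2} y *\<^sub>R (\<phi> n y * G (x, y)))"
      by (rule borel_integrable_compact[OF compact_Icc])
         (auto intro!: continuous_intros continuous_on_subset[OF \<phi>c] continuous_on_subset[OF Gx])
    moreover have "2 / l n \<le> 2" using l[of n] by (simp add: field_simps)
    then have "(\<lambda>y. indicator {0..2} y *\<^sub>R (\<phi> n y * G (x, y))) = (\<lambda>y. \<phi> n y * G (x, y))"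
      using \<phi>supp[of n] by (force simp: fun_eq_iff indicator_def)
    ultimately show ?thesis by simp
  qed
  have limx: "(\<lambda>n. LINT y|lborel. \<phi> n y * G (x, y)) \<longlonglongrightarrow> G (x, 0)" for x
  proof (rule approximate_identity[OF \<phi>1 \<phi>pos iGx])
    fix e :: real assume "e > 0"
    then obtain d where d: "d > 0" "\<And>y. y \<ge> 0 \<Longrightarrow> dist y 0 < d \<Longrightarrow> dist (G (x, y)) (G (x, 0)) < e"
      using Gx[of x] unfolding continuous_on_iff by (metis atLeast_iff order_refl)
    obtain N where N: "real N \<ge> 2 / d" using real_arch_simple by blast
    have "\<bar>G (x, y) - G (x, 0)\<bar> \<le> e" if n: "n \<ge> N" "\<phi> n y \<noteq> 0" for n y
    proof -
      have "l n \<ge> 2 / d" using N n(1) by (simp add: l_def)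
      then have "2 / l n \<le> d" using d(1) l[of n] by (simp add: field_simps)
      then show ?thesis using \<phi>supp[OF n(2)] d(2)[of y] by (simp add: dist_real_def)
    qed
    then show "\<forall>\<^sub>F n in sequentially. \<forall>y. \<phi> n y \<noteq> 0 \<longrightarrow> \<bar>G (x, y) - G (x, 0)\<bar> \<le> e"
      unfolding eventually_sequentially by blast
  qed
  obtain M where M: "M \<ge> 0" "\<And>z. z \<in> upper_cl \<inter> cball 0 R \<Longrightarrow> norm (G z) \<le> M"
    by (rule continuous_on_compact_bound[OF compact_half_ball continuous_on_subset[OF Gc Int_lower1]]) blast
  have GM: "\<bar>G (x, y)\<bar> \<le> M * indicator (cball 0 R) x" if "y \<ge> 0" for x y
  proof (cases "norm (x, y) \<le> R")
    case True
    then have "norm x \<le> R" using norm_fst_le[of x y] by simp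
    then show ?thesis using M(2)[of "(x, y)"] True that by (simp add: upper_cl_def)
  next
    case False
    then have "G (x, y) = 0" using R[of "(x, y)"] \<eta>0 by (simp add: G_def)
    then show ?thesis using M(1) by simp
  qed
  have bdx: "\<bar>LINT y|lborel. \<phi> n y * G (x, y)\<bar> \<le> M * indicator (cball 0 R) x" for n x
  proof -
    have "norm (LINT y|lborel. \<phi> n y * G (x, y)) \<le> (LINT y|lborel. \<phi> n y * (M * indicator (cball 0 R) x))"
    proof (rule Bochner_Integration.integral_norm_bound_integral[OF iGx])
      show "integrable lborel (\<lambda>y. \<phi> n y * (M * indicator (cball 0 R) x))"
        using \<phi>1[of n] by (auto simp: has_bochner_integral_iff)
      fix y
      show "norm (\<phi> n y * G (x, y)) \<le> \<phi> n y * (M * indicator (cball 0 R) x)"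
        using \<phi>supp[of n y] \<phi>pos[of n y] mult_left_mono[OF GM[of y x], of "\<phi> n y"]
        by (cases "\<phi> n y = 0") (auto simp: abs_mult)
    qed
    also have "\<dots> = M * indicator (cball 0 R) x" using \<phi>1[of n] by (auto simp: has_bochner_integral_iff)
    finally show ?thesis by simp
  qed
  \<comment> \<open>Integrating in y first reduces the flat term to a one-dimensional limit for each
    x, dominated by a constant on a ball.\<close>
  have fub: "(LINT z|lborel. \<phi> n (snd z) * G z) = (LINT x|lborel. LINT y|lborel. \<phi> n y * G (x, y))"
    and ifub: "integrable lborel (\<lambda>x. LINT y|lborel. \<phi> n y * G (x, y))" for n
    using lborel_pair.integral_fst'[of "\<lambda>z. \<phi> n (snd z) * G z"] lborel_pair.integrable_fst'[of "\<lambda>z. \<phi> n (snd z) * G z"]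
      iC[of n] by (simp_all add: lborel_prod)
  have limC: "(\<lambda>n. LINT z|lborel. \<phi> n (snd z) * G z) \<longlonglongrightarrow> (LINT x|lborel. G (x, 0))"
    unfolding fub
  proof (rule integral_dominated_convergence[where w = "\<lambda>x. M * indicator (cball 0 R) x"])
    have "continuous_on UNIV (\<lambda>x. G (x, 0))"
      by (intro continuous_on_compose2[OF Gc] continuous_intros) (auto simp: upper_cl_def)
    then show "(\<lambda>x. G (x, 0)) \<in> borel_measurable lborel" using borel_measurable_continuous_onI by auto
    show "integrable lborel (\<lambda>x::real^'n. M * indicator (cball 0 R) x)"
      by (intro integrable_mult_right integrable_indicator_cball)
  qed (rule borel_measurable_integrable[OF ifub] AE_I2 limx | simp add: bdx)+
  have "(\<lambda>n. (LINT z|lborel. Sn n z * A z) + (LINT z|lborel. Sn n z * B z) + (LINT z|lborel. \<phi> n (snd z) * G z))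
      \<longlonglongrightarrow> integral\<^sup>L lborel A + integral\<^sup>L lborel B + (LINT x|lborel. G (x, 0))"
    by (intro tendsto_add conv(2) AU BU iA iB limC)
  then have "integral\<^sup>L lborel A + integral\<^sup>L lborel B + (LINT x|lborel. G (x, 0)) = 0"
    unfolding sum0 using LIMSEQ_unique tendsto_const by metis
  then show "integral\<^sup>L lborel A + integral\<^sup>L lborel B + (LINT x|lborel. \<eta> (x \<bullet> x) * (h (x, 0) * gk (x, 0))) = 0"
    by (simp add: G_def inner_prod_def)
qed

section \<open>Polar coordinates and the cone-measure surface integral\<close>

lemma nn_integral_scaleR:
  fixes F :: "'a::euclidean_space \<Rightarrow> ennreal"
  assumes [measurable]: "F \<in> borel_measurable borel" and c: "c > 0"
  shows "(\<integral>\<^sup>+z. F z \<partial>lborel) = ennreal (c ^ DIM('a)) * (\<integral>\<^sup>+z. F (c *\<^sub>R z) \<partial>lborel)"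
  using c by (subst lborel_affine[of c 0]) (simp_all add: nn_integral_density nn_integral_distr nn_integral_cmult)

text \<open>
  Substitute \<open>r = \<sigma> norm z\<close> in the inner integral, then \<open>z = w / \<sigma>\<close>; the integral over \<open>\<sigma>\<close> that
  remains is 1. This justifies the cone-measure definition of the surface integral.
\<close>

lemma nn_integral_polar:
  fixes F :: "'a::euclidean_space \<Rightarrow> ennreal"
  assumes [measurable]: "F \<in> borel_measurable borel"
  defines "N \<equiv> DIM('a)"
  shows "(\<integral>\<^sup>+r. \<integral>\<^sup>+z. ennreal (indicator {0<..} r * indicator (ball 0 1) z * (real N * r ^ (N - 1)))
      * F (r *\<^sub>R (z /\<^sub>R norm z)) \<partial>lborel \<partial>lborel) = (\<integral>\<^sup>+z. F z \<partial>lborel)"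
proof -
  have N: "N > 0" by (simp add: N_def)
  have [measurable]: "(\<lambda>z. indicator (ball 0 1) z :: real) \<in> borel_measurable (borel :: 'a measure)"
    by (intro borel_measurable_indicator) simp
  \<comment> \<open>Densities after the two substitutions: \<open>w2\<close> contains the factor |z|
    from dr = |z| d\<sigma>, and \<open>w3\<close> the factor \<sigma>^(-N) from the dilation in z,
    which also turns |z| < 1 into |w| < \<sigma>.\<close>
  define w2 where "w2 = (\<lambda>\<sigma> z. indicator {0<..} \<sigma> * indicator (ball 0 1) (z::'a) * (real N * \<sigma> ^ (N - 1) * norm z ^ N))"
  define w3 where "w3 = (\<lambda>\<sigma> z. if norm (z::'a) < \<sigma> then real N * norm z ^ N / \<sigma> ^ (N + 1) else 0)"
  have w3n: "w3 \<sigma> z \<ge> 0" for \<sigma> z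
  proof (cases "norm z < \<sigma>")
    case True
    then have "\<sigma> > 0" using norm_ge_zero[of z] by linarith
    then show ?thesis by (simp add: w3_def)
  qed (simp add: w3_def)
  have "(\<integral>\<^sup>+r. \<integral>\<^sup>+z. ennreal (indicator {0<..} r * indicator (ball 0 1) z * (real N * r ^ (N - 1)))
      * F (r *\<^sub>R (z /\<^sub>R norm z)) \<partial>lborel \<partial>lborel)
    = (\<integral>\<^sup>+z. \<integral>\<^sup>+r. ennreal (indicator {0<..} r * indicator (ball 0 1) z * (real N * r ^ (N - 1)))
      * F (r *\<^sub>R (z /\<^sub>R norm z)) \<partial>lborel \<partial>lborel)"
    by (rule lborel_pair.Fubini'[symmetric]) measurable
  also have "\<dots> = (\<integral>\<^sup>+z. \<integral>\<^sup>+\<sigma>. ennreal (w2 \<sigma> z) * F (\<sigma> *\<^sub>R z) \<partial>lborel \<partial>lborel)"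
  proof (rule nn_integral_cong_AE)
    show "AE z in lborel. (\<integral>\<^sup>+r. ennreal (indicator {0<..} r * indicator (ball 0 1) z * (real N * r ^ (N - 1)))
      * F (r *\<^sub>R (z /\<^sub>R norm z)) \<partial>lborel) = (\<integral>\<^sup>+\<sigma>. ennreal (w2 \<sigma> z) * F (\<sigma> *\<^sub>R z) \<partial>lborel)"
      using AE_lborel_singleton[of "0::'a"]
    proof eventually_elim
      case (elim z)
      then have z: "norm z > 0" by simp
      have sc: "(norm z * \<sigma>) *\<^sub>R (z /\<^sub>R norm z) = \<sigma> *\<^sub>R z" for \<sigma>
      proof -
        have "norm z * \<sigma> * inverse (norm z) = \<sigma>" using z by (simp add: field_simps)
        then show ?thesis by simp
      qed
      have *: "norm z * (norm z * \<sigma>) ^ (N - 1) = \<sigma> ^ (N - 1) * norm z ^ N" for \<sigma>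
        using N by (cases N) (auto simp: power_mult_distrib)
      have "(\<integral>\<^sup>+r. ennreal (indicator {0<..} r * indicator (ball 0 1) z * (real N * r ^ (N - 1)))
          * F (r *\<^sub>R (z /\<^sub>R norm z)) \<partial>lborel)
        = ennreal \<bar>norm z\<bar> * (\<integral>\<^sup>+\<sigma>. ennreal (indicator {0<..} (0 + norm z * \<sigma>) * indicator (ball 0 1) z
            * (real N * (0 + norm z * \<sigma>) ^ (N - 1))) * F ((0 + norm z * \<sigma>) *\<^sub>R (z /\<^sub>R norm z)) \<partial>lborel)"
        by (rule nn_integral_real_affine) (use z in auto)
      also have "\<dots> = (\<integral>\<^sup>+\<sigma>. ennreal \<bar>norm z\<bar> * (ennreal (indicator {0<..} (0 + norm z * \<sigma>) * indicator (ball 0 1) z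
            * (real N * (0 + norm z * \<sigma>) ^ (N - 1))) * F ((0 + norm z * \<sigma>) *\<^sub>R (z /\<^sub>R norm z))) \<partial>lborel)"
        by (rule nn_integral_cmult[symmetric]) measurable
      also have "\<dots> = (\<integral>\<^sup>+\<sigma>. ennreal (w2 \<sigma> z) * F (\<sigma> *\<^sub>R z) \<partial>lborel)"
      proof (rule nn_integral_cong)
        fix \<sigma> :: real
        have "ennreal \<bar>norm z\<bar> * ennreal (indicator {0<..} (norm z * \<sigma>) * indicator (ball 0 1) z * (real N * (norm z * \<sigma>) ^ (N - 1)))
            = ennreal (norm z * (indicator {0<..} (norm z * \<sigma>) * indicator (ball 0 1) z * (real N * (norm z * \<sigma>) ^ (N - 1))))"
          by (simp add: ennreal_mult')
        also have "norm z * (indicator {0<..} (norm z * \<sigma>) * indicator (ball 0 1) z * (real N * (norm z * \<sigma>) ^ (N - 1))) = w2 \<sigma> z"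
          using z *[of \<sigma>] by (auto simp: w2_def indicator_def zero_less_mult_iff)
        finally show "ennreal \<bar>norm z\<bar> * (ennreal (indicator {0<..} (0 + norm z * \<sigma>) * indicator (ball 0 1) z
            * (real N * (0 + norm z * \<sigma>) ^ (N - 1))) * F ((0 + norm z * \<sigma>) *\<^sub>R (z /\<^sub>R norm z))) = ennreal (w2 \<sigma> z) * F (\<sigma> *\<^sub>R z)"
          unfolding add_0 sc[of \<sigma>] mult.assoc[symmetric] abs_norm_cancel by simp
      qed
      finally show ?case .
    qed
  qed
  also have "\<dots> = (\<integral>\<^sup>+\<sigma>. \<integral>\<^sup>+z. ennreal (w2 \<sigma> z) * F (\<sigma> *\<^sub>R z) \<partial>lborel \<partial>lborel)"
    unfolding w2_def by (rule lborel_pair.Fubini') measurable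
  also have "\<dots> = (\<integral>\<^sup>+\<sigma>. \<integral>\<^sup>+z. ennreal (w3 \<sigma> z) * F z \<partial>lborel \<partial>lborel)"
  proof (rule nn_integral_cong)
    fix \<sigma> :: real
    show "(\<integral>\<^sup>+z. ennreal (w2 \<sigma> z) * F (\<sigma> *\<^sub>R z) \<partial>lborel) = (\<integral>\<^sup>+z. ennreal (w3 \<sigma> z) * F z \<partial>lborel)"
    proof (cases "\<sigma> > 0")
      case True
      have "(\<integral>\<^sup>+z. ennreal (w3 \<sigma> z) * F z \<partial>lborel)
        = ennreal (\<sigma> ^ N) * (\<integral>\<^sup>+z. ennreal (w3 \<sigma> (\<sigma> *\<^sub>R z)) * F (\<sigma> *\<^sub>R z) \<partial>lborel)"
        unfolding N_def by (rule nn_integral_scaleR[OF _ True]) (unfold w3_def, measurable)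
      also have "\<dots> = (\<integral>\<^sup>+z. ennreal (\<sigma> ^ N) * (ennreal (w3 \<sigma> (\<sigma> *\<^sub>R z)) * F (\<sigma> *\<^sub>R z)) \<partial>lborel)"
        by (rule nn_integral_cmult[symmetric]) (unfold w3_def, measurable)
      also have "\<dots> = (\<integral>\<^sup>+z. ennreal (w2 \<sigma> z) * F (\<sigma> *\<^sub>R z) \<partial>lborel)"
      proof (rule nn_integral_cong)
        fix z :: 'a
        have "norm (\<sigma> *\<^sub>R z) < \<sigma> \<longleftrightarrow> norm z < 1" using True by simp
        moreover have "\<sigma> ^ N * (real N * norm (\<sigma> *\<^sub>R z) ^ N / \<sigma> ^ (N + 1)) = real N * \<sigma> ^ (N - 1) * norm z ^ N"
          using True N by (cases N) (auto simp: power_mult_distrib field_simps)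
        ultimately have "\<sigma> ^ N * w3 \<sigma> (\<sigma> *\<^sub>R z) = w2 \<sigma> z"
          using True unfolding w2_def w3_def by (simp only: if_distrib[of "(*) _"] mult_zero_right)
            (simp add: indicator_def)
        then have "ennreal (\<sigma> ^ N) * ennreal (w3 \<sigma> (\<sigma> *\<^sub>R z)) = ennreal (w2 \<sigma> z)"
          using True w3n by (simp add: ennreal_mult[symmetric])
        then show "ennreal (\<sigma> ^ N) * (ennreal (w3 \<sigma> (\<sigma> *\<^sub>R z)) * F (\<sigma> *\<^sub>R z)) = ennreal (w2 \<sigma> z) * F (\<sigma> *\<^sub>R z)"
          by (simp add: mult.assoc[symmetric])
      qed
      finally show ?thesis by simp
    next
      case False
      then have "w2 \<sigma> z = 0" "w3 \<sigma> z = 0" for z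
        using norm_ge_zero[of z] by (auto simp: w2_def w3_def indicator_def simp del: norm_ge_zero)
      then show ?thesis by simp
    qed
  qed
  also have "\<dots> = (\<integral>\<^sup>+z. \<integral>\<^sup>+\<sigma>. ennreal (w3 \<sigma> z) * F z \<partial>lborel \<partial>lborel)"
    unfolding w3_def by (rule lborel_pair.Fubini'[symmetric]) measurable
  also have "\<dots> = (\<integral>\<^sup>+z. F z \<partial>lborel)"
  proof (rule nn_integral_cong_AE)
    show "AE z in lborel. (\<integral>\<^sup>+\<sigma>. ennreal (w3 \<sigma> z) * F z \<partial>lborel) = F z"
      using AE_lborel_singleton[of "0::'a"]
    proof eventually_elim
      case (elim z)
      then have z: "norm z > 0" by simp
      \<comment> \<open>The remaining density N |z|^N / \<sigma>^(N+1) has the primitive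
        -(|z|/\<sigma>)^N, which runs from -1 at \<sigma> = |z| to 0 at infinity.\<close>
      have lim: "((\<lambda>\<sigma>. - (norm z ^ N / \<sigma> ^ N)) \<longlongrightarrow> - 0) at_top"
        by (intro tendsto_minus real_tendsto_divide_at_top[OF tendsto_const] filterlim_pow_at_top filterlim_ident N)
      have D: "((\<lambda>\<sigma>. - (norm z ^ N / \<sigma> ^ N)) has_real_derivative real N * norm z ^ N / \<sigma> ^ (N + 1)) (at \<sigma>)" if "norm z \<le> \<sigma>" for \<sigma>
      proof -
        have s0: "\<sigma> > 0" using that z by linarith
        have "((\<lambda>\<sigma>. - (norm z ^ N / \<sigma> ^ N)) has_real_derivative
           - ((0 * \<sigma> ^ N - norm z ^ N * (real N * \<sigma> ^ (N - 1))) / (\<sigma> ^ N * \<sigma> ^ N))) (at \<sigma>)"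
          by (intro DERIV_minus DERIV_divide DERIV_const) (use s0 DERIV_pow[of N \<sigma> UNIV] in auto)
        moreover have "- ((0 * \<sigma> ^ N - norm z ^ N * (real N * \<sigma> ^ (N - 1))) / (\<sigma> ^ N * \<sigma> ^ N)) = real N * norm z ^ N / \<sigma> ^ (N + 1)"
          using s0 N by (cases N) (auto simp: field_simps)
        ultimately show ?thesis by simp
      qed
      have "(\<integral>\<^sup>+\<sigma>. ennreal (real N * norm z ^ N / \<sigma> ^ (N + 1)) * indicator {norm z..} \<sigma> \<partial>lborel) = ennreal (- 0 - - (norm z ^ N / norm z ^ N))"
        by (rule nn_integral_FTC_atLeast[OF _ D _ lim]) (use order_trans[OF norm_ge_zero[of z]] in auto)
      also have "- 0 - - (norm z ^ N / norm z ^ N) = 1" using z by simp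
      finally have I: "(\<integral>\<^sup>+\<sigma>. ennreal (real N * norm z ^ N / \<sigma> ^ (N + 1)) * indicator {norm z..} \<sigma> \<partial>lborel) = 1" by simp
      have "(\<integral>\<^sup>+\<sigma>. ennreal (w3 \<sigma> z) \<partial>lborel) = (\<integral>\<^sup>+\<sigma>. ennreal (real N * norm z ^ N / \<sigma> ^ (N + 1)) * indicator {norm z..} \<sigma> \<partial>lborel)"
      proof (rule nn_integral_cong_AE)
        show "AE \<sigma> in lborel. ennreal (w3 \<sigma> z) = ennreal (real N * norm z ^ N / \<sigma> ^ (N + 1)) * indicator {norm z..} \<sigma>"
          using AE_lborel_singleton[of "norm z"] by eventually_elim (auto simp: w3_def indicator_def)
      qed
      then have "(\<integral>\<^sup>+\<sigma>. ennreal (w3 \<sigma> z) \<partial>lborel) = 1" by (rule trans[OF _ I])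
      moreover have "(\<integral>\<^sup>+\<sigma>. ennreal (w3 \<sigma> z) * F z \<partial>lborel) = (\<integral>\<^sup>+\<sigma>. ennreal (w3 \<sigma> z) \<partial>lborel) * F z"
        by (rule nn_integral_multc) (unfold w3_def, measurable)
      ultimately show ?case by simp
    qed
  qed
  finally show ?thesis .
qed

text \<open>Applied to indicators, the nonnegative identity says that Lebesgue measure is the image
  under (r, z) -> r z / |z| of a measure with density on the product space. Integrability and value
  for signed functions follow by transport and Fubini, without splitting into positive and negative
  parts.\<close>

lemma integral_polar:
  fixes F :: "'a::euclidean_space \<Rightarrow> real"
  assumes F: "integrable lborel F"
  shows "integrable lborel (\<lambda>r. indicator {0<..} r * sphere_integral F 0 r)"
    "(LINT z|lborel. F z) = (LINT r|lborel. indicator {0<..} r * sphere_integral F 0 r)"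
proof -
  define N where "N = DIM('a)"
  define w where "w = (\<lambda>(r, z). indicator {0<..} r * indicator (ball 0 1) (z::'a) * (real N * r ^ (N - 1)))"
  define T where "T = (\<lambda>(r, z). r *\<^sub>R ((z::'a) /\<^sub>R norm z))"
  have [measurable]: "(\<lambda>z. indicator (ball 0 1) z :: real) \<in> borel_measurable (borel :: 'a measure)"
    by (intro borel_measurable_indicator) simp
  have [measurable]: "F \<in> borel_measurable borel" using F by auto
  have w[measurable]: "w \<in> borel_measurable (lborel \<Otimes>\<^sub>M lborel)" unfolding w_def by measurable
  have T[measurable]: "T \<in> measurable (lborel \<Otimes>\<^sub>M lborel) borel" unfolding T_def by measurable
  have w0: "w x \<ge> 0" for x
    by (cases x, cases "fst x > 0") (auto simp: w_def)
  define P where "P = density (lborel \<Otimes>\<^sub>M lborel) (\<lambda>x. ennreal (w x))"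
  have PT: "distr P borel T = lborel"
  proof (rule measure_eqI)
    fix A assume "A \<in> sets (distr P borel T)"
    then have A[measurable]: "A \<in> sets borel" by simp
    have [measurable]: "T \<in> measurable P borel" unfolding P_def by measurable
    have "emeasure (distr P borel T) A = (\<integral>\<^sup>+y. indicator A y \<partial>distr P borel T)" by simp
    also have "\<dots> = (\<integral>\<^sup>+x. indicator A (T x) \<partial>P)" by (rule nn_integral_distr) measurable
    also have "\<dots> = (\<integral>\<^sup>+x. ennreal (w x) * indicator A (T x) \<partial>(lborel \<Otimes>\<^sub>M lborel))"
      unfolding P_def by (rule nn_integral_density) measurable
    also have "\<dots> = (\<integral>\<^sup>+r. \<integral>\<^sup>+z. ennreal (w (r, z)) * indicator A (T (r, z)) \<partial>lborel \<partial>lborel)"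
      by (rule lborel.nn_integral_fst[symmetric]) measurable
    also have "\<dots> = (\<integral>\<^sup>+z. indicator A z \<partial>lborel)"
      using nn_integral_polar[of "indicator A"] by (simp add: w_def T_def N_def)
    finally show "emeasure (distr P borel T) A = emeasure lborel A" by simp
  qed simp
  have TP: "T \<in> measurable P borel" unfolding P_def by measurable
  have "integrable P (\<lambda>x. F (T x))"
    using F integrable_distr_eq[OF TP, of F] by (simp add: PT)
  then have i: "integrable (lborel \<Otimes>\<^sub>M lborel) (\<lambda>x. w x *\<^sub>R F (T x))"
    unfolding P_def by (subst (asm) integrable_density) (use w0 in auto)
  have sph: "(LINT z|lborel. w (r, z) *\<^sub>R F (T (r, z))) = indicator {0<..} r * sphere_integral F 0 r" for r
  proof -
    have "(LINT z|lborel. w (r, z) *\<^sub>R F (T (r, z)))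
      = (LINT z|lborel. (indicator {0<..} r * (real N * r ^ (N - 1))) * (indicator (ball 0 1) z *\<^sub>R F (0 + r *\<^sub>R (z /\<^sub>R norm z))))"
      by (rule Bochner_Integration.integral_cong) (auto simp: w_def T_def)
    also have "\<dots> = (indicator {0<..} r * (real N * r ^ (N - 1))) * (LINT z:ball 0 1|lborel. F (0 + r *\<^sub>R (z /\<^sub>R norm z)))"
      unfolding set_lebesgue_integral_def by (rule integral_mult_right_zero)
    finally show ?thesis by (simp add: sphere_integral_def N_def)
  qed
  show "integrable lborel (\<lambda>r. indicator {0<..} r * sphere_integral F 0 r)"
    using lborel_pair.integrable_fst'[OF i] by (simp only: sph)
  have "(LINT z|lborel. F z) = (LINT x|P. F (T x))"
    using integral_distr[OF TP, of F] by (simp add: PT)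
  also have "\<dots> = integral\<^sup>L (lborel \<Otimes>\<^sub>M lborel) (\<lambda>x. w x *\<^sub>R F (T x))"
    unfolding P_def by (rule integral_density) (use w0 in auto)
  also have "\<dots> = (LINT r|lborel. LINT z|lborel. w (r, z) *\<^sub>R F (T (r, z)))"
    by (rule lborel_pair.integral_fst'[OF i, symmetric])
  finally show "(LINT z|lborel. F z) = (LINT r|lborel. indicator {0<..} r * sphere_integral F 0 r)"
    by (simp only: sph)
qed

text \<open>Majorant on the cone for functions bounded by 1 + y^a near the sphere: the bound becomes
  1 + (2 + 2 y^a), hence the coefficients 3 and 2. The exponent 0 stands for the constant 1, so that
  both summands are instances of the same integrable weight.\<close>

definition cone_weight :: "real \<Rightarrow> (real^'n) \<times> real \<Rightarrow> real" where
  "cone_weight a z = indicator (ball 0 1) z * (indicator (upper \<inter> cball 0 1) z * (3 * snd z powr 0 + 2 * snd z powr a))"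

lemma cone_weight_integrable:
  assumes a: "a > -1"
  shows "integrable lborel (cone_weight a :: (real^'n) \<times> real \<Rightarrow> real)"
proof -
  let ?U = "\<lambda>z :: (real^'n) \<times> real. indicator (upper \<inter> cball 0 1) z :: real"
  have "integrable lborel (\<lambda>z :: (real^'n) \<times> real. 3 * (?U z * snd z powr 0) + 2 * (?U z * snd z powr a))"
    by (intro Bochner_Integration.integrable_add integrable_mult_right weight_integrable) (use a in auto)
  then have "integrable lborel (\<lambda>z :: (real^'n) \<times> real. ?U z * (3 * snd z powr 0 + 2 * snd z powr a))"
    by (simp add: distrib_left mult_ac)
  from integrable_mult_indicator[OF _ this, of "ball 0 1"] show ?thesis
    by (simp add: cone_weight_def[abs_def])
qed

text \<open>Projection to radius r replaces the height y by r y / |z|, and y \<le> y / |z| \<le> 1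
  in the unit half-ball. So the power of y / |z| is at most 1 for a \<ge> 0 and at most y^a for a <
  0; the factor r^a is at most 2 for r in [1/2, 2].\<close>

lemma snd_cone_powr_le:
  fixes z :: "(real^'n) \<times> real"
  assumes a: "-1 < a" "a < 1" and z: "z \<in> upper" "norm z < 1" and r: "1 / 2 \<le> r" "r \<le> 2"
  shows "snd (r *\<^sub>R (z /\<^sub>R norm z)) powr a \<le> 2 + 2 * snd z powr a"
proof -
  have y: "snd z > 0" using z by (simp add: upper_def)
  then have n: "norm z > 0" by auto
  have yn: "snd z \<le> norm z" using norm_snd_le[of "snd z" "fst z"] y by simp
  have e: "snd (r *\<^sub>R (z /\<^sub>R norm z)) = r * (snd z / norm z)" by (simp add: divide_inverse mult.commute)
  have "(snd z / norm z) powr a \<le> 1 + snd z powr a"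
  proof (cases "a \<ge> 0")
    case True
    have "(snd z / norm z) powr a \<le> 1 powr a"
      by (rule powr_mono2) (use True y n yn in \<open>auto simp: divide_le_eq_1\<close>)
    then show ?thesis by (simp add: add_increasing2)
  next
    case False
    have "snd z \<le> snd z / norm z" using y n z(2) by (simp add: pos_le_divide_eq)
    then have "(snd z / norm z) powr a \<le> snd z powr a" using False y by (intro powr_mono2') auto
    then show ?thesis by simp
  qed
  moreover have "r powr a \<le> 2"
  proof (cases "a \<ge> 0")
    case True
    have "r powr a \<le> 2 powr a" by (rule powr_mono2) (use True r in auto)
    also have "\<dots> \<le> 2 powr 1" by (rule powr_mono) (use a in auto)
    finally show ?thesis by simp
  next
    case False
    have "r powr a \<le> (1 / 2) powr a" by (rule powr_mono2') (use False r in auto)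
    also have "\<dots> \<le> (1 / 2) powr (- 1)" by (rule powr_mono') (use a in auto)
    finally show ?thesis by (simp add: powr_minus)
  qed
  ultimately have "r powr a * (snd z / norm z) powr a \<le> 2 * (1 + snd z powr a)"
    by (intro mult_mono) auto
  moreover have "(r * (snd z / norm z)) powr a = r powr a * (snd z / norm z) powr a"
    by (rule powr_mult)
  ultimately show ?thesis by (simp only: e) (simp add: algebra_simps)
qed

lemma cone_point:
  fixes z :: "(real^'n) \<times> real"
  assumes "r > 0" "z \<noteq> 0"
  shows "norm (r *\<^sub>R (z /\<^sub>R norm z)) = r" "r *\<^sub>R (z /\<^sub>R norm z) \<in> upper \<longleftrightarrow> z \<in> upper"
proof -
  have q: "r * inverse (norm z) > 0" using assms by simp
  have "snd (r *\<^sub>R (z /\<^sub>R norm z)) = (r * inverse (norm z)) * snd z" by simp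
  then show "r *\<^sub>R (z /\<^sub>R norm z) \<in> upper \<longleftrightarrow> z \<in> upper"
    using q by (simp only: upper_def mem_Collect_eq) (metis mult_pos_pos zero_less_mult_pos)
qed (use assms in auto)

abbreviation cone_integrand :: "((real^'n) \<times> real \<Rightarrow> real) \<Rightarrow> real \<Rightarrow> (real^'n) \<times> real \<Rightarrow> real" where
  "cone_integrand F r z \<equiv> indicator (ball 0 1) z *
     (indicator upper (r *\<^sub>R (z /\<^sub>R norm z)) * F (r *\<^sub>R (z /\<^sub>R norm z)))"

lemma cone_integrand_bound:
  fixes F :: "(real^'n) \<times> real \<Rightarrow> real"
  assumes a: "-1 < a" "a < 1" and K: "K \<ge> 0"
    and F: "\<And>z. z \<in> upper \<Longrightarrow> norm z \<le> 2 \<Longrightarrow> \<bar>F z\<bar> \<le> K * (1 + snd z powr a)"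
    and r: "1 / 2 \<le> r" "r \<le> 2"
  shows "\<bar>cone_integrand F r z\<bar> \<le> K * cone_weight a z"
proof (cases "z \<in> upper \<inter> ball 0 1")
  case True
  then have z: "z \<in> upper" "norm z < 1" "z \<noteq> 0" by (auto simp: upper_def)
  let ?p = "r *\<^sub>R (z /\<^sub>R norm z)"
  have p: "norm ?p = r" "?p \<in> upper" using cone_point[of r z] z r by auto
  have "\<bar>F ?p\<bar> \<le> K * (1 + snd ?p powr a)" by (rule F[OF p(2)]) (use p(1) r in linarith)
  also have "\<dots> \<le> K * (1 + (2 + 2 * snd z powr a))"
    by (intro mult_left_mono add_left_mono snd_cone_powr_le a z r K)
  finally show ?thesis using True p z by (simp add: cone_weight_def upper_def)
next
  case False
  have "z \<notin> upper \<Longrightarrow> r *\<^sub>R (z /\<^sub>R norm z) \<notin> upper"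
    using cone_point(2)[of r z] r by (cases "z = 0") (auto simp: upper_def)
  then show ?thesis using False by (auto simp: cone_weight_def)
qed

lemma cone_integrand_measurable:
  fixes F :: "(real^'n) \<times> real \<Rightarrow> real"
  assumes "continuous_on upper F"
  shows "(\<lambda>z. cone_integrand F r z) \<in> borel_measurable borel"
proof (rule borel_measurable_times[OF borel_measurable_indicator])
  have [measurable]: "(\<lambda>z. indicator upper z * F z) \<in> borel_measurable borel" by (rule measurable_on_upper[OF assms])
  have "(\<lambda>z. (\<lambda>w. indicator upper w * F w) (r *\<^sub>R (z /\<^sub>R norm z))) \<in> borel_measurable (borel :: ((real^'n) \<times> real) measure)"
    by measurable
  then show "(\<lambda>z. indicator upper (r *\<^sub>R (z /\<^sub>R norm z)) * F (r *\<^sub>R (z /\<^sub>R norm z))) \<in> borel_measurable borel" by simp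
qed simp

text \<open>Dominated convergence with one majorant for all radii in [1/2, 2]. It identifies the
  value at r = 1 as the limit of averages over thin shells.\<close>

lemma sphere_integral_continuous:
  fixes F :: "(real^'n) \<times> real \<Rightarrow> real"
  assumes a: "-1 < a" "a < 1" and K: "K \<ge> 0" and Fc: "continuous_on upper F"
    and F: "\<And>z. z \<in> upper \<Longrightarrow> norm z \<le> 2 \<Longrightarrow> \<bar>F z\<bar> \<le> K * (1 + snd z powr a)"
  shows "continuous_on {1/2..2} (\<lambda>r. sphere_integral (\<lambda>z. indicator upper z * F z) 0 r)"
proof -
  let ?q = "\<lambda>r z. cone_integrand F r z"
  have "continuous_on {1/2..2} (\<lambda>r. LINT z|lborel. ?q r z)"
  proof (rule continuous_on_sequentiallyI)
    fix u :: "nat \<Rightarrow> real" and r :: real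
    assume u: "\<forall>n. u n \<in> {1/2..2}" and r: "r \<in> {1/2..2}" and lim: "u \<longlonglongrightarrow> r"
    show "(\<lambda>n. LINT z|lborel. ?q (u n) z) \<longlonglongrightarrow> (LINT z|lborel. ?q r z)"
    proof (rule integral_dominated_convergence)
      show "?q r \<in> borel_measurable lborel" "?q (u n) \<in> borel_measurable lborel" for n
        using cone_integrand_measurable[OF Fc] by simp_all
      show "integrable lborel (\<lambda>z. K * cone_weight a z :: real)"
        by (intro integrable_mult_right cone_weight_integrable a)
      show "AE z in lborel. norm (?q (u n) z) \<le> K * cone_weight a z" for n
        using cone_integrand_bound[OF a K F, of "u n"] u by (intro AE_I2) auto
      show "AE z in lborel. (\<lambda>n. ?q (u n) z) \<longlonglongrightarrow> ?q r z"
      proof (rule AE_I2)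
        fix z :: "(real^'n) \<times> real"
        show "(\<lambda>n. ?q (u n) z) \<longlonglongrightarrow> ?q r z"
        proof (cases "z \<in> upper")
          case True
          then have z: "z \<noteq> 0" by (auto simp: upper_def)
          have pos: "u n > 0" "r > 0" for n using u r by (auto intro: less_le_trans[of _ "1/2"])
          have up: "u n *\<^sub>R (z /\<^sub>R norm z) \<in> upper" "r *\<^sub>R (z /\<^sub>R norm z) \<in> upper" for n
            using cone_point(2)[OF _ z] pos True by blast+
          have "isCont F (r *\<^sub>R (z /\<^sub>R norm z))"
            using Fc up(2) continuous_on_eq_continuous_at[OF open_upper] by blast
          then have "(\<lambda>n. F (u n *\<^sub>R (z /\<^sub>R norm z))) \<longlonglongrightarrow> F (r *\<^sub>R (z /\<^sub>R norm z))"
            by (rule isCont_tendsto_compose) (intro tendsto_intros lim)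
          then show ?thesis using up by (auto intro!: tendsto_intros)
        next
          case False
          have "\<not> \<rho> *\<^sub>R (z /\<^sub>R norm z) \<in> upper" if "\<rho> \<in> {1/2..2}" for \<rho>
            using cone_point(2)[of \<rho> z] that False by (cases "z = 0") (auto simp: upper_def)
          then have q0: "?q (u n) z = 0" "?q r z = 0" for n using u r by simp_all
          show ?thesis unfolding q0 by (rule tendsto_const)
        qed
      qed
    qed
  qed
  then show ?thesis
    unfolding sphere_integral_def set_lebesgue_integral_def by (intro continuous_intros) simp_all
qed

text \<open>On the sphere z . z equals r^2. This can fail only at the apex z = 0 of the cone, a null
  set, where z / |z| is 0 by the convention for division.\<close>

lemma sphere_integral_radial_factor:
  fixes F :: "'a::euclidean_space \<Rightarrow> real"
  assumes r: "r > 0"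
  shows "sphere_integral (\<lambda>z. g (z \<bullet> z) * F z) 0 r = g (r\<^sup>2) * sphere_integral F 0 r"
proof -
  have "(LINT z|lborel. indicator (ball 0 1) z *\<^sub>R (g ((0 + r *\<^sub>R (z /\<^sub>R norm z)) \<bullet> (0 + r *\<^sub>R (z /\<^sub>R norm z))) * F (0 + r *\<^sub>R (z /\<^sub>R norm z))))
    = (LINT z|lborel. g (r\<^sup>2) * (indicator (ball 0 1) z *\<^sub>R F (0 + r *\<^sub>R (z /\<^sub>R norm z))))"
  proof (rule integral_discrete_difference[of "{0}"])
    fix z :: 'a assume "z \<notin> {0}"
    then have "(0 + r *\<^sub>R (z /\<^sub>R norm z)) \<bullet> (0 + r *\<^sub>R (z /\<^sub>R norm z)) = r\<^sup>2"
      using r by (simp add: dot_square_norm)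
    then show "indicator (ball 0 1) z *\<^sub>R (g ((0 + r *\<^sub>R (z /\<^sub>R norm z)) \<bullet> (0 + r *\<^sub>R (z /\<^sub>R norm z))) * F (0 + r *\<^sub>R (z /\<^sub>R norm z)))
      = g (r\<^sup>2) * (indicator (ball 0 1) z *\<^sub>R F (0 + r *\<^sub>R (z /\<^sub>R norm z)))" by (simp only:) simp
  qed auto
  then show ?thesis
    unfolding sphere_integral_def set_lebesgue_integral_def by simp
qed

text \<open>The radial cutoff tends to the indicator of the unit ball. In polar coordinates its
  derivative is a probability density on (1 - 1/l, 1), so the shell term converges to the surface
  integral at r = 1, where z is the outer unit normal. The flat term is negative because
  \<open>gk\<close> is the weighted derivative along the inner normal.\<close>

lemma green_half_ball:
  fixes h gh k gk :: "(real^'n) \<times> real \<Rightarrow> real"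
  assumes a: "-1 < a" "a < 1"
    and h: "regular_solution a h gh" and k: "regular_solution a k gk"
  shows "set_integrable lborel (upper \<inter> ball 0 1) (\<lambda>z. snd z powr a * (grad h z \<bullet> grad k z))" (is ?int)
    "(LINT z:upper \<inter> ball 0 1|lborel. snd z powr a * (grad h z \<bullet> grad k z)) =
      sphere_integral (\<lambda>z. indicator upper z * (h z * (snd z powr a * (grad k z \<bullet> z)))) 0 1
      - (LINT x:ball 0 1|lborel. h (x, 0) * gk (x, 0))" (is ?eq)
proof -
  define Q where "Q = (\<lambda>z. indicator (upper \<inter> ball 0 1) z * (snd z powr a * (grad h z \<bullet> grad k z)))"
  define F where "F = (\<lambda>z. h z * (snd z powr a * (grad k z \<bullet> z)))"
  define c where "c = (\<lambda>x. indicator (ball 0 1) x * (h (x, 0) * gk (x, 0)))"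
  have hs: "solves a h" "continuous_on upper_cl h" using h by (auto simp: regular_solution_def)
  have ks: "solves a k" "continuous_on upper_cl gk" using k by (auto simp: regular_solution_def)
  have hC: "C2_on upper h" and kC: "C2_on upper k" using hs ks by (auto simp: solves_def)
  have Fc: "continuous_on upper F"
    unfolding F_def by (intro continuous_intros C2_on_continuous_grad kC C2_on_continuous(1)[OF hC]) (auto simp: upper_def)
  obtain K where K: "K > 0"
    "\<And>z. z \<in> upper \<Longrightarrow> norm z \<le> 2 \<Longrightarrow> \<bar>snd z powr a * (grad h z \<bullet> grad k z)\<bar> \<le> K * (1 + snd z powr a + snd z powr (- a))"
    "\<And>z. z \<in> upper \<Longrightarrow> norm z \<le> 2 \<Longrightarrow> \<bar>h z * (snd z powr a * (grad k z \<bullet> z))\<bar> \<le> K * (1 + snd z powr a)"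
    by (rule grad_products_bound[OF h k, of 2]) blast
  have Qm: "Q \<in> borel_measurable borel"
  proof -
    have "(\<lambda>z. indicator upper z * (snd z powr a * (grad h z \<bullet> grad k z))) \<in> borel_measurable borel"
      by (intro measurable_on_upper continuous_intros C2_on_continuous_grad hC kC) (auto simp: upper_def)
    then have "(\<lambda>z. indicator (ball 0 1) z * (indicator upper z * (snd z powr a * (grad h z \<bullet> grad k z)))) \<in> borel_measurable borel"
      by (rule borel_measurable_times[OF borel_measurable_indicator, rotated]) simp
    then show ?thesis by (simp add: Q_def indicator_inter_arith mult_ac)
  qed
  have Qi: "integrable lborel Q"
  proof -
    define W where "W = (\<lambda>z :: (real^'n) \<times> real. indicator (upper \<inter> cball 0 2) z * snd z powr 0
       + indicator (upper \<inter> cball 0 2) z * snd z powr a + indicator (upper \<inter> cball 0 2) z * snd z powr (- a))"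
    have W: "integrable lborel (\<lambda>z. K * W z)"
      unfolding W_def by (intro integrable_mult_right Bochner_Integration.integrable_add weight_integrable) (use a in auto)
    have "\<bar>Q z\<bar> \<le> \<bar>K * W z\<bar>" for z
    proof (cases "z \<in> upper \<inter> ball 0 1")
      case True
      then have "\<bar>Q z\<bar> \<le> K * W z" using K(2)[of z] by (simp add: Q_def W_def upper_def)
      then show ?thesis by linarith
    qed (simp add: Q_def)
    then show ?thesis
      by (intro Bochner_Integration.integrable_bound[OF W]) (use Qm in auto)
  qed
  then show ?int by (simp add: set_integrable_def Q_def)
  have cc: "continuous_on UNIV (\<lambda>x. h (x, 0) * gk (x, 0))"
    by (intro continuous_intros continuous_on_compose2[OF hs(2)] continuous_on_compose2[OF ks(2)]) (auto simp: upper_cl_def)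
  have ci: "integrable lborel c"
  proof -
    have "integrable lborel (\<lambda>x. indicator (cball 0 1) x *\<^sub>R (h (x, 0) * gk (x, 0)))"
      by (rule borel_integrable_compact[OF compact_cball continuous_on_subset[OF cc subset_UNIV]])
    from integrable_mult_indicator[OF _ this, of "ball 0 1"]
    have "integrable lborel (\<lambda>x. indicator (ball 0 1) x * (indicator (cball 0 1) x * (h (x, 0) * gk (x, 0))))" by simp
    moreover have "(\<lambda>x. indicator (ball 0 1) x * (indicator (cball 0 1) x * (h (x, 0) * gk (x, 0)))) = c"
      by (auto simp: c_def indicator_def fun_eq_iff)
    ultimately show ?thesis by simp
  qed
  obtain S S' :: "real \<Rightarrow> real" where S: "\<And>t. (S has_real_derivative S' t) (at t)"
    "continuous_on UNIV S'" "\<And>t. t \<le> 0 \<Longrightarrow> S t = 0" "\<And>t. t \<ge> 1 \<Longrightarrow> S t = 1"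
    "\<And>t. S' t \<ge> 0" "\<And>t. t \<le> 0 \<or> t \<ge> 1 \<Longrightarrow> S' t = 0" "\<And>t. 0 \<le> S t \<and> S t \<le> 1"
    by (rule smooth_step_exists) blast
  have cS: "continuous_on UNIV S" using S(1) by (meson DERIV_isCont continuous_at_imp_continuous_on)
  define l where "l = (\<lambda>n. real (Suc n))"
  have l: "l n \<ge> 1" for n by (simp add: l_def)
  define \<eta> where "\<eta> = (\<lambda>n u. S (l n * (1 - u)))"
  define \<eta>' where "\<eta>' = (\<lambda>n u. - l n * S' (l n * (1 - u)))"
  have d\<eta>: "(\<eta> n has_real_derivative \<eta>' n u) (at u)" for n u
    unfolding \<eta>_def \<eta>'_def
    by (rule DERIV_cong[OF DERIV_chain2[OF S(1)]]) (auto intro!: derivative_eq_intros)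
  have c\<eta>': "continuous_on UNIV (\<eta>' n)" for n
    unfolding \<eta>'_def by (intro continuous_intros continuous_on_compose2[OF S(2)]) auto
  have \<eta>0: "\<eta> n u = 0 \<and> \<eta>' n u = 0" if "u \<ge> 1" for n u
  proof -
    have "l n * (1 - u) \<le> 0" using that l[of n] by (simp add: mult_nonneg_nonpos)
    then show ?thesis by (simp add: \<eta>_def \<eta>'_def S(3,6))
  qed
  have \<eta>lim: "(\<lambda>n. \<eta> n u) \<longlonglongrightarrow> 1" if "u < 1" for u
  proof -
    obtain N where N: "real N \<ge> 1 / (1 - u)" using real_arch_simple by blast
    have "\<eta> n u = 1" if "n \<ge> N" for n
    proof -
      have "l n \<ge> 1 / (1 - u)" using N that by (simp add: l_def)
      then have "l n * (1 - u) \<ge> 1" using \<open>u < 1\<close> by (simp add: field_simps)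
      then show ?thesis by (simp add: \<eta>_def S(4))
    qed
    then have "eventually (\<lambda>n. \<eta> n u = 1) sequentially" unfolding eventually_sequentially by auto
    then show ?thesis by (rule tendsto_eventually)
  qed
  have \<eta>1: "\<bar>\<eta> n u\<bar> \<le> 1" for n u using S(7)[of "l n * (1 - u)"] by (simp add: \<eta>_def)
  have \<eta>m: "\<eta> n \<in> borel_measurable borel" for n
    unfolding \<eta>_def by (intro borel_measurable_continuous_onI continuous_on_compose2[OF cS] continuous_intros) auto
  have nlt: "z \<bullet> z < 1 \<longleftrightarrow> norm z < 1" for z :: "'b::real_inner"
    by (simp add: dot_square_norm power_less_one_iff abs_square_less_1)
  have limgen: "(\<lambda>n. LINT z|lborel. \<eta> n (z \<bullet> z) * q z) \<longlonglongrightarrow> integral\<^sup>L lborel q"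
    if q: "integrable lborel q" and q0: "\<And>z. norm z \<ge> 1 \<Longrightarrow> q z = 0" for q :: "'b::euclidean_space \<Rightarrow> real"
  proof (rule integral_dominated_convergence[where w = "\<lambda>z. \<bar>q z\<bar>"])
    show "integrable lborel (\<lambda>z. \<bar>q z\<bar>)" using q by simp
    show "q \<in> borel_measurable lborel" using q by auto
    have "(\<lambda>z::'b. \<eta> n (z \<bullet> z)) \<in> borel_measurable borel" for n
      by (rule measurable_compose[OF _ \<eta>m]) measurable
    then show "(\<lambda>z. \<eta> n (z \<bullet> z) * q z) \<in> borel_measurable lborel" for n using q by auto
    show "AE z in lborel. norm (\<eta> n (z \<bullet> z) * q z) \<le> \<bar>q z\<bar>" for n
    proof (rule AE_I2)
      fix z :: 'b show "norm (\<eta> n (z \<bullet> z) * q z) \<le> \<bar>q z\<bar>"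
        using mult_right_mono[OF \<eta>1[of n "z \<bullet> z"], of "\<bar>q z\<bar>"] by (simp add: abs_mult)
    qed
    show "AE z in lborel. (\<lambda>n. \<eta> n (z \<bullet> z) * q z) \<longlonglongrightarrow> q z"
    proof (rule AE_I2)
      fix z :: 'b
      show "(\<lambda>n. \<eta> n (z \<bullet> z) * q z) \<longlonglongrightarrow> q z"
      proof (cases "norm z < 1")
        case True
        then have "(\<lambda>n. \<eta> n (z \<bullet> z) * q z) \<longlonglongrightarrow> 1 * q z" by (intro tendsto_intros \<eta>lim) (simp add: nlt)
        then show ?thesis by simp
      qed (simp add: q0)
    qed
  qed
  define A where "A = (\<lambda>n z. indicator upper z * (\<eta> n (z \<bullet> z) * (snd z powr a * (grad h z \<bullet> grad k z))))"
  define B where "B = (\<lambda>n z. indicator upper z * (2 * \<eta>' n (z \<bullet> z) * (h z * (snd z powr a * (grad k z \<bullet> z)))))"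
  have wf: "integrable lborel (B n)"
    "integral\<^sup>L lborel (A n) + integral\<^sup>L lborel (B n) + (LINT x|lborel. \<eta> n (x \<bullet> x) * (h (x, 0) * gk (x, 0))) = 0" for n
    using weak_form_up_to_boundary(2,3)[where \<rho> = 1 and \<eta> = "\<eta> n", OF a h k d\<eta> c\<eta>' \<eta>0] by (simp_all add: A_def B_def)
  have Aeq: "A n = (\<lambda>z. \<eta> n (z \<bullet> z) * Q z)" for n
  proof
    fix z show "A n z = \<eta> n (z \<bullet> z) * Q z"
      using \<eta>0[of "z \<bullet> z" n] nlt[of z] by (cases "norm z < 1") (auto simp: A_def Q_def indicator_def)
  qed
  have ceq: "(\<lambda>x. \<eta> n (x \<bullet> x) * (h (x, 0) * gk (x, 0))) = (\<lambda>x. \<eta> n (x \<bullet> x) * c x)" for n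
  proof
    fix x show "\<eta> n (x \<bullet> x) * (h (x, 0) * gk (x, 0)) = \<eta> n (x \<bullet> x) * c x"
      using \<eta>0[of "x \<bullet> x" n] nlt[of x] by (cases "norm x < 1") (auto simp: c_def indicator_def)
  qed
  have limA: "(\<lambda>n. integral\<^sup>L lborel (A n)) \<longlonglongrightarrow> integral\<^sup>L lborel Q"
    unfolding Aeq by (rule limgen[OF Qi]) (auto simp: Q_def)
  have limC: "(\<lambda>n. LINT x|lborel. \<eta> n (x \<bullet> x) * (h (x, 0) * gk (x, 0))) \<longlonglongrightarrow> integral\<^sup>L lborel c"
    unfolding ceq by (rule limgen[OF ci]) (auto simp: c_def)
  define T where "T = (\<lambda>r. sphere_integral (\<lambda>z. indicator upper z * F z) 0 r)"
  \<comment> \<open>The factor 2r makes \<phi> the derivative of - S (l (1 - r^2)), so that its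
    integral is exactly 1; the surface term is divided by r to compensate.\<close>
  define \<phi> where "\<phi> = (\<lambda>n r. indicator {0<..} r * (2 * r * l n * S' (l n * (1 - r\<^sup>2))))"
  have \<phi>eq: "indicator {0<..} r * sphere_integral (B n) 0 r = - (\<phi> n r * (T r / r))" for n r
  proof (cases "r > 0")
    case True
    have "B n = (\<lambda>z. 2 * \<eta>' n (z \<bullet> z) * (indicator upper z * F z))"
      by (auto simp: B_def F_def fun_eq_iff)
    then have "sphere_integral (B n) 0 r = 2 * \<eta>' n (r\<^sup>2) * T r"
      unfolding T_def using sphere_integral_radial_factor[OF True, of "\<lambda>u. 2 * \<eta>' n u"] by simp
    then show ?thesis using True by (simp add: \<phi>_def \<eta>'_def)
  qed (simp add: \<phi>_def)
  have \<phi>0: "\<phi> n r = 0" if "\<not> (1 - 1 / l n < r \<and> r < 1)" for n r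
  proof (cases "r > 0")
    case True
    have "l n * (1 - r\<^sup>2) \<le> 0 \<or> l n * (1 - r\<^sup>2) \<ge> 1"
    proof (cases "r < 1")
      case True
      then have "r \<le> 1 - 1 / l n" using that by simp
      moreover have "r\<^sup>2 \<le> r" using True \<open>r > 0\<close> by (simp add: power2_eq_square mult_left_le)
      ultimately have "1 / l n \<le> 1 - r\<^sup>2" by simp
      then have "1 \<le> l n * (1 - r\<^sup>2)" using l[of n] by (simp add: field_simps)
      then show ?thesis by simp
    next
      case False
      then have "1 \<le> r\<^sup>2" by (simp add: one_le_power)
      then show ?thesis using l[of n] by (simp add: mult_nonneg_nonpos)
    qed
    then show ?thesis using S(6) by (simp add: \<phi>_def)
  qed (simp add: \<phi>_def)
  have \<phi>pos: "\<phi> n r \<ge> 0" for n r using S(5) l[of n] by (auto simp: \<phi>_def indicator_def)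
  have \<phi>1: "has_bochner_integral lborel (\<phi> n) 1" for n
  proof -
    let ?f = "\<lambda>r. 2 * r * l n * S' (l n * (1 - r\<^sup>2))"
    have D: "((\<lambda>r. - S (l n * (1 - r\<^sup>2))) has_real_derivative ?f r) (at r)" for r
      by (rule DERIV_cong[OF DERIV_minus[OF DERIV_chain2[OF S(1)]]]) (auto intro!: derivative_eq_intros)
    have cf: "continuous_on UNIV ?f"
      by (intro continuous_intros continuous_on_compose2[OF S(2)]) auto
    have "has_bochner_integral lborel (\<lambda>r. ?f r * indicator {0..1} r) (- S (l n * (1 - 1\<^sup>2)) - - S (l n * (1 - 0\<^sup>2)))"
      by (rule has_bochner_integral_FTC_Icc_real[where F = "\<lambda>r. - S (l n * (1 - r\<^sup>2))"])
         (use D cf in \<open>auto simp: continuous_on_eq_continuous_at\<close>)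
    moreover have "(\<lambda>r. ?f r * indicator {0..1} r) = \<phi> n"
    proof
      fix r show "?f r * indicator {0..1} r = \<phi> n r"
        using \<phi>0[of n r] by (cases "r \<le> 1") (auto simp: \<phi>_def indicator_def)
    qed
    moreover have "- S (l n * (1 - 1\<^sup>2)) - - S (l n * (1 - 0\<^sup>2)) = 1" using S(3,4) l[of n] by simp
    ultimately show ?thesis by simp
  qed
  have iphi: "integrable lborel (\<lambda>r. \<phi> n r * (T r / r))"
    and Bint: "integral\<^sup>L lborel (B n) = - (LINT r|lborel. \<phi> n r * (T r / r))" for n
    using integral_polar[OF wf(1)[of n]] unfolding \<phi>eq by simp_all
  have Tc: "continuous_on {1/2..2} (\<lambda>r. T r / r)"
    unfolding T_def
    by (intro continuous_intros sphere_integral_continuous[OF a less_imp_le[OF K(1)] Fc]) (use K(3) in \<open>auto simp: F_def\<close>)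
  have limB: "(\<lambda>n. LINT r|lborel. \<phi> n r * (T r / r)) \<longlonglongrightarrow> T 1 / 1"
  proof (rule approximate_identity[OF \<phi>1 \<phi>pos iphi])
    fix e :: real assume "e > 0"
    moreover have "(1::real) \<in> {1/2..2}" by simp
    ultimately obtain d where d: "d > 0" "\<And>r. r \<in> {1/2..2} \<Longrightarrow> dist r 1 < d \<Longrightarrow> dist (T r / r) (T 1 / 1) < e"
      using Tc unfolding continuous_on_iff by blast
    define d' where "d' = min d (1 / 2)"
    have d': "d' > 0" "d' \<le> d" "d' \<le> 1 / 2" using d by (auto simp: d'_def)
    obtain N where N: "real N \<ge> 1 / d'" using real_arch_simple by blast
    have "\<bar>T r / r - T 1 / 1\<bar> \<le> e" if n: "n \<ge> N" "\<phi> n r \<noteq> 0" for n r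
    proof -
      have r: "1 - 1 / l n < r" "r < 1" using \<phi>0[of n r] n(2) by auto
      have "l n \<ge> 1 / d'" using N n(1) by (simp add: l_def)
      then have "1 / l n \<le> d'" using d'(1) l[of n] by (simp add: field_simps)
      then show ?thesis using r d(2)[of r] d' by (simp add: dist_real_def)
    qed
    then show "\<forall>\<^sub>F n in sequentially. \<forall>r. \<phi> n r \<noteq> 0 \<longrightarrow> \<bar>T r / r - T 1 / 1\<bar> \<le> e"
      unfolding eventually_sequentially by blast
  qed
  have "(\<lambda>n. integral\<^sup>L lborel (A n) + integral\<^sup>L lborel (B n) + (LINT x|lborel. \<eta> n (x \<bullet> x) * (h (x, 0) * gk (x, 0))))
      \<longlonglongrightarrow> integral\<^sup>L lborel Q + - (T 1 / 1) + integral\<^sup>L lborel c"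
    unfolding Bint by (intro tendsto_add tendsto_minus limA limB limC)
  then have "integral\<^sup>L lborel Q + - (T 1 / 1) + integral\<^sup>L lborel c = 0"
    unfolding wf(2) using LIMSEQ_unique tendsto_const by metis
  then show ?eq
    by (simp add: Q_def T_def F_def c_def set_lebesgue_integral_def)
qed

section \<open>Monotonicity of the energy\<close>

text \<open>The flux scales by l^(1-a): one factor l from the derivative, and l^(-a) because the
  weight is taken at height y instead of l y.\<close>

lemma regular_solution_rescale:
  fixes f g :: "(real^'n) \<times> real \<Rightarrow> real"
  assumes f: "regular_solution a f g" and l: "l > 0" and x0: "snd x0 = 0"
  shows "regular_solution a (\<lambda>z. c * f (x0 + l *\<^sub>R z)) (\<lambda>z. c * l powr (1 - a) * g (x0 + l *\<^sub>R z))"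
  unfolding regular_solution_def
proof (intro conjI allI ballI)
  have sol: "solves a f" and cf: "continuous_on upper_cl f" and cg: "continuous_on upper_cl g"
    and g: "\<And>z. z \<in> upper \<Longrightarrow> g z = snd z powr a * partial f (0, 1) z"
    using f unfolding regular_solution_def by auto
  have C2: "C2_on upper f" using sol by (simp add: solves_def)
  have up: "x0 + l *\<^sub>R z \<in> upper \<longleftrightarrow> z \<in> upper" "x0 + l *\<^sub>R z \<in> upper_cl \<longleftrightarrow> z \<in> upper_cl" for z
    using upper_rescale[OF x0 l] by auto
  have pr: "partial (\<lambda>z. c * f (x0 + l *\<^sub>R z)) d z = c * l * partial f d (x0 + l *\<^sub>R z)" if "z \<in> upper" for z d
    by (rule partial_rescale[OF C2_onD(1)[OF C2]]) (use that up in simp)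
  show "solves a (\<lambda>z. c * f (x0 + l *\<^sub>R z))" by (rule solves_rescale[OF sol l x0])
  show "continuous_on upper_cl (\<lambda>z. c * f (x0 + l *\<^sub>R z))"
    by (intro continuous_intros continuous_on_compose2[OF cf]) (use up in auto)
  show "continuous_on upper_cl (\<lambda>z. c * l powr (1 - a) * g (x0 + l *\<^sub>R z))"
    by (intro continuous_intros continuous_on_compose2[OF cg]) (use up in auto)
  fix z :: "(real^'n) \<times> real" assume z: "z \<in> upper"
  have y: "snd z > 0" using z by (simp add: upper_def)
  have "l powr (1 - a) * (l * snd z) powr a = l * snd z powr a"
    using l y by (simp add: powr_mult powr_diff)
  then show "c * l powr (1 - a) * g (x0 + l *\<^sub>R z) = snd z powr a * partial (\<lambda>z. c * f (x0 + l *\<^sub>R z)) (0, 1) z"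
    using z x0 by (simp add: pr g up mult_ac)
next
  fix R
  have C2: "C2_on upper f" using f by (simp add: regular_solution_def solves_def)
  obtain C where C: "\<And>z b. z \<in> upper \<Longrightarrow> b \<in> Basis \<Longrightarrow> norm z \<le> norm x0 + l * R \<Longrightarrow> \<bar>partial f (b, 0) z\<bar> \<le> C"
    using f unfolding regular_solution_def by meson
  show "\<exists>C. \<forall>z\<in>upper. \<forall>b\<in>Basis. norm z \<le> R \<longrightarrow> \<bar>partial (\<lambda>z. c * f (x0 + l *\<^sub>R z)) (b, 0) z\<bar> \<le> C"
  proof (intro exI ballI impI)
    fix z :: "(real^'n) \<times> real" and b :: "real^'n" assume z: "z \<in> upper" and b: "b \<in> Basis" and n: "norm z \<le> R"
    have up: "x0 + l *\<^sub>R z \<in> upper" using upper_rescale(1)[OF x0 l] z by simp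
    have "norm (x0 + l *\<^sub>R z) \<le> norm x0 + l * norm z"
      using norm_triangle_ineq[of x0 "l *\<^sub>R z"] l by simp
    also have "\<dots> \<le> norm x0 + l * R" using n l by simp
    finally have "\<bar>partial f (b, 0) (x0 + l *\<^sub>R z)\<bar> \<le> C" by (rule C[OF up b])
    then have "\<bar>c * l\<bar> * \<bar>partial f (b, 0) (x0 + l *\<^sub>R z)\<bar> \<le> \<bar>c * l\<bar> * C" by (rule mult_left_mono) simp
    then show "\<bar>partial (\<lambda>z. c * f (x0 + l *\<^sub>R z)) (b, 0) z\<bar> \<le> \<bar>c * l\<bar> * C"
      by (simp add: partial_rescale[OF C2_onD(1)[OF C2 up]] abs_mult)
  qed
qed

text \<open>Away from zeros this is the chain rule for a power of the squared norm. Where the vector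
  u + t h vanishes, moving the parameter by r gives a constant multiple of |r|^(p+1), whose
  derivative at r = 0 is 0.\<close>

lemma norm_power_derivative:
  fixes u h :: "nat \<Rightarrow> real"
  assumes p: "p > 1"
  shows "((\<lambda>t. L2_set (\<lambda>i. u i + t * h i) {..<m} powr (p + 1) / (p + 1)) has_real_derivative
     (\<Sum>i<m. h i * (L2_set (\<lambda>i. u i + t * h i) {..<m} powr (p - 1) * (u i + t * h i)))) (at t)"
proof -
  define q where "q = (\<lambda>t. \<Sum>i<m. (u i + t * h i)\<^sup>2)"
  have q0: "q t \<ge> 0" for t by (simp add: q_def sum_nonneg)
  have L: "L2_set (\<lambda>i. u i + t * h i) {..<m} powr e = q t powr (e / 2)" for t e
  proof -
    have "sqrt (q t) powr e = (q t powr (1 / 2)) powr e" using q0 by (simp add: powr_half_sqrt)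
    moreover have "L2_set (\<lambda>i. u i + t * h i) {..<m} = sqrt (q t)" by (simp add: L2_set_def q_def)
    ultimately show ?thesis by (simp add: powr_powr)
  qed
  show ?thesis
  proof (cases "q t > 0")
    case True
    have dq: "(q has_real_derivative (\<Sum>i<m. 2 * (u i + t * h i) * h i)) (at t)"
      unfolding q_def by (rule DERIV_sum) (auto intro!: derivative_eq_intros)
    have "((\<lambda>t. q t powr ((p + 1) / 2) / (p + 1)) has_real_derivative
        ((p + 1) / 2 * q t powr ((p + 1) / 2 - 1) * (\<Sum>i<m. 2 * (u i + t * h i) * h i)) / (p + 1)) (at t)"
      by (rule DERIV_cdivide[OF DERIV_chain2[OF has_real_derivative_powr[OF True] dq]])
    moreover have "((p + 1) / 2 * q t powr ((p + 1) / 2 - 1) * (\<Sum>i<m. 2 * (u i + t * h i) * h i)) / (p + 1)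
       = (\<Sum>i<m. h i * (q t powr ((p - 1) / 2) * (u i + t * h i)))"
    proof -
      have e: "(p + 1) / 2 - 1 = (p - 1) / 2" by (simp add: field_simps)
      have e2: "(\<Sum>i<m. 2 * (u i + t * h i) * h i) = 2 * (\<Sum>i<m. (u i + t * h i) * h i)"
        by (simp only: sum_distrib_left mult.assoc)
      have e3: "(P / 2 * Q * (2 * Z)) / P = Q * Z" if "P \<noteq> 0" for P Q Z :: real using that by simp
      have e4: "q t powr ((p - 1) / 2) * (\<Sum>i<m. (u i + t * h i) * h i) = (\<Sum>i<m. h i * (q t powr ((p - 1) / 2) * (u i + t * h i)))"
        unfolding sum_distrib_left by (intro sum.cong refl) (simp only: mult_ac)
      have "p + 1 \<noteq> 0" using p by simp
      from e3[OF this] show ?thesis unfolding e e2 e4[symmetric] by simp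
    qed
    ultimately show ?thesis unfolding L by simp
  next
    case False
    then have "q t = 0" using q0[of t] by simp
    then have z: "u i + t * h i = 0" if "i < m" for i
      using that by (simp add: q_def sum_nonneg_eq_0_iff)
    define H where "H = L2_set h {..<m} powr (p + 1) / (p + 1)"
    have eq: "L2_set (\<lambda>i. u i + (t + r) * h i) {..<m} powr (p + 1) / (p + 1) = \<bar>r\<bar> powr (p + 1) * H" for r
    proof -
      have "L2_set (\<lambda>i. u i + (t + r) * h i) {..<m} = L2_set (\<lambda>i. r * h i) {..<m}"
        using z by (intro L2_set_cong) (auto simp: distrib_right)
      also have "\<dots> = \<bar>r\<bar> * L2_set h {..<m}"
        by (simp add: L2_set_def power_mult_distrib sum_distrib_left[symmetric] real_sqrt_mult)
      finally show ?thesis by (simp add: H_def powr_mult L2_set_nonneg)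
    qed
    have "((\<lambda>r. (L2_set (\<lambda>i. u i + (t + r) * h i) {..<m} powr (p + 1) / (p + 1)
        - L2_set (\<lambda>i. u i + t * h i) {..<m} powr (p + 1) / (p + 1)) / r) \<longlongrightarrow> 0) (at 0)"
    proof (rule tendsto_0_le[where K = "\<bar>H\<bar>"])
      have "((\<lambda>r::real. \<bar>r\<bar> powr p) \<longlongrightarrow> \<bar>0\<bar> powr p) (at 0)"
        by (rule tendsto_powr'[OF tendsto_rabs[OF tendsto_ident_at] tendsto_const]) (use p in auto)
      then show "((\<lambda>r::real. \<bar>r\<bar> powr p) \<longlongrightarrow> 0) (at 0)" using p by simp
      show "eventually (\<lambda>r. norm ((L2_set (\<lambda>i. u i + (t + r) * h i) {..<m} powr (p + 1) / (p + 1)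
        - L2_set (\<lambda>i. u i + t * h i) {..<m} powr (p + 1) / (p + 1)) / r) \<le> norm (\<bar>r\<bar> powr p) * \<bar>H\<bar>) (at 0)"
        unfolding eventually_at_filter
      proof (intro always_eventually allI impI)
        fix r :: real assume r: "r \<noteq> 0"
        have z0: "L2_set (\<lambda>i. u i + t * h i) {..<m} powr (p + 1) / (p + 1) = 0" using eq[of 0] by simp
        have "\<bar>r\<bar> powr (p + 1) = \<bar>r\<bar> powr p * \<bar>r\<bar>" using r by (simp add: powr_add)
        then show "norm ((L2_set (\<lambda>i. u i + (t + r) * h i) {..<m} powr (p + 1) / (p + 1)
          - L2_set (\<lambda>i. u i + t * h i) {..<m} powr (p + 1) / (p + 1)) / r) \<le> norm (\<bar>r\<bar> powr p) * \<bar>H\<bar>"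
          unfolding eq z0 using r by (simp add: abs_mult)
      qed
    qed
    moreover have "(\<Sum>i<m. h i * (L2_set (\<lambda>i. u i + t * h i) {..<m} powr (p - 1) * (u i + t * h i))) = 0"
      by (intro sum.neutral) (use z in auto)
    ultimately show ?thesis unfolding DERIV_def by simp
  qed
qed

text \<open>By the mean value theorem the exact difference of the potential is h . f(x) for some x
  on the segment from \<open>u\<close> to \<open>w\<close>. Both f(w) - f(x) and f(u) - f(x) are at
  most a Lipschitz constant times d, and their average is multiplied by h, so the error is of order
  d^2. Points of the segment have norm at most B + d \<le> 3B, and q + 2 = p + 1 for the exponent q
  = p - 1.\<close>

lemma trapezoid_error:
  fixes u w :: "nat \<Rightarrow> real"
  assumes p: "p > 1" and B: "L2_set u {..<m} \<le> B" "L2_set w {..<m} \<le> B"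
  shows "\<bar>(1 / 2) * (\<Sum>i<m. (w i - u i) * (L2_set w {..<m} powr (p - 1) * w i + L2_set u {..<m} powr (p - 1) * u i))
      - (L2_set w {..<m} powr (p + 1) - L2_set u {..<m} powr (p + 1)) / (p + 1)\<bar>
    \<le> real m * ((p + 1) * (3 * B) powr (p - 1)) * (L2_set (\<lambda>i. w i - u i) {..<m})\<^sup>2"
proof -
  define h where "h = (\<lambda>i. w i - u i)"
  define d where "d = L2_set h {..<m}"
  define f where "f = (\<lambda>x i. L2_set x {..<m} powr (p - 1) * (x i :: real))"
  have B0: "B \<ge> 0" using order_trans[OF L2_set_nonneg B(1)] .
  have d0: "d \<ge> 0" by (simp add: d_def L2_set_nonneg)
  have scale: "L2_set (\<lambda>i. t * h i) {..<m} = \<bar>t\<bar> * d" for t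
    by (simp add: d_def L2_set_def power_mult_distrib sum_distrib_left[symmetric] real_sqrt_mult)
  have d2: "d \<le> 2 * B"
  proof -
    have "d \<le> L2_set w {..<m} + L2_set (\<lambda>i. - u i) {..<m}"
      using L2_set_triangle_ineq[of w "\<lambda>i. - u i" "{..<m}"] by (simp add: d_def h_def)
    also have "L2_set (\<lambda>i. - u i) {..<m} = L2_set u {..<m}" by (simp add: L2_set_def)
    finally show ?thesis using B by simp
  qed
  have "\<exists>t>0. t < 1 \<and> L2_set (\<lambda>i. u i + 1 * h i) {..<m} powr (p + 1) / (p + 1) - L2_set (\<lambda>i. u i + 0 * h i) {..<m} powr (p + 1) / (p + 1)
     = (1 - 0) * (\<Sum>i<m. h i * (L2_set (\<lambda>i. u i + t * h i) {..<m} powr (p - 1) * (u i + t * h i)))"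
    by (rule MVT2) (auto intro: norm_power_derivative[OF p])
  then obtain t where t: "0 < t" "t < 1" and mv: "(L2_set w {..<m} powr (p + 1) - L2_set u {..<m} powr (p + 1)) / (p + 1)
     = (\<Sum>i<m. h i * f (\<lambda>i. u i + t * h i) i)"
    by (auto simp: h_def f_def diff_divide_distrib)
  define x where "x = (\<lambda>i. u i + t * h i)"
  have xB: "L2_set x {..<m} \<le> 3 * B"
  proof -
    have "L2_set x {..<m} \<le> L2_set u {..<m} + \<bar>t\<bar> * d"
      using L2_set_triangle_ineq[of u "\<lambda>i. t * h i" "{..<m}"] unfolding scale by (simp add: x_def)
    also have "\<bar>t\<bar> * d \<le> 1 * d" using t d0 by (intro mult_right_mono) auto
    finally show ?thesis using B d2 by simp
  qed
  have wB: "L2_set w {..<m} \<le> 3 * B" "L2_set u {..<m} \<le> 3 * B" using B B0 by auto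
  define Lc where "Lc = (p + 1) * (3 * B) powr (p - 1)"
  have Lc: "Lc \<ge> 0" using p by (simp add: Lc_def)
  have dwx: "L2_set (\<lambda>i. w i - x i) {..<m} \<le> d" "L2_set (\<lambda>i. u i - x i) {..<m} \<le> d"
  proof -
    have "(\<lambda>i. w i - x i) = (\<lambda>i. (1 - t) * h i)" by (auto simp: x_def h_def algebra_simps)
    then have "L2_set (\<lambda>i. w i - x i) {..<m} = \<bar>1 - t\<bar> * d" by (simp only: scale)
    also have "\<dots> \<le> 1 * d" using t d0 by (intro mult_right_mono) auto
    finally show "L2_set (\<lambda>i. w i - x i) {..<m} \<le> d" by simp
    have "(\<lambda>i. u i - x i) = (\<lambda>i. (- t) * h i)" by (auto simp: x_def)
    then have "L2_set (\<lambda>i. u i - x i) {..<m} = \<bar>- t\<bar> * d" by (simp only: scale)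
    also have "\<dots> \<le> 1 * d" using t d0 by (intro mult_right_mono) auto
    finally show "L2_set (\<lambda>i. u i - x i) {..<m} \<le> d" by simp
  qed
  have lip: "\<bar>f y i - f x i\<bar> \<le> Lc * d" if "i < m" "L2_set y {..<m} \<le> 3 * B" "L2_set (\<lambda>i. y i - x i) {..<m} \<le> d" for y i
  proof -
    have "\<bar>f y i - f x i\<bar> \<le> ((p - 1) + 2) * (3 * B) powr (p - 1) * L2_set (\<lambda>i. y i - x i) {..<m}"
      unfolding f_def by (rule power_nonlinearity_lipschitz) (use p that xB in auto)
    also have "\<dots> \<le> ((p - 1) + 2) * (3 * B) powr (p - 1) * d"
      using that p by (intro mult_left_mono) auto
    finally show ?thesis by (simp add: Lc_def add.commute)
  qed
  have hi: "\<bar>h i\<bar> \<le> d" if "i < m" for i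
    using member_le_L2_set[of "{..<m}" i "\<lambda>i. \<bar>h i\<bar>"] that by (simp add: d_def L2_set_def)
  have "(1 / 2) * (\<Sum>i<m. (w i - u i) * (f w i + f u i)) - (\<Sum>i<m. h i * f x i)
     = (\<Sum>i<m. h i * ((f w i - f x i) / 2 + (f u i - f x i) / 2))"
    unfolding sum_distrib_left sum_subtractf[symmetric]
    by (intro sum.cong refl) (simp add: h_def field_simps)
  also have "\<bar>\<dots>\<bar> \<le> (\<Sum>i<m. d * (Lc * d))"
  proof (rule order_trans[OF sum_abs], rule sum_mono)
    fix i assume "i \<in> {..<m}"
    then have i: "i < m" by simp
    have "\<bar>(f w i - f x i) / 2 + (f u i - f x i) / 2\<bar> \<le> Lc * d"
      using lip[OF i wB(1) dwx(1)] lip[OF i wB(2) dwx(2)]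
        abs_triangle_ineq[of "(f w i - f x i) / 2" "(f u i - f x i) / 2"] by simp
    then show "\<bar>h i * ((f w i - f x i) / 2 + (f u i - f x i) / 2)\<bar> \<le> d * (Lc * d)"
      unfolding abs_mult using hi[OF i] d0 by (intro mult_mono) auto
  qed
  also have "\<dots> = real m * Lc * d\<^sup>2" by (simp add: power2_eq_square)
  finally show ?thesis unfolding mv by (simp add: f_def x_def Lc_def d_def h_def)
qed

context extension_system
begin

text \<open>The continuous extension of the weighted derivative and the boundary condition describe
  the limit along the same vertical line, so they agree on y = 0. The remaining requirement is the
  tangential gradient bound.\<close>

lemma regular:
  assumes i: "i < m"
  obtains g where "regular_solution (1 - 2 * s) (v i) g"
    "\<And>x. g (x, 0) = - (\<kappa> * vnorm m v (x, 0) powr (p - 1) * v i (x, 0))"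
proof -
  obtain g where g: "continuous_on upper_cl g" "\<And>z. z \<in> upper \<Longrightarrow> g z = snd z powr (1 - 2 * s) * partial (v i) (0, 1) z"
    using cont_flux[OF i] by blast
  have "\<exists>C. \<forall>z\<in>upper. \<forall>b\<in>Basis. norm z \<le> R \<longrightarrow> \<bar>partial (v i) (b, 0) z\<bar> \<le> C" for R
    by (rule tangential_gradient_bound[of R]) (use i in blast)
  then have "regular_solution (1 - 2 * s) (v i) g"
    unfolding regular_solution_def using sol[OF i] cont[OF i] g by blast
  moreover have "g (x, 0) = - (\<kappa> * vnorm m v (x, 0) powr (p - 1) * v i (x, 0))" for x
  proof (rule tendsto_unique[OF _ _ flux[OF i]])
    have "continuous_on {0..} (\<lambda>y. g (x, y))"
      by (intro continuous_on_compose2[OF g(1)] continuous_intros) (auto simp: upper_cl_def)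
    then have "((\<lambda>y. g (x, y)) \<longlongrightarrow> g (x, 0)) (at 0 within {0..})"
      unfolding continuous_on by simp
    then have "((\<lambda>y. g (x, y)) \<longlongrightarrow> g (x, 0)) (at_right 0)"
      by (rule tendsto_mono[rotated]) (auto intro!: at_le)
    then show "((\<lambda>y. y powr (1 - 2 * s) * partial (v i) (0, 1) (x, y)) \<longlongrightarrow> g (x, 0)) (at_right 0)"
      by (rule Lim_transform_eventually)
         (auto simp: eventually_at_filter g(2) upper_def intro!: always_eventually)
  qed simp
  ultimately show thesis by (rule that)
qed

end

section \<open>The blow-up family and scale invariance of the energy\<close>

lemma vnorm_rescale:
  "c \<ge> 0 \<Longrightarrow> vnorm m (\<lambda>i z. c * v i (f z)) z = c * vnorm m v (f z)"
  by (simp add: vnorm_def power_mult_distrib sum_distrib_left[symmetric] real_sqrt_mult)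

lemma integral_lborel_affine:
  fixes f :: "'a::euclidean_space \<Rightarrow> real"
  assumes [measurable]: "f \<in> borel_measurable borel" and l: "l > 0"
  shows "(LINT z|lborel. f z) = l ^ DIM('a) * (LINT z|lborel. f (x0 + l *\<^sub>R z))"
proof -
  have "(LINT z|lborel. f z) = (LINT z|density (distr lborel borel (\<lambda>x. x0 + l *\<^sub>R x)) (\<lambda>_. ennreal (\<bar>l\<bar> ^ DIM('a))). f z)"
    using l by (subst lborel_affine[of l x0]) simp_all
  also have "\<dots> = (LINT z|distr lborel borel (\<lambda>x. x0 + l *\<^sub>R x). (\<bar>l\<bar> ^ DIM('a)) *\<^sub>R f z)"
    by (rule integral_density) auto
  also have "\<dots> = (LINT z|lborel. (\<bar>l\<bar> ^ DIM('a)) *\<^sub>R f (x0 + l *\<^sub>R z))"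
    by (rule integral_distr) auto
  finally show ?thesis using l by simp
qed

text \<open>The cone measure evaluates its argument on the sphere except at the apex, a null set, so
  the scaling relation is required on the unit sphere only.\<close>

lemma sphere_integral_rescale:
  fixes F :: "'a::euclidean_space \<Rightarrow> real"
  assumes "\<And>z. norm z = 1 \<Longrightarrow> F (x0 + l *\<^sub>R z) = k * F' z"
  shows "sphere_integral F x0 l = l ^ (DIM('a) - 1) * k * sphere_integral F' 0 1"
proof -
  have "(LINT z|lborel. indicator (ball 0 1) z *\<^sub>R F (x0 + l *\<^sub>R (z /\<^sub>R norm z)))
      = (LINT z|lborel. k * (indicator (ball 0 1) z *\<^sub>R F' (0 + 1 *\<^sub>R (z /\<^sub>R norm z))))"
  proof (rule integral_discrete_difference[of "{0}"])
    fix z :: 'a assume "z \<notin> {0}"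
    then have "norm (z /\<^sub>R norm z) = 1" by simp
    from assms[OF this] show "indicator (ball 0 1) z *\<^sub>R F (x0 + l *\<^sub>R (z /\<^sub>R norm z))
      = k * (indicator (ball 0 1) z *\<^sub>R F' (0 + 1 *\<^sub>R (z /\<^sub>R norm z)))" by simp
  qed auto
  then show ?thesis unfolding sphere_integral_def set_lebesgue_integral_def by simp
qed

locale monotonicity = extension_system s p \<kappa> m v
  for s p \<kappa> :: real and m :: nat and v :: "nat \<Rightarrow> (real^'n) \<times> real \<Rightarrow> real" +
  fixes x0 :: "(real^'n) \<times> real"
  assumes x0: "snd x0 = 0"
begin

definition c where "c = 2 * s / (p - 1)"

definition blow where "blow l i z = l powr c * v i (x0 + l *\<^sub>R z)"

lemma c_pos: "c > 0" using s p by (simp add: c_def)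

lemma c_p: "c * p = c + 2 * s" "c * (p + 1) = 2 * c + 2 * s" "2 * s * (p + 1) / (p - 1) = 2 * c + 2 * s"
  using p by (simp_all add: c_def field_simps)

text \<open>The flux picks up l^(c + 2s), the nonlinearity (l^c)^p, and these agree because c (p -
  1) = 2s. Hence every member of the family satisfies the same boundary condition.\<close>

lemma blow_regular:
  assumes l: "l > 0" and i: "i < m"
  obtains g where "regular_solution (1 - 2 * s) (blow l i) g"
    "\<And>x. g (x, 0) = - (\<kappa> * (vnorm m (blow l) (x, 0) powr (p - 1) * blow l i (x, 0)))"
proof -
  obtain g where g: "regular_solution (1 - 2 * s) (v i) g"
    "\<And>x. g (x, 0) = - (\<kappa> * vnorm m v (x, 0) powr (p - 1) * v i (x, 0))"
    using regular[OF i] by blast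
  show thesis
  proof (rule that)
    show "regular_solution (1 - 2 * s) (blow l i) (\<lambda>z. l powr c * l powr (1 - (1 - 2 * s)) * g (x0 + l *\<^sub>R z))"
      unfolding blow_def[abs_def] by (rule regular_solution_rescale[OF g(1) l x0])
    fix x :: "real^'n"
    define w where "w = x0 + l *\<^sub>R (x, 0)"
    have w: "w = (fst w, 0)" using x0 by (simp add: w_def prod_eq_iff)
    have vn: "vnorm m (blow l) (x, 0) = l powr c * vnorm m v w"
      unfolding blow_def[abs_def] w_def by (rule vnorm_rescale) simp
    have bw: "blow l i (x, 0) = l powr c * v i w" by (simp only: blow_def w_def)
    have e: "(l powr c) powr (p - 1) * l powr c = l powr c * l powr (2 * s)"
    proof -
      have "c * (p - 1) = 2 * s" using p by (simp add: c_def)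
      then show ?thesis by (simp add: powr_powr)
    qed
    have "vnorm m (blow l) (x, 0) powr (p - 1) * blow l i (x, 0)
        = ((l powr c) powr (p - 1) * l powr c) * (vnorm m v w powr (p - 1) * v i w)"
      unfolding vn bw by (simp add: powr_mult vnorm_def sum_nonneg)
    moreover have "g w = - (\<kappa> * vnorm m v w powr (p - 1) * v i w)" using g(2)[of "fst w"] w by simp
    ultimately show "l powr c * l powr (1 - (1 - 2 * s)) * g (x0 + l *\<^sub>R (x, 0))
        = - (\<kappa> * (vnorm m (blow l) (x, 0) powr (p - 1) * blow l i (x, 0)))"
      unfolding e w_def[symmetric] by simp
  qed
qed

text \<open>The boundary condition of the second function is inserted in the flat term of Green's
  identity; its factor -\<kappa> turns the minus sign there into a plus.\<close>

lemma green_blow: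
  assumes l: "l > 0" "l' > 0" and i: "i < m"
  shows "set_integrable lborel (upper \<inter> ball 0 1) (\<lambda>z. snd z powr (1 - 2 * s) * (grad (blow l i) z \<bullet> grad (blow l' i) z))"
    "(LINT z:upper \<inter> ball 0 1|lborel. snd z powr (1 - 2 * s) * (grad (blow l i) z \<bullet> grad (blow l' i) z))
     = sphere_integral (\<lambda>z. indicator upper z * (blow l i z * (snd z powr (1 - 2 * s) * (grad (blow l' i) z \<bullet> z)))) 0 1
      + \<kappa> * (LINT x:ball 0 1|lborel. blow l i (x, 0) * (vnorm m (blow l') (x, 0) powr (p - 1) * blow l' i (x, 0)))"
proof -
  obtain g where g: "regular_solution (1 - 2 * s) (blow l i) g" by (rule blow_regular[OF l(1) i])
  obtain g' where g': "regular_solution (1 - 2 * s) (blow l' i) g'"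
    "\<And>x. g' (x, 0) = - (\<kappa> * (vnorm m (blow l') (x, 0) powr (p - 1) * blow l' i (x, 0)))"
    using blow_regular[OF l(2) i] by blast
  have a: "-1 < 1 - 2 * s" "1 - 2 * s < 1" using s by auto
  show "set_integrable lborel (upper \<inter> ball 0 1) (\<lambda>z. snd z powr (1 - 2 * s) * (grad (blow l i) z \<bullet> grad (blow l' i) z))"
    by (rule green_half_ball(1)[OF a g g'(1)])
  have "(LINT x:ball 0 1|lborel. blow l i (x, 0) * g' (x, 0))
     = (LINT x:ball 0 1|lborel. (- \<kappa>) * (blow l i (x, 0) * (vnorm m (blow l') (x, 0) powr (p - 1) * blow l' i (x, 0))))"
    by (simp add: g'(2) mult_ac)
  also have "\<dots> = (- \<kappa>) * (LINT x:ball 0 1|lborel. blow l i (x, 0) * (vnorm m (blow l') (x, 0) powr (p - 1) * blow l' i (x, 0)))"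
    by (rule set_integral_mult_right)
  finally show "(LINT z:upper \<inter> ball 0 1|lborel. snd z powr (1 - 2 * s) * (grad (blow l i) z \<bullet> grad (blow l' i) z))
     = sphere_integral (\<lambda>z. indicator upper z * (blow l i z * (snd z powr (1 - 2 * s) * (grad (blow l' i) z \<bullet> z)))) 0 1
      + \<kappa> * (LINT x:ball 0 1|lborel. blow l i (x, 0) * (vnorm m (blow l') (x, 0) powr (p - 1) * blow l' i (x, 0)))"
    using green_half_ball(2)[OF a g g'(1)] by simp
qed

lemma blow_C2: "l > 0 \<Longrightarrow> i < m \<Longrightarrow> C2_on upper (blow l i)"
  by (rule blow_regular[of l i]) (auto simp: regular_solution_def solves_def)

lemma blow_continuous: "l > 0 \<Longrightarrow> i < m \<Longrightarrow> continuous_on upper_cl (blow l i)"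
  by (rule blow_regular[of l i]) (auto simp: regular_solution_def)

lemma grad_blow:
  assumes l: "l > 0" and i: "i < m" and z: "z \<in> upper"
  shows "grad (blow l i) z = (l powr c * l) *\<^sub>R grad (v i) (x0 + l *\<^sub>R z)"
proof -
  have "x0 + l *\<^sub>R z \<in> upper" using upper_rescale(1)[OF x0 l] z by simp
  from partial_rescale[OF C2_onD(1)[OF C2[OF i] this]] show ?thesis
    unfolding grad_def blow_def[abs_def] by (simp add: scaleR_sum_right)
qed

text \<open>A count of exponents for each integral, with \<alpha> = 2c + 2s - n: 2 (c + 1) =
  \<alpha> + (n + 1) + (1 - 2s) for the Dirichlet part, c (p + 1) = \<alpha> + n for the potential,
  and 2c = (\<alpha> - 1) + n + (1 - 2s) for the surface term.\<close>

lemma Es_blow: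
  assumes l: "l > 0" and \<kappa>: "\<kappa> = kappa s"
  shows "Es s p m v l x0 =
    1 / 2 * (LINT z:upper \<inter> ball 0 1|lborel. snd z powr (1 - 2 * s) * (\<Sum>i<m. (norm (grad (blow l i) z))\<^sup>2))
    - \<kappa> / (p + 1) * (LINT x:ball 0 1|lborel. vnorm m (blow l) (x, 0) powr (p + 1))
    + s / (p - 1) * sphere_integral (\<lambda>z. indicator upper z * (snd z powr (1 - 2 * s) * (vnorm m (blow l) z)\<^sup>2)) 0 1"
proof -
  define n where "n = CARD('n)"
  define \<alpha> where "\<alpha> = 2 * s * (p + 1) / (p - 1) - real n"
  have \<alpha>: "\<alpha> = 2 * c + 2 * s - real n" unfolding \<alpha>_def c_p(3) ..
  have D: "DIM((real^'n) \<times> real) = n + 1" "DIM(real^'n) = n" by (simp_all add: n_def)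
  have pw: "l ^ k = l powr real k" for k using l by (simp add: powr_realpow)
  have up: "x0 + l *\<^sub>R z \<in> upper \<longleftrightarrow> z \<in> upper" for z using upper_rescale(1)[OF x0 l] .
  have ba: "x0 + l *\<^sub>R z \<in> ball x0 l \<longleftrightarrow> z \<in> ball 0 1" for z
    using l by (simp add: dist_norm)
  have sy: "snd (x0 + l *\<^sub>R z) powr e = l powr e * snd z powr e" for z e
    using x0 l by (simp add: powr_mult)
  have vb: "vnorm m (blow l) z = l powr c * vnorm m v (x0 + l *\<^sub>R z)" for z
    unfolding blow_def[abs_def] by (rule vnorm_rescale) simp
  have I1: "l powr \<alpha> * (LINT z:upper \<inter> ball x0 l|lborel. snd z powr (1 - 2 * s) * (\<Sum>i<m. (norm (grad (v i) z))\<^sup>2))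
     = (LINT z:upper \<inter> ball 0 1|lborel. snd z powr (1 - 2 * s) * (\<Sum>i<m. (norm (grad (blow l i) z))\<^sup>2))"
  proof -
    let ?f = "\<lambda>z. indicator (ball x0 l) z * (indicator upper z * (snd z powr (1 - 2 * s) * (\<Sum>i<m. (norm (grad (v i) z))\<^sup>2)))"
    let ?g = "\<lambda>z. indicator (upper \<inter> ball 0 1) z * (snd z powr (1 - 2 * s) * (\<Sum>i<m. (norm (grad (blow l i) z))\<^sup>2))"
    have "continuous_on upper (grad (v i))" if "i < m" for i
      by (rule C2_on_continuous_grad[OF C2[OF that]])
    then have "(\<lambda>z. indicator upper z * (snd z powr (1 - 2 * s) * (\<Sum>i<m. (norm (grad (v i) z))\<^sup>2))) \<in> borel_measurable borel"
      by (intro measurable_on_upper continuous_intros) (auto simp: upper_def)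
    then have m: "?f \<in> borel_measurable borel"
      by (rule borel_measurable_times[OF borel_measurable_indicator, rotated]) simp
    have "l powr \<alpha> * (l ^ (n + 1) * ?f (x0 + l *\<^sub>R z)) = ?g z" for z
    proof (cases "z \<in> upper \<inter> ball 0 1")
      case True
      have "(norm (grad (blow l i) z))\<^sup>2 = (l powr c * l)\<^sup>2 * (norm (grad (v i) (x0 + l *\<^sub>R z)))\<^sup>2" if "i < m" for i
        using True l that by (simp add: grad_blow power_mult_distrib)
      then have "?g z = snd z powr (1 - 2 * s) * ((l powr c * l)\<^sup>2 * (\<Sum>i<m. (norm (grad (v i) (x0 + l *\<^sub>R z)))\<^sup>2))"
        using True by (simp add: sum_distrib_left)
      moreover have "l powr \<alpha> * (l ^ (n + 1) * l powr (1 - 2 * s)) = (l powr c * l)\<^sup>2"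
      proof -
        have "(l powr c * l)\<^sup>2 = (l powr (c + 1)) powr 2" using l by (simp add: powr_add powr_numeral)
        also have "\<dots> = l powr (\<alpha> + (real (n + 1) + (1 - 2 * s)))"
          unfolding powr_powr by (rule arg_cong[where f = "\<lambda>e. l powr e"]) (simp add: \<alpha>)
        also have "\<dots> = l powr \<alpha> * (l ^ (n + 1) * l powr (1 - 2 * s))" unfolding pw by (simp only: powr_add)
        finally show ?thesis by simp
      qed
      ultimately show ?thesis using True by (simp only: indicator_simps Int_iff up ba sy mult_1) (simp add: mult_ac ba[simplified] up indicator_def)
    next
      case False
      then have "indicator (ball x0 l) (x0 + l *\<^sub>R z) * indicator upper (x0 + l *\<^sub>R z) = (0::real)"
        using up ba by (auto simp only: indicator_def) auto
      then show ?thesis using False by (simp add: mult.assoc[symmetric])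
    qed
    then have "(LINT z|lborel. ?g z) = (LINT z|lborel. l powr \<alpha> * (l ^ (n + 1) * ?f (x0 + l *\<^sub>R z)))" by simp
    also have "\<dots> = l powr \<alpha> * (l ^ (n + 1) * (LINT z|lborel. ?f (x0 + l *\<^sub>R z)))"
      by (simp only: integral_mult_right_zero)
    also have "l ^ (n + 1) * (LINT z|lborel. ?f (x0 + l *\<^sub>R z)) = (LINT z|lborel. ?f z)"
      using integral_lborel_affine[OF m l, of x0] unfolding D by simp
    finally show ?thesis
      by (simp add: set_lebesgue_integral_def indicator_inter_arith mult_ac)
  qed
  have I2: "l powr \<alpha> * (LINT x:{x. (x, 0) \<in> ball x0 l}|lborel. vnorm m v (x, 0) powr (p + 1))
     = (LINT x:ball 0 1|lborel. vnorm m (blow l) (x, 0) powr (p + 1))"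
  proof -
    let ?f = "\<lambda>x. indicator (ball (fst x0) l) x * vnorm m v (x, 0) powr (p + 1)"
    let ?g = "\<lambda>x. indicator (ball 0 1) x * vnorm m (blow l) (x, 0) powr (p + 1)"
    have "continuous_on UNIV (\<lambda>x. v i (x, 0))" if "i < m" for i
      by (intro continuous_on_compose2[OF cont[OF that]] continuous_intros) (auto simp: upper_cl_def)
    then have "continuous_on UNIV (\<lambda>x. vnorm m v (x, 0) powr (p + 1))"
      unfolding vnorm_def by (intro continuous_on_powr' continuous_intros) (use p in \<open>auto simp: sum_nonneg\<close>)
    then have m: "?f \<in> borel_measurable borel"
      by (intro borel_measurable_times borel_measurable_indicator borel_measurable_continuous_onI) auto
    have e0: "x0 + l *\<^sub>R (x, 0) = (fst x0 + l *\<^sub>R x, 0)" for x using x0 by (simp add: prod_eq_iff)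
    have "l powr \<alpha> * (l ^ n * ?f (fst x0 + l *\<^sub>R x)) = ?g x" for x
    proof -
      have "fst x0 + l *\<^sub>R x \<in> ball (fst x0) l \<longleftrightarrow> x \<in> ball 0 1" using l by (simp add: dist_norm)
      then have "indicator (ball (fst x0) l) (fst x0 + l *\<^sub>R x) = (indicator (ball 0 1) x :: real)"
        by (simp only: indicator_def)
      moreover have "vnorm m (blow l) (x, 0) powr (p + 1) = l powr \<alpha> * l ^ n * vnorm m v (fst x0 + l *\<^sub>R x, 0) powr (p + 1)"
      proof -
        have "(l powr c) powr (p + 1) = l powr (\<alpha> + real n)"
          unfolding powr_powr c_p(2) by (simp add: \<alpha>)
        then show ?thesis unfolding vb e0 pw by (simp add: powr_mult powr_add vnorm_def sum_nonneg)
      qed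
      ultimately show ?thesis by (simp add: mult_ac)
    qed
    then have "(LINT x|lborel. ?g x) = (LINT x|lborel. l powr \<alpha> * (l ^ n * ?f (fst x0 + l *\<^sub>R x)))" by simp
    also have "\<dots> = l powr \<alpha> * (l ^ n * (LINT x|lborel. ?f (fst x0 + l *\<^sub>R x)))"
      by (simp only: integral_mult_right_zero)
    also have "l ^ n * (LINT x|lborel. ?f (fst x0 + l *\<^sub>R x)) = (LINT x|lborel. ?f x)"
      using integral_lborel_affine[OF m l, of "fst x0"] unfolding D by simp
    finally have "(LINT x|lborel. ?g x) = l powr \<alpha> * (LINT x|lborel. ?f x)" .
    moreover have "{x. (x, 0) \<in> ball x0 l} = ball (fst x0) l"
      using x0 by (cases x0) (auto simp: dist_Pair_Pair)
    ultimately show ?thesis by (simp add: set_lebesgue_integral_def)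
  qed
  have I3: "l powr (\<alpha> - 1) * sphere_integral (\<lambda>z. indicator upper z * (snd z powr (1 - 2 * s) * (vnorm m v z)\<^sup>2)) x0 l
     = sphere_integral (\<lambda>z. indicator upper z * (snd z powr (1 - 2 * s) * (vnorm m (blow l) z)\<^sup>2)) 0 1"
  proof -
    have l2: "(l powr c)\<^sup>2 = l powr (2 * c)" by (simp add: power2_eq_square powr_add[symmetric])
    have "sphere_integral (\<lambda>z. indicator upper z * (snd z powr (1 - 2 * s) * (vnorm m v z)\<^sup>2)) x0 l
      = l ^ (DIM((real^'n) \<times> real) - 1) * l powr (1 - 2 * s - 2 * c) *
        sphere_integral (\<lambda>z. indicator upper z * (snd z powr (1 - 2 * s) * (vnorm m (blow l) z)\<^sup>2)) 0 1"
    proof (rule sphere_integral_rescale)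
      fix z :: "(real^'n) \<times> real"
      have "indicator upper (x0 + l *\<^sub>R z) = (indicator upper z :: real)" using up by (simp add: indicator_def)
      moreover have "l powr (1 - 2 * s) = l powr (1 - 2 * s - 2 * c) * l powr (2 * c)" by (simp add: powr_add[symmetric])
      ultimately show "indicator upper (x0 + l *\<^sub>R z) * (snd (x0 + l *\<^sub>R z) powr (1 - 2 * s) * (vnorm m v (x0 + l *\<^sub>R z))\<^sup>2)
        = l powr (1 - 2 * s - 2 * c) * (indicator upper z * (snd z powr (1 - 2 * s) * (vnorm m (blow l) z)\<^sup>2))"
        unfolding sy vb power_mult_distrib l2 by simp
    qed
    moreover have "l powr (\<alpha> - 1) * (l ^ n * l powr (1 - 2 * s - 2 * c)) = 1"
    proof -
      have "l powr (\<alpha> - 1) * (l ^ n * l powr (1 - 2 * s - 2 * c)) = l powr (\<alpha> - 1 + (real n + (1 - 2 * s - 2 * c)))"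
        unfolding pw by (simp only: powr_add)
      also have "\<alpha> - 1 + (real n + (1 - 2 * s - 2 * c)) = 0" by (simp add: \<alpha>)
      finally show ?thesis using l by simp
    qed
    ultimately show ?thesis unfolding D by (simp add: mult.assoc[symmetric])
  qed
  show ?thesis
    unfolding Es_def Let_def n_def[symmetric] \<alpha>_def[symmetric] I1[symmetric] I2[symmetric] I3[symmetric] \<kappa>
    by (simp add: algebra_simps)
qed

end

text \<open>Integrability for the surface measure of the unit half-sphere, expressed on the cone
  because the surface integral is defined there. Additivity of surface integrals needs it as a side
  condition.\<close>

definition cone_integrable :: "((real^'n) \<times> real \<Rightarrow> real) \<Rightarrow> bool" where
  "cone_integrable F \<longleftrightarrow> integrable lborel (\<lambda>z. cone_integrand F 1 z)"

lemma sphere_integral_upper: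
  fixes F :: "(real^'n) \<times> real \<Rightarrow> real"
  shows "sphere_integral (\<lambda>z. indicator upper z * F z) 0 1 = real DIM((real^'n) \<times> real) *
     (LINT z|lborel. cone_integrand F 1 z)"
  by (simp add: sphere_integral_def set_lebesgue_integral_def)

lemma cone_integrableI:
  fixes F :: "(real^'n) \<times> real \<Rightarrow> real"
  assumes a: "-1 < a" "a < 1" and K: "K \<ge> 0" and Fc: "continuous_on upper F"
    and F: "\<And>z. z \<in> upper \<Longrightarrow> norm z \<le> 2 \<Longrightarrow> \<bar>F z\<bar> \<le> K * (1 + snd z powr a)"
  shows "cone_integrable F"
  unfolding cone_integrable_def
proof (rule Bochner_Integration.integrable_bound)
  show "integrable lborel (\<lambda>z. K * cone_weight a z :: real)"
    by (intro integrable_mult_right cone_weight_integrable a)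
  show "(\<lambda>z. cone_integrand F 1 z) \<in> borel_measurable lborel"
    using cone_integrand_measurable[OF Fc, of 1] by simp
  show "AE z in lborel. norm (cone_integrand F 1 z) \<le> norm (K * cone_weight a z)"
  proof (rule AE_I2)
    fix z
    show "norm (cone_integrand F 1 z) \<le> norm (K * cone_weight a z)"
      unfolding real_norm_def
      by (rule order_trans[OF cone_integrand_bound[OF a K F] abs_ge_self]) simp_all
  qed
qed

lemma sphere_integral_upper_cmult:
  "sphere_integral (\<lambda>z. indicator upper z * (k * F z)) 0 1 = k * sphere_integral (\<lambda>z. indicator upper z * F z) 0 1"
  unfolding sphere_integral_def set_lebesgue_integral_def real_scaleR_def mult.left_commute[of _ k]
    integral_mult_right_zero by simp

lemma cone_cmult:
  assumes "cone_integrable F"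
  shows "cone_integrable (\<lambda>z. k * F z)"
  using assms unfolding cone_integrable_def mult.left_commute[of _ k] by (intro integrable_mult_right)

lemma cone_add:
  assumes "cone_integrable F" "cone_integrable G"
  shows "cone_integrable (\<lambda>z. F z + G z)"
    "sphere_integral (\<lambda>z. indicator upper z * (F z + G z)) 0 1 =
      sphere_integral (\<lambda>z. indicator upper z * F z) 0 1 + sphere_integral (\<lambda>z. indicator upper z * G z) 0 1"
proof -
  note i = assms[unfolded cone_integrable_def]
  have e: "(\<lambda>z. cone_integrand (\<lambda>z. F z + G z) 1 z)
    = (\<lambda>z. cone_integrand F 1 z
      + cone_integrand G 1 z)"
    by (simp only: distrib_left)
  show "cone_integrable (\<lambda>z. F z + G z)"
    unfolding cone_integrable_def e by (rule Bochner_Integration.integrable_add[OF i])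
  show "sphere_integral (\<lambda>z. indicator upper z * (F z + G z)) 0 1 =
      sphere_integral (\<lambda>z. indicator upper z * F z) 0 1 + sphere_integral (\<lambda>z. indicator upper z * G z) 0 1"
    unfolding sphere_integral_upper e Bochner_Integration.integral_add[OF i] by (rule distrib_left)
qed

lemma cone_sum:
  assumes "\<And>i. i \<in> A \<Longrightarrow> cone_integrable (F i)"
  shows "cone_integrable (\<lambda>z. \<Sum>i\<in>A. F i z)"
    "sphere_integral (\<lambda>z. indicator upper z * (\<Sum>i\<in>A. F i z)) 0 1 =
      (\<Sum>i\<in>A. sphere_integral (\<lambda>z. indicator upper z * F i z) 0 1)"
proof -
  note i = assms[unfolded cone_integrable_def]
  show "cone_integrable (\<lambda>z. \<Sum>i\<in>A. F i z)"
    unfolding cone_integrable_def sum_distrib_left by (rule Bochner_Integration.integrable_sum[OF i])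
  have "(LINT z|lborel. (\<Sum>j\<in>A. cone_integrand (F j) 1 z))
    = (\<Sum>j\<in>A. LINT z|lborel. cone_integrand (F j) 1 z)"
    by (rule Bochner_Integration.integral_sum[OF i])
  then show "sphere_integral (\<lambda>z. indicator upper z * (\<Sum>i\<in>A. F i z)) 0 1 =
      (\<Sum>i\<in>A. sphere_integral (\<lambda>z. indicator upper z * F i z) 0 1)"
    unfolding sphere_integral_upper by (simp only: sum_distrib_left)
qed

lemma set_integrable_unit_ball:
  fixes f :: "'a::euclidean_space \<Rightarrow> real"
  assumes "continuous_on UNIV f"
  shows "set_integrable lborel (ball 0 1) f"
proof -
  have "set_integrable lborel (cball 0 1) f"
    unfolding set_integrable_def
    by (rule borel_integrable_compact[OF compact_cball continuous_on_subset[OF assms subset_UNIV]])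
  then show ?thesis by (rule set_integrable_subset) auto
qed

section \<open>Dependence of the blow-up family on its parameter\<close>

context monotonicity
begin

text \<open>One constant for all parameters near \<open>l0\<close>. In the radial derivative the
  normal part is snd w d_y v at the dilated point w, of order (snd w)^(2s) by the flux bound; the
  tangential part is bounded by the Lipschitz regularity. The radius contains all points x0 + l z
  with l \<le> 2 l0 and |z| \<le> 2.\<close>

lemma blow_bounds:
  assumes l0: "l0 > 0"
  obtains C where "C > 0"
    "\<And>l i z. l0 / 2 \<le> l \<Longrightarrow> l \<le> 2 * l0 \<Longrightarrow> i < m \<Longrightarrow> z \<in> upper \<Longrightarrow> norm z \<le> 2 \<Longrightarrow> \<bar>blow l i z\<bar> \<le> C"
    "\<And>l i z. l0 / 2 \<le> l \<Longrightarrow> l \<le> 2 * l0 \<Longrightarrow> i < m \<Longrightarrow> z \<in> upper \<Longrightarrow> norm z \<le> 2 \<Longrightarrow> \<bar>grad (blow l i) z \<bullet> z\<bar> \<le> C"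
proof -
  define R where "R = norm x0 + 4 * l0"
  define N where "N = real CARD('n)"
  have "\<exists>C. \<forall>a. (l0 / 2 \<le> fst a \<and> fst a \<le> 2 * l0 \<and> snd a \<in> upper \<and> norm (snd a) \<le> 2) \<longrightarrow>
     \<bar>blow (fst a) i (snd a)\<bar> + \<bar>grad (blow (fst a) i) (snd a) \<bullet> snd a\<bar> \<le> C" if "i \<in> {..<m}" for i
  proof -
    have i: "i < m" using that by simp
    obtain g where g: "regular_solution (1 - 2 * s) (v i) g" using regular[OF i] by blast
    obtain C1 where C1: "C1 > 0" "\<And>z. z \<in> upper_cl \<Longrightarrow> norm z \<le> R \<Longrightarrow> \<bar>v i z\<bar> \<le> C1"
      "\<And>z b. z \<in> upper \<Longrightarrow> norm z \<le> R \<Longrightarrow> b \<in> Basis \<Longrightarrow> \<bar>partial (v i) (b, 0) z\<bar> \<le> C1"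
      "\<And>z. z \<in> upper \<Longrightarrow> norm z \<le> R \<Longrightarrow> \<bar>partial (v i) (0, 1) z\<bar> \<le> C1 * snd z powr (- (1 - 2 * s))"
      by (rule regular_solution_bounds[OF g, of R]) blast
    define C2 where "C2 = (2 * l0) powr c * C1 + (2 * l0) powr c * (2 * l0 * (N * (C1 * 2)) + C1 * R powr (2 * s))"
    have "\<bar>blow l i z\<bar> + \<bar>grad (blow l i) z \<bullet> z\<bar> \<le> C2"
      if l: "l0 / 2 \<le> l" "l \<le> 2 * l0" and z: "z \<in> upper" "norm z \<le> 2" for l z
    proof -
      have lp: "l > 0" using l l0 by simp
      define w where "w = x0 + l *\<^sub>R z"
      have wu: "w \<in> upper" using upper_rescale(1)[OF x0 lp] z by (simp add: w_def)
      have "norm w \<le> norm x0 + l * norm z" using norm_triangle_ineq[of x0 "l *\<^sub>R z"] lp by (simp add: w_def)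
      also have "l * norm z \<le> (2 * l0) * 2" using l z(2) l0 by (intro mult_mono) auto
      finally have wR: "norm w \<le> R" by (simp add: R_def)
      have lc: "l powr c \<le> (2 * l0) powr c" using lp l c_pos by (intro powr_mono2) auto
      have yw: "snd w = l * snd z" using x0 by (simp add: w_def)
      have y0: "snd z > 0" "snd w > 0" using z wu by (auto simp: upper_def)
      have "\<bar>v i w\<bar> \<le> C1" using C1(2)[OF _ wR] wu upper_subset_cl by auto
      then have b1: "\<bar>blow l i z\<bar> \<le> (2 * l0) powr c * C1"
        unfolding blow_def w_def[symmetric] abs_mult using lc C1(1) by (intro mult_mono) auto
      have bi: "\<bar>fst z \<bullet> b\<bar> \<le> 2" if "b \<in> Basis" for b
        using Basis_le_norm[OF that, of "fst z"] norm_fst_le[of "fst z" "snd z"] z(2) by simp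
      have "\<bar>\<Sum>b\<in>Basis. partial (v i) (b, 0) w * (fst z \<bullet> b)\<bar> \<le> (\<Sum>b\<in>(Basis::(real^'n) set). C1 * 2)"
        by (rule order_trans[OF sum_abs], rule sum_mono, unfold abs_mult, rule mult_mono)
           (use C1(1,3) wu wR bi in auto)
      then have s1: "\<bar>\<Sum>b\<in>Basis. partial (v i) (b, 0) w * (fst z \<bullet> b)\<bar> \<le> N * (C1 * 2)" by (simp add: N_def)
      have "\<bar>partial (v i) (0, 1) w * snd z\<bar> * l \<le> (C1 * snd w powr (- (1 - 2 * s)) * snd z) * l"
        unfolding abs_mult using C1(4)[OF wu wR] y0 lp by (intro mult_right_mono mult_mono) auto
      also have "\<dots> = C1 * (snd w powr (- (1 - 2 * s)) * snd w powr 1)" using y0 by (simp add: yw mult_ac)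
      also have "\<dots> = C1 * snd w powr (2 * s)" by (simp only: powr_add[symmetric]) simp
      also have "\<dots> \<le> C1 * R powr (2 * s)"
      proof -
        have "snd w \<le> R" using norm_snd_le[of "snd w" "fst w"] wR by simp
        then show ?thesis using C1(1) y0 s by (intro mult_left_mono powr_mono2) auto
      qed
      finally have s2: "\<bar>partial (v i) (0, 1) w * snd z\<bar> * l \<le> C1 * R powr (2 * s)" .
      have "\<bar>grad (v i) w \<bullet> z\<bar> * l \<le> \<bar>\<Sum>b\<in>Basis. partial (v i) (b, 0) w * (fst z \<bullet> b)\<bar> * l + \<bar>partial (v i) (0, 1) w * snd z\<bar> * l"
        unfolding grad_inner distrib_right[symmetric] using lp by (intro mult_right_mono abs_triangle_ineq) auto
      also have "\<dots> \<le> (N * (C1 * 2)) * (2 * l0) + C1 * R powr (2 * s)"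
        by (rule add_mono[OF mult_mono[OF s1 l(2)] s2]) (use C1(1) lp in \<open>auto simp: N_def\<close>)
      finally have "\<bar>grad (v i) w \<bullet> z\<bar> * l \<le> 2 * l0 * (N * (C1 * 2)) + C1 * R powr (2 * s)" by (simp add: mult_ac)
      then have "l powr c * (\<bar>grad (v i) w \<bullet> z\<bar> * l) \<le> (2 * l0) powr c * (2 * l0 * (N * (C1 * 2)) + C1 * R powr (2 * s))"
        using lc lp by (intro mult_mono) auto
      moreover have "\<bar>grad (blow l i) z \<bullet> z\<bar> = l powr c * (\<bar>grad (v i) w \<bullet> z\<bar> * l)"
        unfolding grad_blow[OF lp i z(1)] w_def[symmetric] using lp by (simp add: abs_mult mult_ac)
      ultimately show ?thesis using b1 by (simp add: C2_def)
    qed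
    then show ?thesis by (intro exI[of _ C2]) auto
  qed
  then have "\<exists>C>0. \<forall>i\<in>{..<m}. \<forall>a. (l0 / 2 \<le> fst a \<and> fst a \<le> 2 * l0 \<and> snd a \<in> upper \<and> norm (snd a) \<le> 2) \<longrightarrow>
     \<bar>blow (fst a) i (snd a)\<bar> + \<bar>grad (blow (fst a) i) (snd a) \<bullet> snd a\<bar> \<le> C"
    by (rule finite_uniform_bound[OF finite_lessThan])
  then obtain C where C: "C > 0" and b: "\<And>i a. i < m \<Longrightarrow> l0 / 2 \<le> fst a \<and> fst a \<le> 2 * l0 \<and> snd a \<in> upper \<and> norm (snd a) \<le> 2 \<Longrightarrow>
     \<bar>blow (fst a) i (snd a)\<bar> + \<bar>grad (blow (fst a) i) (snd a) \<bullet> snd a\<bar> \<le> C" by blast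
  have sum: "\<bar>blow l i z\<bar> + \<bar>grad (blow l i) z \<bullet> z\<bar> \<le> C"
    if "l0 / 2 \<le> l" "l \<le> 2 * l0" "i < m" "z \<in> upper" "norm z \<le> 2" for l i z
    using b[of i "(l, z)"] that by simp
  show thesis
  proof (rule that[OF C])
    fix l i and z :: "(real^'n) \<times> real" assume "l0 / 2 \<le> l" "l \<le> 2 * l0" "i < m" "z \<in> upper" "norm z \<le> 2"
    from sum[OF this] show "\<bar>blow l i z\<bar> \<le> C" "\<bar>grad (blow l i) z \<bullet> z\<bar> \<le> C" by linarith+
  qed
qed

text \<open>Euler's relation for the family: moving the parameter moves the point along its ray.
  Times \<open>l\<close>, this derivative is, up to a power of \<open>l\<close>, the expression that
  is squared in the final formula.\<close>

lemma blow_derivative: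
  assumes l: "l > 0" and i: "i < m" and z: "z \<in> upper"
  shows "((\<lambda>l. blow l i z) has_real_derivative (c * blow l i z + grad (blow l i) z \<bullet> z) / l) (at l)"
proof -
  have up: "x0 + l *\<^sub>R z \<in> upper" using upper_rescale(1)[OF x0 l] z by simp
  have "((\<lambda>l. l powr c * v i (x0 + l *\<^sub>R z)) has_real_derivative
     c * l powr (c - 1) * v i (x0 + l *\<^sub>R z) + partial (v i) z (x0 + l *\<^sub>R z) * l powr c) (at l)"
    by (rule DERIV_mult[OF has_real_derivative_powr[OF l] has_real_derivative_line[OF C2_onD(1)[OF C2[OF i] up]]])
  moreover have "c * l powr (c - 1) * v i (x0 + l *\<^sub>R z) + partial (v i) z (x0 + l *\<^sub>R z) * l powr c
     = (c * blow l i z + grad (blow l i) z \<bullet> z) / l"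
    unfolding grad_blow[OF l i z] partial_eq_grad_inner[OF C2_onD(1)[OF C2[OF i] up]]
    using l by (simp add: blow_def powr_diff field_simps)
  ultimately show ?thesis unfolding blow_def by simp
qed

text \<open>Mean value theorem in the parameter at interior points. No tangential derivative is
  available on the flat boundary itself, so the bound is carried there by letting y decrease to 0 at
  fixed x.\<close>

lemma blow_lipschitz:
  assumes l0: "l0 > 0"
  obtains C where "C > 0"
    "\<And>l l' i z. l0 / 2 \<le> l \<Longrightarrow> l \<le> 2 * l0 \<Longrightarrow> l0 / 2 \<le> l' \<Longrightarrow> l' \<le> 2 * l0 \<Longrightarrow> i < m \<Longrightarrow> z \<in> upper \<Longrightarrow> norm z \<le> 2 \<Longrightarrow>
       \<bar>blow l i z - blow l' i z\<bar> \<le> C * \<bar>l - l'\<bar>"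
    "\<And>l l' i x. l0 / 2 \<le> l \<Longrightarrow> l \<le> 2 * l0 \<Longrightarrow> l0 / 2 \<le> l' \<Longrightarrow> l' \<le> 2 * l0 \<Longrightarrow> i < m \<Longrightarrow> norm x \<le> 1 \<Longrightarrow>
       \<bar>blow l i (x, 0) - blow l' i (x, 0)\<bar> \<le> C * \<bar>l - l'\<bar>"
proof -
  obtain C0 where C0: "C0 > 0"
    "\<And>l i z. l0 / 2 \<le> l \<Longrightarrow> l \<le> 2 * l0 \<Longrightarrow> i < m \<Longrightarrow> z \<in> upper \<Longrightarrow> norm z \<le> 2 \<Longrightarrow> \<bar>blow l i z\<bar> \<le> C0"
    "\<And>l i z. l0 / 2 \<le> l \<Longrightarrow> l \<le> 2 * l0 \<Longrightarrow> i < m \<Longrightarrow> z \<in> upper \<Longrightarrow> norm z \<le> 2 \<Longrightarrow> \<bar>grad (blow l i) z \<bullet> z\<bar> \<le> C0"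
    by (rule blow_bounds[OF l0]) blast
  define C where "C = (c * C0 + C0) / (l0 / 2)"
  have C: "C > 0" using C0(1) c_pos l0 by (simp add: C_def add_pos_pos)
  have lt: "\<bar>blow l i z - blow l' i z\<bar> \<le> C * \<bar>l - l'\<bar>"
    if l: "l0 / 2 \<le> l" "l \<le> 2 * l0" "l0 / 2 \<le> l'" "l' \<le> 2 * l0" "l' < l" and i: "i < m" and z: "z \<in> upper" "norm z \<le> 2" for l l' i z
  proof -
    have "\<exists>t>l'. t < l \<and> blow l i z - blow l' i z = (l - l') * ((c * blow t i z + grad (blow t i) z \<bullet> z) / t)"
      by (rule MVT2[OF l(5)]) (use l l0 i z in \<open>auto intro!: blow_derivative\<close>)
    then obtain t where t: "l' < t" "t < l" "blow l i z - blow l' i z = (l - l') * ((c * blow t i z + grad (blow t i) z \<bullet> z) / t)" by blast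
    have tb: "l0 / 2 \<le> t" "t \<le> 2 * l0" using t l by auto
    have "\<bar>c * blow t i z + grad (blow t i) z \<bullet> z\<bar> \<le> c * \<bar>blow t i z\<bar> + \<bar>grad (blow t i) z \<bullet> z\<bar>"
      using abs_triangle_ineq[of "c * blow t i z" "grad (blow t i) z \<bullet> z"] c_pos by (simp add: abs_mult)
    also have "\<dots> \<le> c * C0 + C0"
      using C0(2,3)[OF tb i z] c_pos by (intro add_mono mult_left_mono) auto
    finally have "\<bar>c * blow t i z + grad (blow t i) z \<bullet> z\<bar> / t \<le> (c * C0 + C0) / (l0 / 2)"
      using tb l0 by (intro frac_le) auto
    then have "\<bar>(c * blow t i z + grad (blow t i) z \<bullet> z) / t\<bar> \<le> C" using tb l0 by (simp add: C_def)
    then have "\<bar>l - l'\<bar> * \<bar>(c * blow t i z + grad (blow t i) z \<bullet> z) / t\<bar> \<le> \<bar>l - l'\<bar> * C" by (rule mult_left_mono) simp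
    then show ?thesis unfolding t(3) abs_mult[of "l - l'"] by (simp only: mult.commute)
  qed
  have in1: "\<bar>blow l i z - blow l' i z\<bar> \<le> C * \<bar>l - l'\<bar>"
    if l: "l0 / 2 \<le> l" "l \<le> 2 * l0" "l0 / 2 \<le> l'" "l' \<le> 2 * l0" and i: "i < m" and z: "z \<in> upper" "norm z \<le> 2" for l l' i z
    using lt[OF l _ i z] lt[OF l(3,4,1,2) _ i z] by (cases l l' rule: linorder_cases) (auto simp: abs_minus_commute)
  show thesis
  proof (rule that[OF C in1])
    fix l l' i and x :: "real^'n"
    assume l: "l0 / 2 \<le> l" "l \<le> 2 * l0" "l0 / 2 \<le> l'" "l' \<le> 2 * l0" and i: "i < m" and x: "norm x \<le> 1"
    have lp: "l > 0" "l' > 0" using l l0 by auto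
    have ct: "continuous_on {0..} (\<lambda>y. blow r i (x, y))" if "r > 0" for r
      by (intro continuous_on_compose2[OF blow_continuous[OF that i]] continuous_intros) (auto simp: upper_cl_def)
    have "continuous_on {0..} (\<lambda>y. \<bar>blow l i (x, y) - blow l' i (x, y)\<bar>)"
      by (intro continuous_intros ct lp)
    then have "((\<lambda>y. \<bar>blow l i (x, y) - blow l' i (x, y)\<bar>) \<longlongrightarrow> \<bar>blow l i (x, 0) - blow l' i (x, 0)\<bar>) (at 0 within {0..})"
      unfolding continuous_on by simp
    then have "((\<lambda>y. \<bar>blow l i (x, y) - blow l' i (x, y)\<bar>) \<longlongrightarrow> \<bar>blow l i (x, 0) - blow l' i (x, 0)\<bar>) (at_right 0)"
      by (rule tendsto_mono[rotated]) (auto intro!: at_le)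
    moreover have "eventually (\<lambda>y. \<bar>blow l i (x, y) - blow l' i (x, y)\<bar> \<le> C * \<bar>l - l'\<bar>) (at_right 0)"
      unfolding eventually_at_right_field
    proof (intro exI[of _ 1] conjI allI impI)
      fix y :: real assume y: "0 < y" "y < 1"
      show "\<bar>blow l i (x, y) - blow l' i (x, y)\<bar> \<le> C * \<bar>l - l'\<bar>"
        by (rule in1[OF l i]) (use y x norm_Pair_le[of x y] in \<open>auto simp: upper_def\<close>)
    qed simp
    ultimately show "\<bar>blow l i (x, 0) - blow l' i (x, 0)\<bar> \<le> C * \<bar>l - l'\<bar>"
      by (intro tendsto_upperbound) auto
  qed
qed

end

context monotonicity
begin

lemma cone_integrable_flux:
  assumes "l > 0" "l' > 0" "i < m"
  shows "cone_integrable (\<lambda>z. blow l i z * (snd z powr (1 - 2 * s) * (grad (blow l' i) z \<bullet> z)))"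
proof -
  obtain g where g: "regular_solution (1 - 2 * s) (blow l i) g" using blow_regular[OF assms(1,3)] by blast
  obtain g' where g': "regular_solution (1 - 2 * s) (blow l' i) g'" using blow_regular[OF assms(2,3)] by blast
  obtain K where K: "K > 0" "\<And>z. z \<in> upper \<Longrightarrow> norm z \<le> 2 \<Longrightarrow>
      \<bar>blow l i z * (snd z powr (1 - 2 * s) * (grad (blow l' i) z \<bullet> z))\<bar> \<le> K * (1 + snd z powr (1 - 2 * s))"
    by (rule grad_products_bound[OF g g', of 2]) blast
  have contg: "continuous_on upper (grad (blow l' i))"
    by (intro C2_on_continuous_grad blow_C2 assms)
  show ?thesis
  proof (rule cone_integrableI[where K = K and a = "1 - 2 * s"])
    show "continuous_on upper (\<lambda>z. blow l i z * (snd z powr (1 - 2 * s) * (grad (blow l' i) z \<bullet> z)))"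
      by (intro continuous_intros contg C2_on_continuous(1)[OF blow_C2] assms) (auto simp: upper_def)
  qed (use s K in auto)
qed

lemma cone_integrable_square:
  assumes "l > 0" "i < m"
  shows "cone_integrable (\<lambda>z. snd z powr (1 - 2 * s) * (blow l i z)\<^sup>2)"
proof -
  obtain g where g: "regular_solution (1 - 2 * s) (blow l i) g" using blow_regular[OF assms] by blast
  obtain C where C: "C > 0" "\<And>z. z \<in> upper_cl \<Longrightarrow> norm z \<le> 2 \<Longrightarrow> \<bar>blow l i z\<bar> \<le> C"
    by (rule regular_solution_bounds[OF g, of 2]) blast
  show ?thesis
  proof (rule cone_integrableI[where K = "C\<^sup>2" and a = "1 - 2 * s"])
    show "continuous_on upper (\<lambda>z. snd z powr (1 - 2 * s) * (blow l i z)\<^sup>2)"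
      by (intro continuous_intros C2_on_continuous(1)[OF blow_C2] assms) (auto simp: upper_def)
    fix z :: "(real^'n) \<times> real" assume z: "z \<in> upper" "norm z \<le> 2"
    then have "\<bar>blow l i z\<bar> \<le> C" using C(2)[of z] upper_subset_cl by auto
    then have "\<bar>blow l i z\<bar>\<^sup>2 \<le> C\<^sup>2" by (rule power_mono) simp
    then have "(blow l i z)\<^sup>2 * snd z powr (1 - 2 * s) \<le> C\<^sup>2 * snd z powr (1 - 2 * s)"
      by (intro mult_right_mono) auto
    also have "\<dots> \<le> C\<^sup>2 * (1 + snd z powr (1 - 2 * s))" by (simp add: mult_left_mono)
    finally show "\<bar>snd z powr (1 - 2 * s) * (blow l i z)\<^sup>2\<bar> \<le> C\<^sup>2 * (1 + snd z powr (1 - 2 * s))"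
      by (simp add: abs_mult mult.commute)
  qed (use s in auto)
qed

lemma boundary_continuous:
  assumes "l > 0"
  shows "i < m \<Longrightarrow> continuous_on UNIV (\<lambda>x. blow l i (x, 0))"
    "q > 0 \<Longrightarrow> continuous_on UNIV (\<lambda>x. vnorm m (blow l) (x, 0) powr q)"
proof -
  show b: "continuous_on UNIV (\<lambda>x. blow l i (x, 0))" if "i < m" for i
    by (intro continuous_on_compose2[OF blow_continuous[OF assms that]] continuous_intros) (auto simp: upper_cl_def)
  show "continuous_on UNIV (\<lambda>x. vnorm m (blow l) (x, 0) powr q)" if "q > 0"
    unfolding vnorm_def by (intro continuous_on_powr' continuous_intros b) (use that in \<open>auto simp: sum_nonneg\<close>)
qed

text \<open>With w and u the two members, this is (w - u)(w_r + u_r) / 2 + (c/2)(w^2 - u^2), summed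
  and weighted: the polarised Dirichlet energy after Green's identity, and the difference of the
  surface terms. The common factor w - u is what permits division by l - l'.\<close>

definition sphere_term where
  "sphere_term l l' z = snd z powr (1 - 2 * s) * (\<Sum>i<m. (blow l i z - blow l' i z) *
     (1 / 2 * (grad (blow l i) z \<bullet> z + grad (blow l' i) z \<bullet> z) + s / (p - 1) * (blow l i z + blow l' i z)))"

text \<open>Trapezoidal approximation minus exact difference of the potential. The first is left on
  the flat boundary by Green's identity, the second comes from the energy.\<close>

definition boundary_term where
  "boundary_term l l' x = 1 / 2 * (\<Sum>i<m. (blow l i (x, 0) - blow l' i (x, 0)) *
       (vnorm m (blow l) (x, 0) powr (p - 1) * blow l i (x, 0) + vnorm m (blow l') (x, 0) powr (p - 1) * blow l' i (x, 0)))
     - (vnorm m (blow l) (x, 0) powr (p + 1) - vnorm m (blow l') (x, 0) powr (p + 1)) / (p + 1)"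

text \<open>
  With \<open>D(h,k)\<close> the Dirichlet form, \<open>D(w,w) - D(u,u) = D(w,w) + D(w,u) - D(u,w) - D(u,u)\<close>, and Green's
  identity is applied to each of the four terms.
\<close>

lemma energy_difference:
  assumes l: "l > 0" "l' > 0" and \<kappa>: "\<kappa> = kappa s"
  shows "Es s p m v l x0 - Es s p m v l' x0 =
     sphere_integral (\<lambda>z. indicator upper z * sphere_term l l' z) 0 1
     + \<kappa> * (LINT x:ball 0 1|lborel. boundary_term l l' x)"
proof -
  define D where "D = (\<lambda>a b i. LINT z:upper \<inter> ball 0 1|lborel. snd z powr (1 - 2 * s) * (grad (blow a i) z \<bullet> grad (blow b i) z))"
  define H where "H = (\<lambda>a b i z. blow a i z * (snd z powr (1 - 2 * s) * (grad (blow b i) z \<bullet> z)))"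
  define S where "S = (\<lambda>F :: (real^'n) \<times> real \<Rightarrow> real. sphere_integral (\<lambda>z. indicator upper z * F z) 0 1)"
  define b where "b = (\<lambda>a d i x. blow a i (x, 0) * (vnorm m (blow d) (x, 0) powr (p - 1) * blow d i (x, 0)))"
  define B where "B = (\<lambda>f :: real^'n \<Rightarrow> real. LINT x:ball 0 1|lborel. f x)"
  define P where "P = (\<lambda>a x. vnorm m (blow a) (x, 0) powr (p + 1))"
  define V where "V = (\<lambda>a i z. snd z powr (1 - 2 * s) * (blow a i z)\<^sup>2)"
  have gr: "D x y i = S (H x y i) + \<kappa> * B (b x y i)" if "x > 0" "y > 0" "i < m" for x y i
    unfolding D_def S_def H_def B_def b_def by (rule green_blow(2)[OF that])
  have Dsym: "D x y i = D y x i" for x y i by (simp add: D_def inner_commute)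
  have cH: "cone_integrable (H x y i)" if "x > 0" "y > 0" "i < m" for x y i
    unfolding H_def by (rule cone_integrable_flux[OF that])
  have cV: "cone_integrable (V x i)" if "x > 0" "i < m" for x i
    unfolding V_def by (rule cone_integrable_square[OF that])
  have ib: "set_integrable lborel (ball 0 1) (b x y i)" if "x > 0" "y > 0" "i < m" for x y i
    unfolding b_def by (intro set_integrable_unit_ball continuous_intros boundary_continuous) (use that p in auto)
  have iP: "set_integrable lborel (ball 0 1) (P x)" if "x > 0" for x
    unfolding P_def by (intro set_integrable_unit_ball boundary_continuous) (use that p in auto)
  have E: "Es s p m v x x0 = 1 / 2 * (\<Sum>i<m. D x x i) - \<kappa> / (p + 1) * B (P x) + s / (p - 1) * (\<Sum>i<m. S (V x i))" if x: "x > 0" for x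
  proof -
    have "(LINT z:upper \<inter> ball 0 1|lborel. snd z powr (1 - 2 * s) * (\<Sum>i<m. (norm (grad (blow x i) z))\<^sup>2))
       = (LINT z:upper \<inter> ball 0 1|lborel. (\<Sum>i<m. snd z powr (1 - 2 * s) * (grad (blow x i) z \<bullet> grad (blow x i) z)))"
      by (simp add: sum_distrib_left power2_norm_eq_inner)
    also have "\<dots> = (\<Sum>i<m. D x x i)"
      unfolding D_def set_lebesgue_integral_def scaleR_sum_right
      by (rule Bochner_Integration.integral_sum) (use green_blow(1)[OF x x] in \<open>auto simp: set_integrable_def\<close>)
    finally have e1: "(LINT z:upper \<inter> ball 0 1|lborel. snd z powr (1 - 2 * s) * (\<Sum>i<m. (norm (grad (blow x i) z))\<^sup>2)) = (\<Sum>i<m. D x x i)" .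
    have "(\<lambda>z. indicator upper z * (snd z powr (1 - 2 * s) * (vnorm m (blow x) z)\<^sup>2)) = (\<lambda>z. indicator upper z * (\<Sum>i<m. V x i z))"
      by (simp add: vnorm_def sum_nonneg V_def sum_distrib_left)
    then have e2: "sphere_integral (\<lambda>z. indicator upper z * (snd z powr (1 - 2 * s) * (vnorm m (blow x) z)\<^sup>2)) 0 1 = (\<Sum>i<m. S (V x i))"
      unfolding S_def by (simp only:) (rule cone_sum(2), use cV x in auto)
    show ?thesis unfolding Es_blow[OF x \<kappa>] e1 e2 by (simp add: B_def P_def)
  qed
  \<comment> \<open>Right-nested with explicit scalar factors, so that linearity of the surface
    integral applies summand by summand. The four terms in \<open>H\<close> combine to (w - u)(w_r +
    u_r) / 2 times the weight.\<close>
  define F where "F = (\<lambda>i z. 1 / 2 * H l l i z + (1 / 2 * H l l' i z + (- 1 / 2 * H l' l i z + (- 1 / 2 * H l' l' i z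
      + (s / (p - 1) * V l i z + (- s / (p - 1)) * V l' i z)))))"
  have F: "cone_integrable (F i)" "S (F i) = 1 / 2 * S (H l l i) + (1 / 2 * S (H l l' i) + (- 1 / 2 * S (H l' l i) + (- 1 / 2 * S (H l' l' i)
      + (s / (p - 1) * S (V l i) + (- s / (p - 1)) * S (V l' i)))))" if "i < m" for i
  proof -
    have hh: "cone_integrable (H l l i)" "cone_integrable (H l l' i)" "cone_integrable (H l' l i)" "cone_integrable (H l' l' i)"
      "cone_integrable (V l i)" "cone_integrable (V l' i)" using cH cV l that by auto
    show "cone_integrable (F i)" unfolding F_def by (intro cone_add(1) cone_cmult hh)
    show "S (F i) = 1 / 2 * S (H l l i) + (1 / 2 * S (H l l' i) + (- 1 / 2 * S (H l' l i) + (- 1 / 2 * S (H l' l' i)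
      + (s / (p - 1) * S (V l i) + (- s / (p - 1)) * S (V l' i)))))"
      unfolding F_def S_def by (simp only: cone_add cone_cmult sphere_integral_upper_cmult hh)
  qed
  have st: "sphere_term l l' = (\<lambda>z. \<Sum>i<m. F i z)"
    unfolding sphere_term_def[abs_def] sum_distrib_left
    by (intro ext sum.cong refl) (simp add: F_def H_def V_def algebra_simps power2_eq_square add_divide_distrib diff_divide_distrib)
  have "S (sphere_term l l') = (\<Sum>i<m. S (F i))"
    unfolding st S_def by (rule cone_sum(2)) (use F(1) in auto)
  also have "\<dots> = 1 / 2 * (\<Sum>i<m. S (H l l i) + S (H l l' i) - S (H l' l i) - S (H l' l' i))
      + s / (p - 1) * (\<Sum>i<m. S (V l i)) - s / (p - 1) * (\<Sum>i<m. S (V l' i))"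
    by (simp add: F(2) sum_distrib_left sum.distrib sum_subtractf sum_negf algebra_simps
        add_divide_distrib diff_divide_distrib sum_divide_distrib)
  finally have S: "S (sphere_term l l') = 1 / 2 * (\<Sum>i<m. S (H l l i) + S (H l l' i) - S (H l' l i) - S (H l' l' i))
      + s / (p - 1) * (\<Sum>i<m. S (V l i)) - s / (p - 1) * (\<Sum>i<m. S (V l' i))" .
  define f where "f = (\<lambda>i x. b l l i x + (b l l' i x + ((- 1) * b l' l i x + (- 1) * b l' l' i x)))"
  have Badd: "set_integrable lborel (ball 0 1) (\<lambda>x. g x + h x)" "B (\<lambda>x. g x + h x) = B g + B h"
    if "set_integrable lborel (ball 0 1) g" "set_integrable lborel (ball 0 1) h" for g h
    using set_integral_add[OF that] by (simp_all add: B_def)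
  have Bc: "set_integrable lborel (ball 0 1) (\<lambda>x. k * g x)" "B (\<lambda>x. k * g x) = k * B g"
    if "set_integrable lborel (ball 0 1) g" for g k
    using that by (auto simp: B_def)
  have f: "set_integrable lborel (ball 0 1) (f i)" "B (f i) = B (b l l i) + (B (b l l' i) + ((- 1) * B (b l' l i) + (- 1) * B (b l' l' i)))" if "i < m" for i
  proof -
    have hh: "set_integrable lborel (ball 0 1) (b l l i)" "set_integrable lborel (ball 0 1) (b l l' i)"
      "set_integrable lborel (ball 0 1) (b l' l i)" "set_integrable lborel (ball 0 1) (b l' l' i)" using ib l that by auto
    show "set_integrable lborel (ball 0 1) (f i)" unfolding f_def by (intro Badd(1) Bc(1) hh)
    show "B (f i) = B (b l l i) + (B (b l l' i) + ((- 1) * B (b l' l i) + (- 1) * B (b l' l' i)))"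
      unfolding f_def by (simp only: Badd Bc hh)
  qed
  have fs: "set_integrable lborel (ball 0 1) (\<lambda>x. \<Sum>i<m. f i x)" "B (\<lambda>x. \<Sum>i<m. f i x) = (\<Sum>i<m. B (f i))"
  proof -
    have fi: "integrable lborel (\<lambda>x. indicator (ball 0 1) x *\<^sub>R f i x)" if "i \<in> {..<m}" for i
      using f(1)[of i] that by (simp add: set_integrable_def)
    show "set_integrable lborel (ball 0 1) (\<lambda>x. \<Sum>i<m. f i x)"
      unfolding set_integrable_def scaleR_sum_right by (rule Bochner_Integration.integrable_sum[OF fi])
    show "B (\<lambda>x. \<Sum>i<m. f i x) = (\<Sum>i<m. B (f i))"
      unfolding B_def set_lebesgue_integral_def scaleR_sum_right by (rule Bochner_Integration.integral_sum[OF fi])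
  qed
  have bt: "boundary_term l l' = (\<lambda>x. 1 / 2 * (\<Sum>i<m. f i x) + ((- 1 / (p + 1)) * P l x + 1 / (p + 1) * P l' x))"
    unfolding boundary_term_def[abs_def]
    by (rule ext) (simp add: f_def b_def P_def algebra_simps diff_divide_distrib)
  have Bb: "B (boundary_term l l') = 1 / 2 * (\<Sum>i<m. B (f i)) + ((- 1 / (p + 1)) * B (P l) + 1 / (p + 1) * B (P l'))"
    unfolding bt using l by (simp only: Badd Bc fs iP)
  have sumf: "(\<Sum>i<m. B (f i)) = (\<Sum>i<m. B (b l l i) + B (b l l' i) - B (b l' l i) - B (b l' l' i))"
    by (rule sum.cong) (auto simp: f(2))
  \<comment> \<open>The inserted mixed terms cancel by symmetry of the form, although Green's
    identity represents them by different surface and flat integrals.\<close>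
  have "(\<Sum>i<m. D l l i) - (\<Sum>i<m. D l' l' i) = (\<Sum>i<m. D l l i + D l l' i - D l' l i - D l' l' i)"
    unfolding sum_subtractf[symmetric] by (intro sum.cong refl) (simp add: Dsym[of l l'])
  also have "\<dots> = (\<Sum>i<m. (S (H l l i) + S (H l l' i) - S (H l' l i) - S (H l' l' i))
      + \<kappa> * (B (b l l i) + B (b l l' i) - B (b l' l i) - B (b l' l' i)))"
    by (intro sum.cong refl) (simp add: gr l algebra_simps)
  also have "\<dots> = (\<Sum>i<m. S (H l l i) + S (H l l' i) - S (H l' l i) - S (H l' l' i)) + \<kappa> * (\<Sum>i<m. B (f i))"
    unfolding sumf by (simp only: sum.distrib sum_distrib_left)
  finally have DD: "(\<Sum>i<m. D l l i) - (\<Sum>i<m. D l' l' i) = \<dots>" .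
  have "Es s p m v l x0 - Es s p m v l' x0 = 1 / 2 * ((\<Sum>i<m. D l l i) - (\<Sum>i<m. D l' l' i))
     + \<kappa> * ((- 1 / (p + 1)) * B (P l) + 1 / (p + 1) * B (P l')) + s / (p - 1) * (\<Sum>i<m. S (V l i)) - s / (p - 1) * (\<Sum>i<m. S (V l' i))"
    unfolding E[OF l(1)] E[OF l(2)] by (simp add: algebra_simps)
  also have "\<dots> = S (sphere_term l l') + \<kappa> * B (boundary_term l l')"
    unfolding S Bb DD by (simp only: distrib_left)
  finally show ?thesis by (simp add: S_def B_def)
qed

end

section \<open>Difference quotients of the energy and their limit\<close>

context monotonicity
begin

lemma boundary_bound:
  assumes l: "l > 0"
  obtains B where "B > 0" "\<And>i x. i < m \<Longrightarrow> norm x \<le> 1 \<Longrightarrow> \<bar>blow l i (x, 0)\<bar> \<le> B"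
proof -
  have "\<exists>B. \<forall>x. norm x \<le> 1 \<longrightarrow> \<bar>blow l i (x, 0)\<bar> \<le> B" if "i \<in> {..<m}" for i
  proof -
    have i: "i < m" using that by simp
    obtain B where "\<And>x. x \<in> cball 0 1 \<Longrightarrow> norm (blow l i (x, 0)) \<le> B"
      by (rule continuous_on_compact_bound[OF compact_cball continuous_on_subset[OF boundary_continuous(1)[OF l i] subset_UNIV], of 0 1]) blast
    then show ?thesis by (intro exI[of _ B]) simp
  qed
  then have "\<exists>B>0. \<forall>i\<in>{..<m}. \<forall>x. norm x \<le> 1 \<longrightarrow> \<bar>blow l i (x, 0)\<bar> \<le> B"
    by (rule finite_uniform_bound[OF finite_lessThan])
  then show thesis using that by blast
qed

lemma L2_set_le:
  assumes "\<And>j. j < m \<Longrightarrow> \<bar>w j\<bar> \<le> C"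
  shows "L2_set w {..<m} \<le> real m * C"
proof -
  have "L2_set w {..<m} \<le> (\<Sum>j<m. \<bar>w j\<bar>)" by (rule L2_set_le_sum_abs)
  also have "\<dots> \<le> (\<Sum>j<m. C)" by (rule sum_mono) (use assms in auto)
  finally show ?thesis by simp
qed

text \<open>On the flat disc the two members differ by at most C |l - l0|, and the trapezoidal error
  is quadratic in that. Both are bounded by the fixed member plus C l0, since |l - l0| \<le> l0 in
  the range considered.\<close>

lemma boundary_term_integral_bound:
  assumes l0: "l0 > 0"
  obtains M where "M \<ge> 0" "\<And>l. l0 / 2 \<le> l \<Longrightarrow> l \<le> 2 * l0 \<Longrightarrow>
     \<bar>LINT x:ball 0 1|lborel. boundary_term l l0 x\<bar> \<le> M * \<bar>l - l0\<bar>\<^sup>2"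
proof -
  obtain B0 where B0: "B0 > 0" "\<And>i x. i < m \<Longrightarrow> norm x \<le> 1 \<Longrightarrow> \<bar>blow l0 i (x, 0)\<bar> \<le> B0"
    by (rule boundary_bound[OF l0]) blast
  obtain C where C: "C > 0"
    "\<And>l l' i x. l0 / 2 \<le> l \<Longrightarrow> l \<le> 2 * l0 \<Longrightarrow> l0 / 2 \<le> l' \<Longrightarrow> l' \<le> 2 * l0 \<Longrightarrow> i < m \<Longrightarrow> norm x \<le> 1 \<Longrightarrow>
       \<bar>blow l i (x, 0) - blow l' i (x, 0)\<bar> \<le> C * \<bar>l - l'\<bar>"
    by (rule blow_lipschitz[OF l0]) blast
  define B where "B = real m * (B0 + C * l0)"
  define M1 where "M1 = real m * ((p + 1) * (3 * B) powr (p - 1)) * (real m * C)\<^sup>2"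
  define M where "M = M1 * measure lborel (cball (0::real^'n) 1)"
  have M1: "M1 \<ge> 0" using p by (simp add: M1_def)
  show thesis
  proof (rule that)
    show "M \<ge> 0" using M1 by (simp add: M_def)
    fix l assume l: "l0 / 2 \<le> l" "l \<le> 2 * l0"
    have lp: "l > 0" using l l0 by simp
    have dl: "\<bar>l - l0\<bar> \<le> l0" using l l0 by (auto simp: abs_le_iff)
    have bt: "\<bar>boundary_term l l0 x\<bar> \<le> M1 * \<bar>l - l0\<bar>\<^sup>2" if x: "norm x \<le> 1" for x
    proof -
      let ?w = "\<lambda>i. blow l i (x, 0)" and ?u = "\<lambda>i. blow l0 i (x, 0)"
      have d: "\<bar>?w i - ?u i\<bar> \<le> C * \<bar>l - l0\<bar>" if "i < m" for i
        by (rule C(2)) (use l l0 that x in auto)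
      have d': "C * \<bar>l - l0\<bar> \<le> C * l0" using dl C(1) by simp
      have uB: "L2_set ?u {..<m} \<le> B"
        unfolding B_def using B0(2)[OF _ x] C(1) l0 by (intro L2_set_le) (auto intro: add_increasing2)
      have wB: "L2_set ?w {..<m} \<le> B"
        unfolding B_def
      proof (rule L2_set_le)
        fix j assume j: "j < m"
        show "\<bar>?w j\<bar> \<le> B0 + C * l0" using B0(2)[OF j x] d[OF j] d' by linarith
      qed
      have L: "L2_set (\<lambda>i. ?w i - ?u i) {..<m} \<le> real m * (C * \<bar>l - l0\<bar>)"
        by (rule L2_set_le) (rule d)
      have v: "vnorm m (blow r) (x, 0) = L2_set (\<lambda>i. blow r i (x, 0)) {..<m}" for r
        by (simp add: vnorm_def L2_set_def)
      have "\<bar>boundary_term l l0 x\<bar> \<le> real m * ((p + 1) * (3 * B) powr (p - 1)) * (L2_set (\<lambda>i. ?w i - ?u i) {..<m})\<^sup>2"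
        unfolding boundary_term_def v by (rule trapezoid_error[OF p uB wB])
      also have "\<dots> \<le> real m * ((p + 1) * (3 * B) powr (p - 1)) * (real m * (C * \<bar>l - l0\<bar>))\<^sup>2"
        using p L by (intro mult_left_mono power_mono L2_set_nonneg) auto
      also have "\<dots> = M1 * \<bar>l - l0\<bar>\<^sup>2" by (simp add: M1_def power_mult_distrib)
      finally show ?thesis .
    qed
    have cb: "continuous_on UNIV (boundary_term l l0)"
      unfolding boundary_term_def[abs_def]
      by (intro continuous_on_diff continuous_on_mult continuous_on_const continuous_on_sum continuous_on_add
          continuous_on_divide boundary_continuous) (use p lp l0 in auto)
    have "norm (LINT x|lborel. indicator (ball 0 1) x *\<^sub>R boundary_term l l0 x) \<le>
       (LINT x|lborel. (M1 * \<bar>l - l0\<bar>\<^sup>2) * indicator (cball (0::real^'n) 1) x)"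
    proof (rule Bochner_Integration.integral_norm_bound_integral)
      show "integrable lborel (\<lambda>x. indicator (ball 0 1) x *\<^sub>R boundary_term l l0 x)"
        using set_integrable_unit_ball[OF cb] by (simp add: set_integrable_def)
      show "integrable lborel (\<lambda>x::real^'n. (M1 * \<bar>l - l0\<bar>\<^sup>2) * indicator (cball 0 1) x)"
        by (intro integrable_mult_right integrable_indicator_cball)
      fix x :: "real^'n"
      show "norm (indicator (ball 0 1) x *\<^sub>R boundary_term l l0 x) \<le> (M1 * \<bar>l - l0\<bar>\<^sup>2) * indicator (cball 0 1) x"
        using bt[of x] M1 by (cases "norm x < 1") auto
    qed
    also have "\<dots> = (M1 * \<bar>l - l0\<bar>\<^sup>2) * measure lborel (cball (0::real^'n) 1)"
      by (simp only: integral_mult_right_zero) simp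
    finally show "\<bar>LINT x:ball 0 1|lborel. boundary_term l l0 x\<bar> \<le> M * \<bar>l - l0\<bar>\<^sup>2"
      by (simp add: set_lebesgue_integral_def M_def mult_ac)
  qed
qed

text \<open>The weighted square of \<open>l\<close> times the parameter derivative of the
  family.\<close>

definition limit_term where
  "limit_term l z = snd z powr (1 - 2 * s) * (\<Sum>i<m. (grad (blow l i) z \<bullet> z + c * blow l i z)\<^sup>2)"

lemma grad_blow_tendsto:
  assumes l0: "l0 > 0" and X: "X \<longlonglongrightarrow> l0" "\<And>n. X n > 0" and i: "i < m" and z: "z \<in> upper"
  shows "(\<lambda>n. grad (blow (X n) i) z \<bullet> z) \<longlonglongrightarrow> grad (blow l0 i) z \<bullet> z"
proof -
  have up: "x0 + l *\<^sub>R z \<in> upper" if "l > 0" for l using upper_rescale(1)[OF x0 that] z by simp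
  have "continuous_on upper (grad (v i))"
    by (rule C2_on_continuous_grad[OF C2[OF i]])
  then have "isCont (grad (v i)) (x0 + l0 *\<^sub>R z)"
    using continuous_on_eq_continuous_at[OF open_upper] up[OF l0] by blast
  then have "(\<lambda>n. grad (v i) (x0 + X n *\<^sub>R z)) \<longlonglongrightarrow> grad (v i) (x0 + l0 *\<^sub>R z)"
    by (rule isCont_tendsto_compose) (intro tendsto_intros X)
  then have "(\<lambda>n. ((X n powr c * X n) *\<^sub>R grad (v i) (x0 + X n *\<^sub>R z)) \<bullet> z) \<longlonglongrightarrow> ((l0 powr c * l0) *\<^sub>R grad (v i) (x0 + l0 *\<^sub>R z)) \<bullet> z"
    using l0 by (intro tendsto_intros X) auto
  then show ?thesis by (simp only: grad_blow[OF X(2) i z] grad_blow[OF l0 i z])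
qed

text \<open>The quotient of w - u by the parameter difference is bounded by the Lipschitz constant
  and tends to (c w + w_r) / l0. The other factor is bounded and tends to w_r + c w, since 2 s/(p-1)
  = c. The product is the square, and the weight alone serves as majorant on the cone.\<close>

lemma sphere_term_limit:
  assumes l0: "l0 > 0" and X: "X \<longlonglongrightarrow> l0" "\<And>n. l0 / 2 < X n" "\<And>n. X n < 2 * l0" "\<And>n. X n \<noteq> l0"
  shows "(\<lambda>n. sphere_integral (\<lambda>z. indicator upper z * (1 / (X n - l0) * sphere_term (X n) l0 z)) 0 1)
    \<longlonglongrightarrow> sphere_integral (\<lambda>z. indicator upper z * (1 / l0 * limit_term l0 z)) 0 1"
proof -
  have Xp: "X n > 0" for n using X(2)[of n] l0 by simp
  have a: "-1 < 1 - 2 * s" "1 - 2 * s < 1" using s by auto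
  obtain C0 where C0: "C0 > 0"
    "\<And>l i z. l0 / 2 \<le> l \<Longrightarrow> l \<le> 2 * l0 \<Longrightarrow> i < m \<Longrightarrow> z \<in> upper \<Longrightarrow> norm z \<le> 2 \<Longrightarrow> \<bar>blow l i z\<bar> \<le> C0"
    "\<And>l i z. l0 / 2 \<le> l \<Longrightarrow> l \<le> 2 * l0 \<Longrightarrow> i < m \<Longrightarrow> z \<in> upper \<Longrightarrow> norm z \<le> 2 \<Longrightarrow> \<bar>grad (blow l i) z \<bullet> z\<bar> \<le> C0"
    by (rule blow_bounds[OF l0]) blast
  obtain C1 where C1: "C1 > 0"
    "\<And>l l' i z. l0 / 2 \<le> l \<Longrightarrow> l \<le> 2 * l0 \<Longrightarrow> l0 / 2 \<le> l' \<Longrightarrow> l' \<le> 2 * l0 \<Longrightarrow> i < m \<Longrightarrow> z \<in> upper \<Longrightarrow> norm z \<le> 2 \<Longrightarrow>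
       \<bar>blow l i z - blow l' i z\<bar> \<le> C1 * \<bar>l - l'\<bar>"
    by (rule blow_lipschitz[OF l0]) blast
  define Fn where "Fn = (\<lambda>n z. 1 / (X n - l0) * sphere_term (X n) l0 z)"
  define q where "q = (\<lambda>n i z. (blow (X n) i z - blow l0 i z) / (X n - l0))"
  define g where "g = (\<lambda>n i z. 1 / 2 * (grad (blow (X n) i) z \<bullet> z + grad (blow l0 i) z \<bullet> z) + s / (p - 1) * (blow (X n) i z + blow l0 i z))"
  have Fq: "Fn n z = snd z powr (1 - 2 * s) * (\<Sum>i<m. q n i z * g n i z)" for n z
    by (simp add: Fn_def sphere_term_def q_def g_def sum_distrib_left mult_ac)
  define K where "K = real m * (C1 * (C0 + c * C0))"
  have K: "K \<ge> 0" using C0 C1 c_pos by (simp add: K_def)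
  have Fb: "\<bar>Fn n z\<bar> \<le> K * (1 + snd z powr (1 - 2 * s))" if z: "z \<in> upper" "norm z \<le> 2" for n z
  proof -
    have "\<bar>\<Sum>i<m. q n i z * g n i z\<bar> \<le> (\<Sum>i<m. C1 * (C0 + c * C0))"
    proof (rule order_trans[OF sum_abs], rule sum_mono)
      fix i assume "i \<in> {..<m}"
      then have i: "i < m" by simp
      have X2: "l0 / 2 \<le> X n" "X n \<le> 2 * l0" "l0 / 2 \<le> l0" "l0 \<le> 2 * l0" using X(2,3)[of n] l0 by auto
      have "\<bar>q n i z\<bar> \<le> C1"
        using C1(2)[OF X2 i z] X(4)[of n] by (simp add: q_def abs_divide pos_divide_le_eq)
      moreover have "\<bar>g n i z\<bar> \<le> C0 + c * C0"
      proof -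
        have "\<bar>grad (blow (X n) i) z \<bullet> z + grad (blow l0 i) z \<bullet> z\<bar> \<le> 2 * C0"
          using C0(3)[OF X2(1,2) i z] C0(3)[OF X2(3,4) i z] by linarith
        then have g1: "\<bar>1 / 2 * (grad (blow (X n) i) z \<bullet> z + grad (blow l0 i) z \<bullet> z)\<bar> \<le> C0" by simp
        have "\<bar>blow (X n) i z + blow l0 i z\<bar> \<le> 2 * C0"
          using C0(2)[OF X2(1,2) i z] C0(2)[OF X2(3,4) i z] by linarith
        then have "s / (p - 1) * \<bar>blow (X n) i z + blow l0 i z\<bar> \<le> s / (p - 1) * (2 * C0)"
          using s p by (intro mult_left_mono) auto
        also have "\<dots> = c * C0" by (simp add: c_def)
        finally have g2: "\<bar>s / (p - 1) * (blow (X n) i z + blow l0 i z)\<bar> \<le> c * C0"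
          using s p by (simp add: abs_mult)
        show ?thesis unfolding g_def using g1 g2 abs_triangle_ineq order_trans add_mono by meson
      qed
      ultimately show "\<bar>q n i z * g n i z\<bar> \<le> C1 * (C0 + c * C0)"
        unfolding abs_mult using C1(1) by (intro mult_mono) auto
    qed
    then have "snd z powr (1 - 2 * s) * \<bar>\<Sum>i<m. q n i z * g n i z\<bar> \<le> snd z powr (1 - 2 * s) * K"
      by (intro mult_left_mono) (auto simp: K_def)
    also have "\<dots> \<le> K * (1 + snd z powr (1 - 2 * s))" using K by (simp add: distrib_left mult.commute)
    finally show ?thesis unfolding Fq abs_mult by simp
  qed
  have contb: "continuous_on upper (blow l i)" "continuous_on upper (\<lambda>z. grad (blow l i) z \<bullet> z)" if "l > 0" "i < m" for l i
  proof -
    show "continuous_on upper (blow l i)" by (rule C2_on_continuous(1)[OF blow_C2[OF that]])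
    have "continuous_on upper (grad (blow l i))"
      by (intro C2_on_continuous_grad blow_C2 that)
    then show "continuous_on upper (\<lambda>z. grad (blow l i) z \<bullet> z)" by (intro continuous_intros)
  qed
  have Fc: "continuous_on upper (Fn n)" for n
    unfolding Fn_def sphere_term_def
    by (intro continuous_intros contb Xp l0) (auto simp: upper_def)
  have Lc: "continuous_on upper (\<lambda>z. 1 / l0 * limit_term l0 z)"
    unfolding limit_term_def
    by (intro continuous_intros contb l0) (auto simp: upper_def)
  have lim: "(\<lambda>n. Fn n z) \<longlonglongrightarrow> 1 / l0 * limit_term l0 z" if z: "z \<in> upper" for z
  proof -
    have qg: "(\<lambda>n. q n i z * g n i z) \<longlonglongrightarrow> (c * blow l0 i z + grad (blow l0 i) z \<bullet> z) / l0 *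
       (1 / 2 * (grad (blow l0 i) z \<bullet> z + grad (blow l0 i) z \<bullet> z) + s / (p - 1) * (blow l0 i z + blow l0 i z))" if i: "i < m" for i
    proof -
      have D: "((\<lambda>l. blow l i z) has_real_derivative (c * blow l0 i z + grad (blow l0 i) z \<bullet> z) / l0) (at l0)"
        by (rule blow_derivative[OF l0 i z])
      have "((\<lambda>l. (blow l i z - blow l0 i z) / (l - l0)) \<longlongrightarrow> (c * blow l0 i z + grad (blow l0 i) z \<bullet> z) / l0) (at l0)"
        using D by (simp add: has_field_derivative_iff)
      then have qi: "(\<lambda>n. q n i z) \<longlonglongrightarrow> (c * blow l0 i z + grad (blow l0 i) z \<bullet> z) / l0"
        unfolding q_def by (rule filterlim_compose) (use X(1,4) in \<open>auto simp: filterlim_at\<close>)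
      have bi: "(\<lambda>n. blow (X n) i z) \<longlonglongrightarrow> blow l0 i z"
        by (rule isCont_tendsto_compose[OF DERIV_isCont[OF D] X(1)])
      show ?thesis unfolding g_def
        by (intro tendsto_mult tendsto_add tendsto_const qi bi grad_blow_tendsto[OF l0 X(1) Xp i z])
    qed
    have "(\<lambda>n. Fn n z) \<longlonglongrightarrow> snd z powr (1 - 2 * s) * (\<Sum>i<m. (c * blow l0 i z + grad (blow l0 i) z \<bullet> z) / l0 *
       (1 / 2 * (grad (blow l0 i) z \<bullet> z + grad (blow l0 i) z \<bullet> z) + s / (p - 1) * (blow l0 i z + blow l0 i z)))"
      unfolding Fq by (intro tendsto_mult[OF tendsto_const] tendsto_sum qg) simp
    also have "(\<Sum>i<m. (c * blow l0 i z + grad (blow l0 i) z \<bullet> z) / l0 *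
       (1 / 2 * (grad (blow l0 i) z \<bullet> z + grad (blow l0 i) z \<bullet> z) + s / (p - 1) * (blow l0 i z + blow l0 i z)))
      = 1 / l0 * (\<Sum>i<m. (grad (blow l0 i) z \<bullet> z + c * blow l0 i z)\<^sup>2)"
      unfolding sum_distrib_left
    proof (rule sum.cong[OF refl])
      fix i
      have "1 / 2 * (grad (blow l0 i) z \<bullet> z + grad (blow l0 i) z \<bullet> z) + s / (p - 1) * (blow l0 i z + blow l0 i z)
         = grad (blow l0 i) z \<bullet> z + c * blow l0 i z" by (simp add: c_def)
      then show "(c * blow l0 i z + grad (blow l0 i) z \<bullet> z) / l0 *
       (1 / 2 * (grad (blow l0 i) z \<bullet> z + grad (blow l0 i) z \<bullet> z) + s / (p - 1) * (blow l0 i z + blow l0 i z))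
        = 1 / l0 * (grad (blow l0 i) z \<bullet> z + c * blow l0 i z)\<^sup>2"
        by (simp only: power2_eq_square) (simp add: add.commute)
    qed
    finally show ?thesis by (simp add: limit_term_def mult_ac)
  qed
  have "(\<lambda>n. LINT z|lborel. cone_integrand (Fn n) 1 z)
     \<longlonglongrightarrow> (LINT z|lborel. cone_integrand (\<lambda>z. 1 / l0 * limit_term l0 z) 1 z)"
  proof (rule integral_dominated_convergence)
    show "integrable lborel (\<lambda>z :: (real^'n) \<times> real. K * cone_weight (1 - 2 * s) z)"
      by (intro integrable_mult_right cone_weight_integrable a)
    show "(\<lambda>z. cone_integrand (Fn n) 1 z) \<in> borel_measurable lborel" for n
      using cone_integrand_measurable[OF Fc, of 1] by simp
    show "(\<lambda>z. cone_integrand (\<lambda>z. 1 / l0 * limit_term l0 z) 1 z) \<in> borel_measurable lborel"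
      using cone_integrand_measurable[OF Lc, of 1] by simp
    show "AE z in lborel. norm (cone_integrand (Fn n) 1 z) \<le> K * cone_weight (1 - 2 * s) z" for n
      unfolding real_norm_def by (rule AE_I2) (rule cone_integrand_bound[OF a K Fb], simp_all)
    show "AE z in lborel. (\<lambda>n. cone_integrand (Fn n) 1 z)
       \<longlonglongrightarrow> cone_integrand (\<lambda>z. 1 / l0 * limit_term l0 z) 1 z"
    proof (rule AE_I2)
      fix z :: "(real^'n) \<times> real"
      show "(\<lambda>n. cone_integrand (Fn n) 1 z)
       \<longlonglongrightarrow> cone_integrand (\<lambda>z. 1 / l0 * limit_term l0 z) 1 z"
      proof (cases "1 *\<^sub>R (z /\<^sub>R norm z) \<in> upper")
        case True
        show ?thesis by (intro tendsto_mult tendsto_const lim[OF True])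
      next
        case False
        then have "indicator upper (1 *\<^sub>R (z /\<^sub>R norm z)) = (0::real)" by (rule indicator_simps)
        then show ?thesis by (simp only: mult_zero_left mult_zero_right tendsto_const)
      qed
    qed
  qed
  then show ?thesis unfolding sphere_integral_upper Fn_def by (intro tendsto_mult tendsto_const)
qed

text \<open>Exponents: 2c + 2s - n from the prefactor, n from the surface measure, 1 - 2s from the
  weight and -(2c + 2) from the square relative to the blow-up add up to -1, the factor 1 /
  l.\<close>

lemma target_rescale:
  assumes l: "l > 0"
  shows "l powr (2 * s * (p + 1) / (p - 1) - real CARD('n)) *
     sphere_integral (\<lambda>z. indicator upper z * (snd z powr (1 - 2 * s) *
        (\<Sum>i<m. (partial (v i) ((z - x0) /\<^sub>R norm (z - x0)) z + 2 * s / (p - 1) * v i z / norm (z - x0))\<^sup>2))) x0 l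
   = sphere_integral (\<lambda>z. indicator upper z * (1 / l * limit_term l z)) 0 1"
proof -
  define n where "n = CARD('n)"
  define k where "k = l powr (1 - 2 * s - (2 * c + 2))"
  have pw: "l ^ k = l powr real k" for k using l by (simp add: powr_realpow)
  have D: "DIM((real^'n) \<times> real) - 1 = n" by (simp add: n_def)
  have "sphere_integral (\<lambda>z. indicator upper z * (snd z powr (1 - 2 * s) *
        (\<Sum>i<m. (partial (v i) ((z - x0) /\<^sub>R norm (z - x0)) z + 2 * s / (p - 1) * v i z / norm (z - x0))\<^sup>2))) x0 l
     = l ^ (DIM((real^'n) \<times> real) - 1) * k * sphere_integral (\<lambda>z. indicator upper z * limit_term l z) 0 1"
  proof (rule sphere_integral_rescale)
    fix z :: "(real^'n) \<times> real" assume nz: "norm z = 1"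
    show "indicator upper (x0 + l *\<^sub>R z) * (snd (x0 + l *\<^sub>R z) powr (1 - 2 * s) *
        (\<Sum>i<m. (partial (v i) ((x0 + l *\<^sub>R z - x0) /\<^sub>R norm (x0 + l *\<^sub>R z - x0)) (x0 + l *\<^sub>R z)
           + 2 * s / (p - 1) * v i (x0 + l *\<^sub>R z) / norm (x0 + l *\<^sub>R z - x0))\<^sup>2))
      = k * (indicator upper z * limit_term l z)"
    proof (cases "z \<in> upper")
      case True
      then have up: "x0 + l *\<^sub>R z \<in> upper" using upper_rescale(1)[OF x0 l] by simp
      have dir: "(x0 + l *\<^sub>R z - x0) /\<^sub>R norm (x0 + l *\<^sub>R z - x0) = z" "norm (x0 + l *\<^sub>R z - x0) = l"
        using nz l by auto
      have ll: "(l powr c * l)\<^sup>2 = l powr (2 * c + 2)"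
      proof -
        have "(l powr c * l)\<^sup>2 = (l powr (c + 1)) powr 2" using l by (simp add: powr_add powr_numeral)
        then show ?thesis by (simp add: powr_powr algebra_simps)
      qed
      have "(grad (blow l i) z \<bullet> z + c * blow l i z)\<^sup>2 = l powr (2 * c + 2) *
         (partial (v i) z (x0 + l *\<^sub>R z) + 2 * s / (p - 1) * v i (x0 + l *\<^sub>R z) / l)\<^sup>2" if i: "i < m" for i
      proof -
        have "grad (blow l i) z \<bullet> z + c * blow l i z = (l powr c * l) *
          (partial (v i) z (x0 + l *\<^sub>R z) + 2 * s / (p - 1) * v i (x0 + l *\<^sub>R z) / l)"
          unfolding grad_blow[OF l i True] partial_eq_grad_inner[OF C2_onD(1)[OF C2[OF i] up]] c_def[symmetric]
          using l by (simp add: blow_def field_simps)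
        then show ?thesis by (simp only: power_mult_distrib[of "l powr c * l"] ll)
      qed
      moreover define Z where "Z = (\<Sum>i<m. (partial (v i) z (x0 + l *\<^sub>R z) + 2 * s / (p - 1) * v i (x0 + l *\<^sub>R z) / l)\<^sup>2)"
      ultimately have lt: "limit_term l z = snd z powr (1 - 2 * s) * (l powr (2 * c + 2) * Z)"
        by (simp add: limit_term_def sum_distrib_left)
      have kl: "k * l powr (2 * c + 2) = l powr (1 - 2 * s)"
        by (simp add: k_def powr_add[symmetric])
      have sy: "snd (x0 + l *\<^sub>R z) powr (1 - 2 * s) = l powr (1 - 2 * s) * snd z powr (1 - 2 * s)"
        using x0 l by (simp add: powr_mult)
      have "k * limit_term l z = (k * l powr (2 * c + 2)) * snd z powr (1 - 2 * s) * Z"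
        unfolding lt by (simp only: mult_ac)
      then have "k * limit_term l z = snd (x0 + l *\<^sub>R z) powr (1 - 2 * s) * Z"
        unfolding kl sy .
      then show ?thesis unfolding dir(1) unfolding dir(2) Z_def[symmetric] indicator_simps(1)[OF up] indicator_simps(1)[OF True]
        by simp
    next
      case False
      then have "x0 + l *\<^sub>R z \<notin> upper" using upper_rescale(1)[OF x0 l] by simp
      then show ?thesis using False by simp
    qed
  qed
  moreover have "l powr (2 * s * (p + 1) / (p - 1) - real n) * (l ^ n * k) = 1 / l"
  proof -
    have "l powr (2 * s * (p + 1) / (p - 1) - real n) * (l ^ n * k)
      = l powr (2 * c + 2 * s - real n + (real n + (1 - 2 * s - (2 * c + 2))))"
      unfolding c_p(3) k_def pw by (simp only: powr_add)
    also have "2 * c + 2 * s - real n + (real n + (1 - 2 * s - (2 * c + 2))) = - 1" by simp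
    finally show ?thesis using l by (simp add: powr_minus_divide)
  qed
  ultimately show ?thesis unfolding D n_def[symmetric] sphere_integral_upper_cmult by (simp add: mult.assoc[symmetric])
qed

text \<open>In the quotient the flat part is O(|l - l0|) and disappears, while the surface part
  converges along every sequence. The interval from l0/2 to 2 l0 is where the uniform bounds hold,
  and it is a neighbourhood of \<open>l0\<close>.\<close>

lemma energy_derivative:
  assumes l0: "l0 > 0" and \<kappa>: "\<kappa> = kappa s"
  shows "((\<lambda>l. Es s p m v l x0) has_real_derivative
     sphere_integral (\<lambda>z. indicator upper z * (1 / l0 * limit_term l0 z)) 0 1) (at l0)" (is "(?E has_real_derivative ?D) _")
proof -
  have "((\<lambda>l. (?E l - ?E l0) / (l - l0)) \<longlongrightarrow> ?D) (at l0 within {l0 / 2<..<2 * l0})"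
    unfolding tendsto_at_iff_sequentially
  proof (intro allI impI)
    fix X assume X0: "\<forall>n. X n \<in> {l0 / 2<..<2 * l0} - {l0}" and Xl: "X \<longlonglongrightarrow> l0"
    have X: "l0 / 2 < X n" "X n < 2 * l0" "X n \<noteq> l0" "X n > 0" for n
      using X0 l0 by (auto intro: less_trans[of 0 "l0 / 2"])
    obtain M where M: "M \<ge> 0" "\<And>l. l0 / 2 \<le> l \<Longrightarrow> l \<le> 2 * l0 \<Longrightarrow>
       \<bar>LINT x:ball 0 1|lborel. boundary_term l l0 x\<bar> \<le> M * \<bar>l - l0\<bar>\<^sup>2"
      by (rule boundary_term_integral_bound[OF l0]) blast
    define b where "b = (\<lambda>n. \<kappa> * (LINT x:ball 0 1|lborel. boundary_term (X n) l0 x) / (X n - l0))"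
    have eq: "(?E (X n) - ?E l0) / (X n - l0)
       = sphere_integral (\<lambda>z. indicator upper z * (1 / (X n - l0) * sphere_term (X n) l0 z)) 0 1 + b n" for n
      unfolding energy_difference[OF X(4) l0 \<kappa>] sphere_integral_upper_cmult b_def by (simp add: add_divide_distrib)
    have "b \<longlonglongrightarrow> 0"
    proof (rule tendsto_0_le[where K = "\<bar>\<kappa>\<bar> * M"])
      have "(\<lambda>n. X n - l0) \<longlonglongrightarrow> l0 - l0" by (intro tendsto_diff Xl tendsto_const)
      then show "(\<lambda>n. X n - l0) \<longlonglongrightarrow> 0" by simp
      show "\<forall>\<^sub>F n in sequentially. norm (b n) \<le> norm (X n - l0) * (\<bar>\<kappa>\<bar> * M)"
      proof (rule always_eventually, rule allI)
        fix n
        have nz: "\<bar>X n - l0\<bar> > 0" using X(3)[of n] by simp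
        have "\<bar>\<kappa>\<bar> * \<bar>LINT x:ball 0 1|lborel. boundary_term (X n) l0 x\<bar> \<le> \<bar>\<kappa>\<bar> * (M * \<bar>X n - l0\<bar>\<^sup>2)"
          using X(1,2)[of n] by (intro mult_left_mono M) auto
        also have "\<dots> = (\<bar>X n - l0\<bar> * (\<bar>\<kappa>\<bar> * M)) * \<bar>X n - l0\<bar>" by (simp only: power2_eq_square mult_ac)
        finally show "norm (b n) \<le> norm (X n - l0) * (\<bar>\<kappa>\<bar> * M)"
          unfolding b_def real_norm_def abs_divide abs_mult[of \<kappa>] pos_divide_le_eq[OF nz] .
      qed
    qed
    then have "(\<lambda>n. sphere_integral (\<lambda>z. indicator upper z * (1 / (X n - l0) * sphere_term (X n) l0 z)) 0 1 + b n) \<longlonglongrightarrow> ?D + 0"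
      by (intro tendsto_add sphere_term_limit[OF l0 Xl X(1,2,3)])
    then show "((\<lambda>l. (?E l - ?E l0) / (l - l0)) \<circ> X) \<longlonglongrightarrow> ?D"
      unfolding comp_def eq by simp
  qed
  moreover have "at l0 within {l0 / 2<..<2 * l0} = at l0"
    by (rule at_within_open) (use l0 in auto)
  ultimately show ?thesis by (simp add: has_field_derivative_iff)
qed

end

theorem theorem1p3:
  fixes s p :: real and m :: nat and v :: "nat \<Rightarrow> (real^'n) \<times> real \<Rightarrow> real"
    and x0 :: "(real^'n) \<times> real"
  assumes s: "0 < s" "s < 1" and m: "m \<ge> 1" and p: "p > 1"
    and C2: "\<And>i. i < m \<Longrightarrow> C2_on upper (v i)"
    and cont: "\<And>i. i < m \<Longrightarrow> continuous_on upper_cl (v i)"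
    and cont_dy: "\<And>i. i < m \<Longrightarrow> \<exists>g. continuous_on upper_cl g \<and>
        (\<forall>z\<in>upper. g z = snd z powr (1 - 2 * s) * partial (v i) (0, 1) z)"
    and eq: "\<And>i z. i < m \<Longrightarrow> z \<in> upper \<Longrightarrow>
        (\<Sum>b\<in>Basis. partial (\<lambda>w. snd w powr (1 - 2 * s) * partial (v i) b w) b z) = 0"
    and bdry: "\<And>i x. i < m \<Longrightarrow>
        ((\<lambda>y. - (y powr (1 - 2 * s) * partial (v i) (0, 1) (x, y)))
          \<longlongrightarrow> kappa s * vnorm m v (x, 0) powr (p - 1) * v i (x, 0)) (at_right 0)"
    and x0: "snd x0 = 0"
  shows "mono_on {0<..} (\<lambda>lam. Es s p m v lam x0) \<and>
    (\<forall>lam>0.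
        ((\<lambda>l. Es s p m v l x0) has_real_derivative
          lam powr (2 * s*(p+1)/(p-1) - real CARD('n)) *
          sphere_integral (\<lambda>z. indicator upper z * (snd z powr (1 - 2 * s) *
            (\<Sum>i<m. (partial (v i) ((z - x0) /\<^sub>R norm (z - x0)) z
                      + 2 * s/(p-1) * v i z / norm (z - x0))\<^sup>2))) x0 lam) (at lam))"
proof -
  have flux: "((\<lambda>y. y powr (1 - 2 * s) * partial (v i) (0, 1) (x, y))
      \<longlongrightarrow> - (kappa s * vnorm m v (x, 0) powr (p - 1) * v i (x, 0))) (at_right 0)" if "i < m" for i x
    using tendsto_minus[OF bdry[OF that, of x]] by simp
  have sol: "solves (1 - 2 * s) (v i)" if "i < m" for i
    using C2[OF that] eq[OF that] by (simp add: solves_def)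
  interpret monotonicity s p "kappa s" m v x0
  proof (intro monotonicity.intro extension_system.intro monotonicity_axioms.intro)
    show "0 < s" "s < 1" "1 < p" "snd x0 = 0" by (rule s p x0)+
    show "solves (1 - 2 * s) (v i)" if "i < m" for i by (rule sol[OF that])
    show "continuous_on upper_cl (v i)" if "i < m" for i by (rule cont[OF that])
    show "\<exists>g. continuous_on upper_cl g \<and> (\<forall>z\<in>upper. g z = snd z powr (1 - 2 * s) * partial (v i) (0, 1) z)"
      if "i < m" for i by (rule cont_dy[OF that])
    show "((\<lambda>y. y powr (1 - 2 * s) * partial (v i) (0, 1) (x, y))
      \<longlongrightarrow> - (kappa s * vnorm m v (x, 0) powr (p - 1) * v i (x, 0))) (at_right 0)" if "i < m" for i x
      by (rule flux[OF that])
  qed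
  let ?D = "\<lambda>lam. lam powr (2 * s*(p+1)/(p-1) - real CARD('n)) *
          sphere_integral (\<lambda>z. indicator upper z * (snd z powr (1 - 2 * s) *
            (\<Sum>i<m. (partial (v i) ((z - x0) /\<^sub>R norm (z - x0)) z
                      + 2 * s/(p-1) * v i z / norm (z - x0))\<^sup>2))) x0 lam"
  \<comment> \<open>The derivative was computed on the unit half-sphere; undoing the scaling moves
    it to the sphere of radius \<open>lam\<close> about \<open>x0\<close>.\<close>
  have deriv: "((\<lambda>l. Es s p m v l x0) has_real_derivative ?D lam) (at lam)" if "lam > 0" for lam
    using energy_derivative[OF that refl] unfolding target_rescale[OF that] .
  have nonneg: "?D lam \<ge> 0" if "lam > 0" for lam
    using that unfolding sphere_integral_def set_lebesgue_integral_def
    by (intro mult_nonneg_nonneg Bochner_Integration.integral_nonneg) (auto intro!: mult_nonneg_nonneg sum_nonneg)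
  have "mono_on {0<..} (\<lambda>lam. Es s p m v lam x0)"
  proof (rule mono_onI)
    fix r t :: real assume r: "r \<in> {0<..}" and rt: "r \<le> t"
    show "Es s p m v r x0 \<le> Es s p m v t x0"
    proof (rule DERIV_nonneg_imp_nondecreasing[OF rt])
      fix x assume "r \<le> x" "x \<le> t"
      then have "x > 0" using r by simp
      then show "\<exists>y. ((\<lambda>lam. Es s p m v lam x0) has_real_derivative y) (at x) \<and> 0 \<le> y"
        using deriv nonneg by blast
    qed
  qed
  then show ?thesis using deriv by blast
qed

end
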